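(* Let $f(x)\in\mathbb{Z}[x]$ be a monic irreducible monogenic polynomial, let $N$ be a positive integer that is not a perfect power, and let $a(x)\in\mathbb{Z}[x]$ be a monic polynomial that is a factor of $f(x)$ over $\mathbb{Z}/N$. Then in polynomial time we can either find a non-trivial factor of $N$, or find a monic integral polynomial $\tilde a(x)\in\mathbb{Z}[x]$ such that $f(x)$ can be written as $$f(x)=\tilde f_1(x)\,N+\tilde a(x)\,\tilde A(x),\qquad \tilde f_1(x),\tilde A(x)\in\mathbb{Z}[x],$$ with $a(x)\equiv\tilde a(x)\pmod N$ and $(\tilde a(x),\tilde f_1(x),N)=1$ in $\mathbb{Z}[x]$.
   Context: A monic irreducible $f\in\mathbb{Z}[x]$ is called monogenic if $[O_K:\mathbb{Z}[x]/(f)]=1$, where $K=\mathbb{Q}[x]/(f)$ and $O_K$ is its ring of integers. "$(g,h,N)=1$ in $\mathbb{Z}[x]$" means that the ideal of $\mathbb{Z}[x]$ generated by $g,h,N$ is the whole ring. "Factor of $f$ over $\mathbb{Z}/N$" means that its reduction divides the reduction of $f$ in $(\mathbb{Z}/N)[x]$. *)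

theory Defs
  imports
    "HOL-Number_Theory.Residues"
    "HOL-Algebra.UnivPoly"
    "HOL-Algebra.QuotRing"
    "HOL-Algebra.Divisibility"
    "HOL-Decision_Procs.Algebra_Aux"
    "HOL-Computational_Algebra.Computational_Algebra"
    "HOL-Library.Log_Nat"
begin

section \<open>Monogenic polynomials\<close>

text \<open>
  \<^const>\<open>cring_class_ops\<close> is the HOL-Algebra ring given by the operations of a type class.
  Below, elements of the quotient of the rational polynomials by \<open>f\<close> are cosets.
\<close>

definition principal_ideal :: "int poly \<Rightarrow> rat poly set" where
  "principal_ideal f = PIdl\<^bsub>cring_class_ops\<^esub> (map_poly of_int f)"

definition number_field :: "int poly \<Rightarrow> rat poly set ring" where
  "number_field f = cring_class_ops Quot principal_ideal f"

definition eval_int_poly :: "('a, 'b) ring_scheme \<Rightarrow> int poly \<Rightarrow> 'a \<Rightarrow> 'a" where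
  "eval_int_poly R p z =
     (\<Oplus>\<^bsub>R\<^esub>i\<in>{..Polynomial.degree p}. [Polynomial.coeff p i] \<cdot>\<^bsub>R\<^esub> (z [^]\<^bsub>R\<^esub> i))"

definition ring_of_integers :: "int poly \<Rightarrow> rat poly set set" where
  "ring_of_integers f =
     {z \<in> carrier (number_field f).
        \<exists>p. lead_coeff p = 1 \<and> eval_int_poly (number_field f) p z = \<zero>\<^bsub>number_field f\<^esub>}"

text \<open>The image of \<open>\<int>[x]\<close> in the field, which for monic \<open>f\<close> is a copy of \<open>\<int>[x]/(f)\<close>:\<close>

definition equation_order :: "int poly \<Rightarrow> rat poly set set" where
  "equation_order f = range (\<lambda>q. principal_ideal f +>\<^bsub>cring_class_ops\<^esub> map_poly of_int q)"

text \<open>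
  The index of additive groups is a number of cosets; since \<^const>\<open>card\<close> is 0 on infinite sets,
  an infinite index is not 1.
\<close>

definition monogenic :: "int poly \<Rightarrow> bool" where
  "monogenic f \<longleftrightarrow>
     card (a_rcosets\<^bsub>(number_field f)\<lparr>carrier := ring_of_integers f\<rparr>\<^esub> (equation_order f)) = 1"


section \<open>Polynomials modulo \<open>N\<close>\<close>

definition reduce_poly :: "int \<Rightarrow> int poly \<Rightarrow> nat \<Rightarrow> int" where
  "reduce_poly N p = (\<lambda>i. Polynomial.coeff p i mod N)"

text \<open>\<^const>\<open>residue_ring\<close> \<open>N\<close> is a ring only for \<open>N > 1\<close>; \<open>N = 1\<close> is a perfect power.\<close>

definition factor_mod :: "int \<Rightarrow> int poly \<Rightarrow> int poly \<Rightarrow> bool" where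
  "factor_mod N a f \<longleftrightarrow>
     reduce_poly N a divides\<^bsub>UP (residue_ring N)\<^esub> reduce_poly N f"

definition perfect_power :: "int \<Rightarrow> bool" where
  "perfect_power N \<longleftrightarrow> (\<exists>k\<ge>2. is_nth_power k N)"

definition coprime_in_Zx :: "int poly \<Rightarrow> int poly \<Rightarrow> int \<Rightarrow> bool" where
  "coprime_in_Zx g h N \<longleftrightarrow> Idl\<^bsub>cring_class_ops\<^esub> {g, h, [:N:]} = UNIV"


section \<open>Polynomial time\<close>

text \<open>
  A deterministic sequential machine model with the logarithmic cost criterion. Data are binary
  trees with integers at the leaves; a program transforms one datum into another. Every instruction
  and every control step is charged at least the bit size of the datum it acts on, and instructions
  and pairings also the bit size of their result. The instructions are computable in polynomial
  time in these sizes, so that polynomial time in this model is polynomial time on a multitape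
  Turing machine.
\<close>

datatype val = Num int | Pair val val

fun bitsize :: "val \<Rightarrow> nat" where
  "bitsize (Num k) = 2 + floorlog 2 (nat \<bar>k\<bar>)"
| "bitsize (Pair u v) = 1 + bitsize u + bitsize v"

datatype instr = Id | Const int | Fst | Snd | IsPair | Add | Sub | Mul | Quo | Rem | Less

text \<open>A result \<^const>\<open>None\<close> means that the machine is stuck, so that the program has no run.\<close>

fun step :: "instr \<Rightarrow> val \<Rightarrow> val option" where
  "step Id v = Some v"
| "step (Const k) _ = Some (Num k)"
| "step Fst (Pair u v) = Some u"
| "step Snd (Pair u v) = Some v"
| "step IsPair (Pair u v) = Some (Num 1)"
| "step IsPair (Num _) = Some (Num 0)"
| "step Add (Pair (Num k) (Num l)) = Some (Num (k + l))"
| "step Sub (Pair (Num k) (Num l)) = Some (Num (k - l))"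
| "step Mul (Pair (Num k) (Num l)) = Some (Num (k * l))"
| "step Quo (Pair (Num k) (Num l)) = Some (Num (k div l))"
| "step Rem (Pair (Num k) (Num l)) = Some (Num (k mod l))"
| "step Less (Pair (Num k) (Num l)) = Some (Num (if k < l then 1 else 0))"
| "step _ _ = None"

datatype prog =
    Do instr
  | Seq prog prog
  | Fork prog prog
  | Cond prog prog prog
  | While prog prog

text \<open>
  \<open>run P v t w\<close>: started on \<open>v\<close>, the program \<open>P\<close> stops after time \<open>t\<close> with result \<open>w\<close>.
  \<open>Fork\<close> pairs the results of two programs run on the same datum. The first argument of \<open>Cond\<close> and
  \<open>While\<close> is a test, run on a copy of the datum; a non-zero integer means true.
\<close>

inductive run :: "prog \<Rightarrow> val \<Rightarrow> nat \<Rightarrow> val \<Rightarrow> bool" where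
  Do: "step i v = Some w \<Longrightarrow> run (Do i) v (bitsize v + bitsize w) w"
| Seq: "run P u s v \<Longrightarrow> run Q v t w \<Longrightarrow> run (Seq P Q) u (bitsize u + s + t) w"
| Fork: "run P u s v \<Longrightarrow> run Q u t w \<Longrightarrow>
    run (Fork P Q) u (bitsize u + s + t + bitsize (Pair v w)) (Pair v w)"
| CondT: "run B u r (Num k) \<Longrightarrow> k \<noteq> 0 \<Longrightarrow> run P u t w \<Longrightarrow>
    run (Cond B P Q) u (bitsize u + r + t) w"
| CondF: "run B u r (Num 0) \<Longrightarrow> run Q u t w \<Longrightarrow>
    run (Cond B P Q) u (bitsize u + r + t) w"
| WhileT: "run B u r (Num k) \<Longrightarrow> k \<noteq> 0 \<Longrightarrow> run P u s v \<Longrightarrow> run (While B P) v t w \<Longrightarrow>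
    run (While B P) u (bitsize u + r + s + t) w"
| WhileF: "run B u r (Num 0) \<Longrightarrow> run (While B P) u (bitsize u + r) u"

lemma run_deterministic:
  "run P v t w \<Longrightarrow> run P v t' w' \<Longrightarrow> t' = t \<and> w' = w"
proof (induction arbitrary: t' w' rule: run.induct)
  case (Do i v w)
  from Do.prems Do.hyps show ?case by cases auto
next
  case (Seq P u s v Q t w)
  from Seq.prems show ?case by cases (use Seq.IH in blast)
next
  case (Fork P u s v Q t w)
  from Fork.prems show ?case by cases (use Fork.IH in blast)
next
  case (CondT B u r k P t w Q)
  from CondT.prems show ?case by cases (use CondT.IH CondT.hyps in blast)+
next
  case (CondF B u r Q t w P)
  from CondF.prems show ?case by cases (use CondF.IH in blast)+
next
  case (WhileT B u r k P s v t w)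
  from WhileT.prems show ?case by cases (use WhileT.IH WhileT.hyps in blast)+
next
  case (WhileF B u r P)
  from WhileF.prems show ?case by cases (use WhileF.IH in blast)+
qed

fun encode_list :: "int list \<Rightarrow> val" where
  "encode_list [] = Num 0"
| "encode_list (k # ks) = Pair (Num k) (encode_list ks)"

text \<open>Dense representation, constant coefficient first.\<close>

definition encode_poly :: "int poly \<Rightarrow> val" where
  "encode_poly p = encode_list (coeffs p)"

definition encode_input :: "int poly \<Rightarrow> int \<Rightarrow> int poly \<Rightarrow> val" where
  "encode_input f N a = Pair (encode_poly f) (Pair (Num N) (encode_poly a))"

text \<open>A program returns either an integer or a polynomial.\<close>

fun encode_output :: "int + int poly \<Rightarrow> val" where
  "encode_output (Inl d) = Pair (Num 0) (Num d)"
| "encode_output (Inr p) = Pair (Num 1) (encode_poly p)"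

end

theory Submission
  imports Defs "Jordan_Normal_Form.Char_Poly"
begin

text \<open>
  Divide \<open>f\<close> by the monic polynomial \<open>a\<close> over the integers. The remainder is divisible by \<open>N\<close>, so that
  \<open>f = a A + N b\<close>, and \<open>f = (b - s A) N + (a + N s) A\<close> for every \<open>s\<close>.
  So \<open>a + N s\<close> and \<open>b - s A\<close> are as wanted if \<open>s\<close> has smaller degree than \<open>a\<close> and \<open>b - s A\<close> avoids all
  prime ideals \<open>(p, g)\<close> of \<open>\<int>[x]\<close> that contain \<open>N\<close> and \<open>a\<close>.

  Here monogenicity comes in. By Dedekind's criterion (\<open>monogenic_not_in_square\<close>), \<open>f\<close> is in the square
  of no such ideal; for an ideal that contains \<open>a\<close> and \<open>b\<close> it follows that it does not contain \<open>A\<close>.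
  Hence \<open>b - s A\<close> avoids an ideal that contains \<open>b\<close> if and only if \<open>s\<close> does, and it avoids an ideal
  that does not contain \<open>b\<close> whenever \<open>s\<close> is in the ideal. The part of \<open>a\<close> that is coprime to \<open>b\<close>
  modulo \<open>N\<close> has the required behaviour. It is the end of the chain \<open>e\<^sub>0 = a\<close>,
  \<open>e\<^sub>i\<^sub>+\<^sub>1 = e\<^sub>i / gcd(e\<^sub>i, b)\<close>, which becomes stationary after at most \<open>deg a\<close> steps
  (\<open>coprime_lift\<close>); subtracting a multiple of \<open>a\<close> makes the degree small enough.

  The gcds are meant modulo \<open>N\<close>, as if \<open>N\<close> were prime. Euclid's algorithm fails only if it meets a
  leading coefficient that is neither 0 nor a unit modulo \<open>N\<close>, and then the gcd of this coefficient and
  \<open>N\<close> is a non-trivial factor of \<open>N\<close>. If it does not fail, it works modulo all prime factors of \<open>N\<close>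
  simultaneously (\<open>cofactor_correct\<close>). Besides the gcd, Euclid's algorithm yields the quotient
  \<open>e\<^sub>i / gcd(e\<^sub>i, b)\<close> as the cofactor of \<open>b\<close> at the point where the remainder vanishes.

  That a program with polynomial running time exists is derived from closure properties of the relation
  \<open>ptime\<close>. Numbers are reduced modulo \<open>N\<close> or \<open>N\<^sup>2\<close> in the course of the computation, and lists are at most
  twice as long as the input; this bounds the states of the loops.
\<close>

section \<open>Polynomial time\<close>

lemma floorlog2_le_iff: "floorlog 2 n \<le> m \<longleftrightarrow> n < 2 ^ m"
proof (cases "n = 0")
  case False
  show ?thesis
  proof
    assume "floorlog 2 n \<le> m"
    moreover have "n < 2 ^ floorlog 2 n" using floorlog_bounds[of n 2] False by simp
    ultimately show "n < 2 ^ m" by (meson less_le_trans one_le_numeral power_increasing)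
  next
    assume "n < 2 ^ m"
    moreover have "2 ^ (floorlog 2 n - 1) \<le> n" using floorlog_bounds[of n 2] False by simp
    ultimately have "(2::nat) ^ (floorlog 2 n - 1) < 2 ^ m" by linarith
    hence "floorlog 2 n - 1 < m" by simp
    thus "floorlog 2 n \<le> m" by linarith
  qed
qed (simp add: floorlog_def)

lemma bitsize_pos: "1 \<le> bitsize v"
  by (cases v) auto

lemma bitsize_Num_mono: "\<bar>k\<bar> \<le> \<bar>l\<bar> \<Longrightarrow> bitsize (Num k) \<le> bitsize (Num l)"
  by (simp add: floorlog_mono)

lemma bitsize_Num_add: "bitsize (Num (k + l)) \<le> bitsize (Num k) + bitsize (Num l)"
proof -
  let ?b = "\<lambda>j::int. floorlog 2 (nat \<bar>j\<bar>)"
  have "nat \<bar>k\<bar> < 2 ^ ?b k" "nat \<bar>l\<bar> < 2 ^ ?b l" using floorlog2_le_iff by blast+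
  moreover have "(2::nat) ^ ?b k \<le> 2 ^ (?b k + ?b l)" "(2::nat) ^ ?b l \<le> 2 ^ (?b k + ?b l)"
    by (auto intro: power_increasing)
  moreover have "nat \<bar>k + l\<bar> \<le> nat \<bar>k\<bar> + nat \<bar>l\<bar>" by linarith
  ultimately have "nat \<bar>k + l\<bar> < 2 ^ (?b k + ?b l) + 2 ^ (?b k + ?b l)" by linarith
  hence "nat \<bar>k + l\<bar> < 2 ^ (?b k + ?b l + 1)" by simp
  hence "?b (k + l) \<le> ?b k + ?b l + 1" using floorlog2_le_iff by blast
  thus ?thesis by simp
qed

lemma bitsize_Num_mult: "bitsize (Num (k * l)) \<le> bitsize (Num k) + bitsize (Num l)"
proof -
  let ?b = "\<lambda>j::int. floorlog 2 (nat \<bar>j\<bar>)"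
  have "nat \<bar>k\<bar> < 2 ^ ?b k" "nat \<bar>l\<bar> < 2 ^ ?b l" using floorlog2_le_iff by blast+
  hence "nat \<bar>k\<bar> * nat \<bar>l\<bar> < 2 ^ ?b k * 2 ^ ?b l" by (intro mult_strict_mono') auto
  hence "nat \<bar>k * l\<bar> < 2 ^ (?b k + ?b l)" by (simp add: abs_mult nat_mult_distrib power_add)
  hence "?b (k * l) \<le> ?b k + ?b l" using floorlog2_le_iff by blast
  thus ?thesis by simp
qed

lemma abs_div_le: "\<bar>k div l\<bar> \<le> \<bar>k::int\<bar>"
proof (cases "l = 0 \<or> k div l = 0")
  case False
  have "l * (k div l) = k - k mod l" by (simp add: minus_mod_eq_mult_div)
  hence "\<bar>l\<bar> * \<bar>k div l\<bar> = \<bar>k - k mod l\<bar>" by (metis abs_mult)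
  hence "\<bar>l\<bar> * (\<bar>k div l\<bar> - 1) < \<bar>k\<bar>"
    using abs_mod_less[of l k] False by (simp add: algebra_simps)
  moreover have "1 * (\<bar>k div l\<bar> - 1) \<le> \<bar>l\<bar> * (\<bar>k div l\<bar> - 1)"
    using False by (intro mult_right_mono) auto
  ultimately have "\<bar>k div l\<bar> - 1 < \<bar>k\<bar>" by (metis le_less_trans mult_1)
  thus ?thesis by simp
qed auto

lemma abs_mod_le: "\<bar>k mod l\<bar> \<le> \<bar>k\<bar> + \<bar>l::int\<bar>"
proof (cases "l = 0")
  case False
  then show ?thesis using abs_mod_less[of l k] by linarith
qed simp

lemma bitsize_Num_div: "bitsize (Num (k div l)) \<le> bitsize (Num k)"
  by (intro bitsize_Num_mono abs_div_le)

lemma bitsize_Num_mod: "bitsize (Num (k mod l)) \<le> bitsize (Num k) + bitsize (Num l)"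
proof -
  have "bitsize (Num (k mod l)) \<le> bitsize (Num (\<bar>k\<bar> + \<bar>l\<bar>))"
    using abs_mod_le[of k l] by (intro bitsize_Num_mono) simp
  also have "\<dots> \<le> bitsize (Num \<bar>k\<bar>) + bitsize (Num \<bar>l\<bar>)" by (rule bitsize_Num_add)
  finally show ?thesis by simp
qed

text \<open>
  A given instruction enlarges its argument by at most a constant. A bound on the time of a
  program thus follows from bounds on the sizes of the data between its instructions.
\<close>

lemma bitsize_step:
  assumes "step i v = Some w"
  shows "bitsize w \<le> bitsize v + bitsize (Num (case i of Const k \<Rightarrow> k | _ \<Rightarrow> 1))"
proof -
  have two: "2 \<le> bitsize (Num k)" for k by simp
  have less: "bitsize (Num (if b then 1 else 0)) \<le> 3" for b by (simp add: floorlog_def)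
  have neg: "bitsize (Num (- k)) = bitsize (Num k)" for k by simp
  show ?thesis
  proof (cases "\<exists>k l. v = Pair (Num k) (Num l)")
    case True
    then obtain k l where v: "v = Pair (Num k) (Num l)" by blast
    have *: "bitsize (Num (k + l)) \<le> bitsize v" "bitsize (Num (k - l)) \<le> bitsize v"
      "bitsize (Num (k * l)) \<le> bitsize v" "bitsize (Num (k div l)) \<le> bitsize v"
      "bitsize (Num (k mod l)) \<le> bitsize v" "bitsize (Num k) \<le> bitsize v" "bitsize (Num l) \<le> bitsize v"
      "3 \<le> bitsize v" "\<And>b. bitsize (Num (if b then 1 else 0)) \<le> bitsize v"
      using bitsize_Num_add[of k l] bitsize_Num_add[of k "- l"] bitsize_Num_mult[of k l]
        bitsize_Num_div[of k l] bitsize_Num_mod[of k l] two[of k] two[of l] neg[of l]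
      unfolding v bitsize.simps(2) by (simp_all del: bitsize.simps add: le_trans[OF less])
    show ?thesis
    proof (cases i)
      case (Const c)
      then show ?thesis using assms by simp
    next
      case Less
      with assms v have "w = Num (if k < l then 1 else 0)" by simp
      then show ?thesis using *(9) trans_le_add1 by blast
    qed (use assms * in \<open>simp_all add: v trans_le_add1 del: bitsize.simps\<close>)
  next
    case False
    have three: "3 \<le> bitsize (Pair a b)" for a b
      using bitsize_pos[of a] bitsize_pos[of b] by simp
    have *: "2 \<le> bitsize v" using two three[THEN le_trans[rotated]] by (cases v) (simp_all del: bitsize.simps)
    show ?thesis
      using assms False * three by (cases "(i, v)" rule: step.cases) (auto simp: floorlog_def)
  qed
qed

lemma bitsize_run: "run P v t w \<Longrightarrow> bitsize w \<le> t"
  by (induction rule: run.induct) auto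

lemma poly_nat_mono: "a \<le> b \<Longrightarrow> poly (T :: nat poly) a \<le> poly T b"
  by (induction T) (auto intro: add_mono mult_mono)

text \<open>
  The polynomial depends on \<open>D\<close>, \<open>m\<close> and \<open>b\<close>, but not on
  the point of \<open>D\<close>.
\<close>

definition pbounded :: "'x set \<Rightarrow> ('x \<Rightarrow> nat) \<Rightarrow> ('x \<Rightarrow> nat) \<Rightarrow> bool" where
  "pbounded D m b \<longleftrightarrow> (\<exists>T. \<forall>x\<in>D. b x \<le> poly T (m x))"

lemma pbounded_self: "pbounded D m m"
  unfolding pbounded_def by (rule exI[of _ "[:0,1:]"]) simp

lemma pbounded_const: "pbounded D m (\<lambda>_. c)"
  unfolding pbounded_def by (rule exI[of _ "[:c:]"]) simp

lemma pbounded_add: "pbounded D m b \<Longrightarrow> pbounded D m c \<Longrightarrow> pbounded D m (\<lambda>x. b x + c x)"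
  unfolding pbounded_def by (metis add_mono poly_add)

lemma pbounded_mult: "pbounded D m b \<Longrightarrow> pbounded D m c \<Longrightarrow> pbounded D m (\<lambda>x. b x * c x)"
  unfolding pbounded_def by (metis mult_le_mono poly_mult)

lemma pbounded_mono: "pbounded D m b \<Longrightarrow> (\<And>x. x \<in> D \<Longrightarrow> c x \<le> b x) \<Longrightarrow> pbounded D m c"
  unfolding pbounded_def by (meson le_trans)

lemma pbounded_trans: "pbounded D m b \<Longrightarrow> pbounded D b c \<Longrightarrow> pbounded D m c"
proof -
  assume "pbounded D m b" "pbounded D b c"
  then obtain S T where S: "\<And>x. x \<in> D \<Longrightarrow> b x \<le> poly S (m x)" and T: "\<And>x. x \<in> D \<Longrightarrow> c x \<le> poly T (b x)"
    unfolding pbounded_def by blast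
  have "c x \<le> poly (pcompose T S) (m x)" if "x \<in> D" for x
    using T[OF that] poly_nat_mono[OF S[OF that], of T] by (simp add: poly_pcompose)
  thus "pbounded D m c" unfolding pbounded_def by blast
qed

lemma pbounded_poly: "pbounded D m b \<Longrightarrow> pbounded D m (\<lambda>x. poly T (b x))"
  by (erule pbounded_trans) (auto simp: pbounded_def)

text \<open>
  One program turns \<open>u x\<close> into \<open>w x\<close> for all \<open>x \<in> D\<close>.
  Families indexed by \<open>x\<close> replace functions on \<^typ>\<open>val\<close>: what the
  machine computes can be written as an ordinary term in \<open>x\<close>, nothing has to be
  decoded, and preconditions of a program become part of \<open>D\<close>. The rules below are
  applied backwards with \<open>u\<close> fixed, so that a term is shown to be computable by
  following its syntax; the program itself is never written down.
\<close>

definition ptime :: "'x set \<Rightarrow> ('x \<Rightarrow> val) \<Rightarrow> ('x \<Rightarrow> val) \<Rightarrow> bool" where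
  "ptime D u w \<longleftrightarrow>
     (\<exists>P T. \<forall>x\<in>D. \<exists>t. run P (u x) t (w x) \<and> t \<le> poly T (bitsize (u x)))"

abbreviation psize :: "'x set \<Rightarrow> ('x \<Rightarrow> val) \<Rightarrow> ('x \<Rightarrow> nat) \<Rightarrow> bool" where
  "psize D u b \<equiv> pbounded D (\<lambda>x. bitsize (u x)) b"

lemma ptimeI:
  assumes "\<And>x. x \<in> D \<Longrightarrow> run P (u x) (t x) (w x)" "psize D u t"
  shows "ptime D u w"
  using assms unfolding ptime_def pbounded_def by blast

lemma ptimeE:
  assumes "ptime D u w"
  obtains P t where "\<And>x. x \<in> D \<Longrightarrow> run P (u x) (t x) (w x)" "psize D u t"
proof -
  from assms obtain P T where
    *: "\<And>x. x \<in> D \<Longrightarrow> \<exists>t. run P (u x) t (w x) \<and> t \<le> poly T (bitsize (u x))"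
    unfolding ptime_def by blast
  define t where "t x = (SOME t. run P (u x) t (w x) \<and> t \<le> poly T (bitsize (u x)))" for x
  have "run P (u x) (t x) (w x) \<and> t x \<le> poly T (bitsize (u x))" if "x \<in> D" for x
    unfolding t_def using someI_ex[OF *[OF that]] .
  thus ?thesis using that[of P t] unfolding pbounded_def by blast
qed

lemma ptime_size: "ptime D u w \<Longrightarrow> psize D u (\<lambda>x. bitsize (w x))"
  by (erule ptimeE) (blast intro: pbounded_mono bitsize_run)

lemma ptime_cong:
  "ptime D u v \<Longrightarrow> (\<And>x. x \<in> D \<Longrightarrow> w x = v x) \<Longrightarrow> ptime D u w"
  unfolding ptime_def by fastforce

lemma ptime_subset: "ptime D u w \<Longrightarrow> E \<subseteq> D \<Longrightarrow> ptime E u w"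
  unfolding ptime_def by blast

lemma ptime_reindex:
  "ptime D u w \<Longrightarrow> h ` E \<subseteq> D \<Longrightarrow> ptime E (\<lambda>x. u (h x)) (\<lambda>x. w (h x))"
  unfolding ptime_def by blast

lemma ptime_Do: 
  assumes "\<And>x. x \<in> D \<Longrightarrow> step i (u x) = Some (w x)"
  shows "ptime D u w"
proof (rule ptimeI)
  show "run (Do i) (u x) (bitsize (u x) + bitsize (w x)) (w x)" if "x \<in> D" for x
    using assms that by (intro run.Do)
  show "psize D u (\<lambda>x. bitsize (u x) + bitsize (w x))"
    using bitsize_step[OF assms]
    by (intro pbounded_add pbounded_self pbounded_mono[OF pbounded_add[OF pbounded_self pbounded_const]])
qed

lemma ptime_id: "ptime D u u"
  by (rule ptime_Do[where i = Id]) simp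

lemma ptime_Num: "ptime D u (\<lambda>_. Num k)"
  by (rule ptime_Do[where i = "Const k"]) simp

lemma ptime_trans:
  assumes "ptime D u v" "ptime D v w"
  shows "ptime D u w"
proof -
  obtain P s where P: "\<And>x. x \<in> D \<Longrightarrow> run P (u x) (s x) (v x)" "psize D u s"
    using ptimeE[OF assms(1)] by blast
  obtain Q t where Q: "\<And>x. x \<in> D \<Longrightarrow> run Q (v x) (t x) (w x)" "psize D v t"
    using ptimeE[OF assms(2)] by blast
  note * = P Q
  show ?thesis
  proof (rule ptimeI)
    show "run (Seq P Q) (u x) (bitsize (u x) + s x + t x) (w x)" if "x \<in> D" for x
      using * that by (intro run.Seq)
    show "psize D u (\<lambda>x. bitsize (u x) + s x + t x)"
      using * pbounded_trans[OF ptime_size[OF assms(1)]] by (intro pbounded_add pbounded_self)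
  qed
qed

lemma ptime_Pair:
  assumes "ptime D u v" "ptime D u w"
  shows "ptime D u (\<lambda>x. Pair (v x) (w x))"
proof -
  obtain P s where P: "\<And>x. x \<in> D \<Longrightarrow> run P (u x) (s x) (v x)" "psize D u s"
    using ptimeE[OF assms(1)] by blast
  obtain Q t where Q: "\<And>x. x \<in> D \<Longrightarrow> run Q (u x) (t x) (w x)" "psize D u t"
    using ptimeE[OF assms(2)] by blast
  note * = P Q
  show ?thesis
  proof (rule ptimeI)
    show "run (Fork P Q) (u x) (bitsize (u x) + s x + t x + bitsize (Pair (v x) (w x))) (Pair (v x) (w x))"
      if "x \<in> D" for x using * that by (intro run.Fork)
    show "psize D u (\<lambda>x. bitsize (u x) + s x + t x + bitsize (Pair (v x) (w x)))"
      using *(2,4) ptime_size[OF assms(1)] ptime_size[OF assms(2)] unfolding bitsize.simps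
      by (intro pbounded_add pbounded_self pbounded_const)
  qed
qed

lemma ptime_fst: "ptime D u (\<lambda>x. Pair (v x) (w x)) \<Longrightarrow> ptime D u v"
  by (erule ptime_trans) (rule ptime_Do[where i = Fst], simp)

lemma ptime_snd: "ptime D u (\<lambda>x. Pair (v x) (w x)) \<Longrightarrow> ptime D u w"
  by (erule ptime_trans) (rule ptime_Do[where i = Snd], simp)

lemma ptime_proj_fst: "ptime D (\<lambda>x. Pair (v x) (w x)) v"
  by (rule ptime_fst[OF ptime_id])

lemma ptime_proj_snd: "ptime D (\<lambda>x. Pair (v x) (w x)) w"
  by (rule ptime_snd[OF ptime_id])

text \<open>
  With these rules, \<open>rule\<close> finds the components of a tuple that is nested to the
  right, which is how the variables of a loop are stored.
\<close>

lemmas ptime_proj = ptime_proj_fst ptime_proj_snd ptime_trans[OF ptime_proj_snd]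

lemma
  assumes "ptime D u (\<lambda>x. Num (k x))" "ptime D u (\<lambda>x. Num (l x))"
  shows ptime_add: "ptime D u (\<lambda>x. Num (k x + l x))"
    and ptime_diff: "ptime D u (\<lambda>x. Num (k x - l x))"
    and ptime_mult: "ptime D u (\<lambda>x. Num (k x * l x))"
    and ptime_div: "ptime D u (\<lambda>x. Num (k x div l x))"
    and ptime_mod: "ptime D u (\<lambda>x. Num (k x mod l x))"
    and ptime_less: "ptime D u (\<lambda>x. Num (if k x < l x then 1 else 0))"
  by (rule ptime_trans[OF ptime_Pair[OF assms] ptime_Do[where i = Add]]
        ptime_trans[OF ptime_Pair[OF assms] ptime_Do[where i = Sub]]
        ptime_trans[OF ptime_Pair[OF assms] ptime_Do[where i = Mul]]
        ptime_trans[OF ptime_Pair[OF assms] ptime_Do[where i = Quo]]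
        ptime_trans[OF ptime_Pair[OF assms] ptime_Do[where i = Rem]]
        ptime_trans[OF ptime_Pair[OF assms] ptime_Do[where i = Less]], simp)+

lemma ptime_cond:
  assumes "ptime D u (\<lambda>x. Num (b x))"
    and "ptime {x \<in> D. b x \<noteq> 0} u v" "ptime {x \<in> D. b x = 0} u w"
  shows "ptime D u (\<lambda>x. if b x \<noteq> 0 then v x else w x)"
proof -
  obtain B r where B: "\<And>x. x \<in> D \<Longrightarrow> run B (u x) (r x) (Num (b x))" "psize D u r"
    using ptimeE[OF assms(1)] by blast
  obtain P s where
    P: "\<And>x. x \<in> {x \<in> D. b x \<noteq> 0} \<Longrightarrow> run P (u x) (s x) (v x)" "psize {x \<in> D. b x \<noteq> 0} u s"
    using ptimeE[OF assms(2)] by blast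
  obtain Q t where
    Q: "\<And>x. x \<in> {x \<in> D. b x = 0} \<Longrightarrow> run Q (u x) (t x) (w x)" "psize {x \<in> D. b x = 0} u t"
    using ptimeE[OF assms(3)] by blast
  show ?thesis
  proof (rule ptimeI)
    show "run (Cond B P Q) (u x) (bitsize (u x) + r x + (if b x \<noteq> 0 then s x else t x))
       (if b x \<noteq> 0 then v x else w x)" if "x \<in> D" for x
      using that B(1) P(1) Q(1) run.CondT[of B "u x" "r x" "b x"] run.CondF[of B "u x" "r x"]
      by (cases "b x = 0") (auto, fastforce)
    from P(2) Q(2) obtain S T where ST: "\<And>x. x \<in> D \<Longrightarrow> b x \<noteq> 0 \<Longrightarrow> s x \<le> poly S (bitsize (u x))"
      "\<And>x. x \<in> D \<Longrightarrow> b x = 0 \<Longrightarrow> t x \<le> poly T (bitsize (u x))"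
      unfolding pbounded_def by blast
    have "psize D u (\<lambda>x. if b x \<noteq> 0 then s x else t x)"
      unfolding pbounded_def using ST by (intro exI[of _ "S + T"]) (fastforce intro: trans_le_add1 trans_le_add2)
    thus "psize D u (\<lambda>x. bitsize (u x) + r x + (if b x \<noteq> 0 then s x else t x))"
      using B(2) by (intro pbounded_add pbounded_self)
  qed
qed

lemma ptime_if_less:
  assumes "ptime D u (\<lambda>x. Num (k x))" "ptime D u (\<lambda>x. Num (l x))"
    and "ptime {x \<in> D. k x < l x} u v" "ptime {x \<in> D. \<not> k x < l x} u w"
  shows "ptime D u (\<lambda>x. if k x < l x then v x else w x)"
  by (rule ptime_cong[OF ptime_cond[OF ptime_less[OF assms(1,2)], of v w]])
     (auto intro: ptime_subset[OF assms(3)] ptime_subset[OF assms(4)])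

lemma ptime_if_eq:
  assumes "ptime D u (\<lambda>x. Num (k x))"
    and "ptime {x \<in> D. k x \<noteq> l} u w" "ptime {x \<in> D. k x = l} u v"
  shows "ptime D u (\<lambda>x. if k x = l then v x else w x)"
  by (rule ptime_cong[OF ptime_cond[OF ptime_diff[OF assms(1) ptime_Num[of _ _ l]], of w v]])
     (auto intro: ptime_subset[OF assms(2)] ptime_subset[OF assms(3)])

lemma run_While:
  assumes "\<And>i. i \<le> k \<Longrightarrow> run B (s i) (r i) (Num (b i))"
    and "\<And>i. i < k \<Longrightarrow> b i \<noteq> 0" "b k = 0"
    and "\<And>i. i < k \<Longrightarrow> run P (s i) (t i) (s (Suc i))"
  shows "run (While B P) (s 0) ((\<Sum>i<k. bitsize (s i) + r i + t i) + (bitsize (s k) + r k)) (s k)"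
  using assms
proof (induction k arbitrary: s r b t)
  case 0
  then show ?case using run.WhileF[of B "s 0" "r 0" P] by force
next
  case (Suc k)
  have "run (While B P) (s (Suc 0)) ((\<Sum>i<k. bitsize (s (Suc i)) + r (Suc i) + t (Suc i)) +
      (bitsize (s (Suc k)) + r (Suc k))) (s (Suc k))"
    by (rule Suc.IH[where b = "\<lambda>i. b (Suc i)"]) (use Suc.prems in auto)
  from run.WhileT[OF Suc.prems(1)[of 0] Suc.prems(2)[of 0] Suc.prems(4)[of 0] this]
  show ?case unfolding sum.lessThan_Suc_shift by (simp add: ac_simps)
qed

text \<open>
  The states \<open>s x 0, \<dots>, s x (k x)\<close> that the loop runs through are given
  beforehand. Their sizes must be bounded for all rounds together, in terms of the input: a
  bound on the growth in one round would be compounded to an exponential one.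
\<close>

lemma ptime_loop:
  assumes init: "ptime D u (\<lambda>x. s x 0)"
    and test: "ptime (SIGMA x:D. {..k x}) (\<lambda>y. s (fst y) (snd y)) (\<lambda>y. Num (b (fst y) (snd y)))"
    and body: "ptime (SIGMA x:D. {..<k x}) (\<lambda>y. s (fst y) (snd y)) (\<lambda>y. s (fst y) (Suc (snd y)))"
    and b: "\<And>x i. x \<in> D \<Longrightarrow> i \<le> k x \<Longrightarrow> b x i \<noteq> 0 \<longleftrightarrow> i < k x"
    and iterations: "psize D u k"
    and bounded: "psize D u m" "\<And>x i. x \<in> D \<Longrightarrow> i \<le> k x \<Longrightarrow> bitsize (s x i) \<le> m x"
  shows "ptime D u (\<lambda>x. s x (k x))"
proof -
  let ?I = "SIGMA x:D. {..k x}" and ?J = "SIGMA x:D. {..<k x}"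
  obtain B r where B: "\<And>y. y \<in> ?I \<Longrightarrow> run B (s (fst y) (snd y)) (r y) (Num (b (fst y) (snd y)))"
    and Br: "pbounded ?I (\<lambda>y. bitsize (s (fst y) (snd y))) r"
    using ptimeE[OF test] by blast
  obtain R where rR: "\<And>y. y \<in> ?I \<Longrightarrow> r y \<le> poly R (bitsize (s (fst y) (snd y)))"
    using Br unfolding pbounded_def by blast
  have r: "run B (s x i) (r (x, i)) (Num (b x i))" "r (x, i) \<le> poly R (bitsize (s x i))"
    if "x \<in> D" "i \<le> k x" for x i using B[of "(x, i)"] rR[of "(x, i)"] that by auto
  obtain P t where P: "\<And>y. y \<in> ?J \<Longrightarrow> run P (s (fst y) (snd y)) (t y) (s (fst y) (Suc (snd y)))"
    and Pt: "pbounded ?J (\<lambda>y. bitsize (s (fst y) (snd y))) t"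
    using ptimeE[OF body] by blast
  obtain T where tT: "\<And>y. y \<in> ?J \<Longrightarrow> t y \<le> poly T (bitsize (s (fst y) (snd y)))"
    using Pt unfolding pbounded_def by blast
  have t: "run P (s x i) (t (x, i)) (s x (Suc i))" "t (x, i) \<le> poly T (bitsize (s x i))"
    if "x \<in> D" "i < k x" for x i using P[of "(x, i)"] tT[of "(x, i)"] that by auto
  define c where "c x = m x + poly R (m x) + poly T (m x)" for x
  have R: "r (x, i) \<le> poly R (m x)" if "x \<in> D" "i \<le> k x" for x i
    using r(2)[OF that] poly_nat_mono[OF bounded(2)[OF that]] le_trans by blast
  have T: "t (x, i) \<le> poly T (m x)" if "x \<in> D" "i < k x" for x i
    using t(2)[OF that] poly_nat_mono[OF bounded(2)[of x i]] le_trans that less_imp_le by metis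
  have mc: "pbounded D m c" unfolding c_def
    by (intro pbounded_add pbounded_self) (auto simp: pbounded_def)
  obtain I q where q: "\<And>x. x \<in> D \<Longrightarrow> run I (u x) (q x) (s x 0)" "psize D u q"
    using ptimeE[OF init] by blast
  let ?t = "\<lambda>x. (\<Sum>i<k x. bitsize (s x i) + r (x, i) + t (x, i)) + (bitsize (s x (k x)) + r (x, k x))"
  show ?thesis
  proof (rule ptimeI)
    show "run (Seq I (While B P)) (u x) (bitsize (u x) + q x + ?t x) (s x (k x))" if x: "x \<in> D" for x
    proof (rule run.Seq[OF q(1)[OF x]], rule run_While[where b = "b x"])
      show "b x (k x) = 0" using b[OF x order.refl] by simp
    qed (use x r(1) t(1) b in auto)
    show "psize D u (\<lambda>x. bitsize (u x) + q x + ?t x)"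
    proof (rule pbounded_mono)
      show "psize D u (\<lambda>x. bitsize (u x) + q x + (k x * c x + c x))"
        using pbounded_trans[OF bounded(1) mc] iterations q(2)
        by (intro pbounded_add pbounded_mult pbounded_self)
      fix x assume x: "x \<in> D"
      have "(\<Sum>i<k x. bitsize (s x i) + r (x, i) + t (x, i)) \<le> of_nat (card {..<k x}) * c x"
        by (rule sum_bounded_above) (use x R T bounded(2) in \<open>force simp: c_def intro: add_mono\<close>)
      moreover have "bitsize (s x (k x)) + r (x, k x) \<le> c x"
        using x R[of x "k x"] bounded(2)[of x "k x"] unfolding c_def by simp
      ultimately show "bitsize (u x) + q x + ?t x \<le> bitsize (u x) + q x + (k x * c x + c x)" by simp
    qed
  qed
qed

section \<open>Lists\<close>

lemma bitsize_encode_list: "bitsize (encode_list l) = 2 + (\<Sum>k\<leftarrow>l. 1 + bitsize (Num k))"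
  by (induction l) (auto simp: floorlog_def)

lemma bitsize_encode_list_append:
  "bitsize (encode_list (l @ l')) \<le> bitsize (encode_list l) + bitsize (encode_list l')"
  unfolding bitsize_encode_list by simp

lemma bitsize_encode_list_rev: "bitsize (encode_list (rev l)) = bitsize (encode_list l)"
  unfolding bitsize_encode_list by (simp add: rev_map[symmetric] del: bitsize.simps)

lemma bitsize_encode_list_take: "bitsize (encode_list (take i l)) \<le> bitsize (encode_list l)"
  and bitsize_encode_list_drop: "bitsize (encode_list (drop i l)) \<le> bitsize (encode_list l)"
proof -
  have "bitsize (encode_list l) = 2 + (\<Sum>k\<leftarrow>take i l @ drop i l. 1 + bitsize (Num k))"
    unfolding bitsize_encode_list by simp
  thus "bitsize (encode_list (take i l)) \<le> bitsize (encode_list l)"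
    "bitsize (encode_list (drop i l)) \<le> bitsize (encode_list l)"
    unfolding map_append sum_list_append bitsize_encode_list by simp_all
qed

lemma bitsize_encode_list_mem: "k \<in> set l \<Longrightarrow> bitsize (Num k) \<le> bitsize (encode_list l)"
  by (induction l) auto

lemma length_le_bitsize: "length l \<le> bitsize (encode_list l)"
  by (induction l) auto

lemma bitsize_encode_list_le:
  "(\<And>k. k \<in> set l \<Longrightarrow> bitsize (Num k) \<le> b) \<Longrightarrow> bitsize (encode_list l) \<le> 2 + length l * (1 + b)"
proof (induction l)
  case (Cons k l)
  then show ?case using Cons.IH Cons.prems[of k] by (fastforce simp: floorlog_def)
qed (simp add: floorlog_def)

lemma ptime_nonempty:
  assumes "ptime D u (\<lambda>x. encode_list (l x))"
  shows "ptime D u (\<lambda>x. Num (if l x \<noteq> [] then 1 else 0))"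
proof (rule ptime_trans[OF assms], rule ptime_Do[where i = IsPair])
  show "step IsPair (encode_list (l x)) = Some (Num (if l x \<noteq> [] then 1 else 0))" for x
    by (cases "l x") auto
qed

lemma ptime_Nil: "ptime D u (\<lambda>_. encode_list [])"
  using ptime_Num[of D u 0] by simp

lemma ptime_uncons:
  assumes "ptime D u (\<lambda>x. encode_list (l x))" "\<And>x. x \<in> D \<Longrightarrow> l x \<noteq> []"
  shows "ptime D u (\<lambda>x. Pair (Num (hd (l x))) (encode_list (tl (l x))))"
proof (rule ptime_cong[OF assms(1)])
  show "Pair (Num (hd (l x))) (encode_list (tl (l x))) = encode_list (l x)" if "x \<in> D" for x
    using assms(2)[OF that] by (cases "l x") auto
qed

lemmas ptime_hd = ptime_fst[OF ptime_uncons]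

lemma ptime_list_cases:
  assumes l: "ptime D u (\<lambda>x. encode_list (l x))"
    and "ptime {x \<in> D. l x \<noteq> []} u v" "ptime {x \<in> D. l x = []} u w"
  shows "ptime D u (\<lambda>x. if l x \<noteq> [] then v x else w x)"
  by (rule ptime_cong[OF ptime_cond[OF ptime_nonempty[OF l], of v w]])
     (auto intro: ptime_subset[OF assms(2)] ptime_subset[OF assms(3)])

lemma ptime_tl:
  assumes "ptime D u (\<lambda>x. encode_list (l x))"
  shows "ptime D u (\<lambda>x. encode_list (tl (l x)))"
  by (rule ptime_cong[OF ptime_list_cases[OF assms
          ptime_snd[OF ptime_uncons[OF ptime_subset[OF assms]]] ptime_Nil]]) auto

lemma ptime_nth_default_0:
  assumes "ptime D u (\<lambda>x. encode_list (l x))"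
  shows "ptime D u (\<lambda>x. Num (nth_default 0 (l x) 0))"
  by (rule ptime_cong[OF ptime_list_cases[OF assms
          ptime_fst[OF ptime_uncons[OF ptime_subset[OF assms]]] ptime_Num]])
     (auto simp: nth_default_def hd_conv_nth)

lemma ptime_Cons:
  "ptime D u (\<lambda>x. Num (k x)) \<Longrightarrow> ptime D u (\<lambda>x. encode_list (l x)) \<Longrightarrow>
   ptime D u (\<lambda>x. encode_list (k x # l x))"
  by (auto intro: ptime_Pair)

text \<open>
  The list is consumed from its head. Programs have no variables, so that all data which the
  body needs are carried along in \<open>env\<close>.
\<close>

lemma ptime_fold:
  assumes l: "ptime D u (\<lambda>x. encode_list (l x))"
    and env: "ptime D u env"
    and init: "ptime D u (\<lambda>x. acc x 0)"
    and body: "ptime (SIGMA x:D. {..<length (l x)})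
      (\<lambda>y. Pair (env (fst y)) (Pair (acc (fst y) (snd y)) (Num (l (fst y) ! snd y))))
      (\<lambda>y. acc (fst y) (Suc (snd y)))"
    and m: "psize D u m" "\<And>x i. x \<in> D \<Longrightarrow> i \<le> length (l x) \<Longrightarrow> bitsize (acc x i) \<le> m x"
  shows "ptime D u (\<lambda>x. acc x (length (l x)))"
proof -
  define s where "s x i = Pair (env x) (Pair (acc x i) (encode_list (drop i (l x))))" for x i
  have *: "ptime Y (\<lambda>y. s (fst y) (snd y)) (\<lambda>y. env (fst y))"
    "ptime Y (\<lambda>y. s (fst y) (snd y)) (\<lambda>y. acc (fst y) (snd y))"
    "ptime Y (\<lambda>y. s (fst y) (snd y)) (\<lambda>y. encode_list (drop (snd y) (l (fst y))))" for Y
    unfolding s_def by (rule ptime_proj)+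
  have "ptime D u (\<lambda>x. s x (length (l x)))"
  proof (rule ptime_loop[where b = "\<lambda>x i. if drop i (l x) \<noteq> [] then 1 else 0"])
    show "ptime D u (\<lambda>x. s x 0)" unfolding s_def drop_0 by (intro ptime_Pair l env init)
    show "ptime (SIGMA x:D. {..length (l x)}) (\<lambda>y. s (fst y) (snd y))
        (\<lambda>y. Num (if drop (snd y) (l (fst y)) \<noteq> [] then 1 else 0))"
      by (rule ptime_nonempty[OF *(3)])
    let ?J = "SIGMA x:D. {..<length (l x)}"
    have "ptime ?J (\<lambda>y. s (fst y) (snd y)) (\<lambda>y. Num (l (fst y) ! snd y))"
      by (rule ptime_cong[OF ptime_hd[OF *(3)]]) (auto simp: hd_drop_conv_nth)
    hence "ptime ?J (\<lambda>y. s (fst y) (snd y)) (\<lambda>y. acc (fst y) (Suc (snd y)))"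
      by (intro ptime_trans[OF _ body] ptime_Pair *)
    moreover have "ptime ?J (\<lambda>y. s (fst y) (snd y)) (\<lambda>y. encode_list (drop (Suc (snd y)) (l (fst y))))"
      by (rule ptime_cong[OF ptime_tl[OF *(3)]]) (auto simp: drop_Suc tl_drop)
    ultimately show "ptime ?J (\<lambda>y. s (fst y) (snd y)) (\<lambda>y. s (fst y) (Suc (snd y)))"
      by (subst (2) s_def) (intro ptime_Pair *)
    show "psize D u (\<lambda>x. length (l x))"
      using pbounded_mono[OF ptime_size[OF l] length_le_bitsize] .
    show "psize D u (\<lambda>x. 1 + bitsize (env x) + (1 + m x + bitsize (encode_list (l x))))"
      by (intro pbounded_add pbounded_const ptime_size env l m)
    show "bitsize (s x i) \<le> 1 + bitsize (env x) + (1 + m x + bitsize (encode_list (l x)))"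
      if "x \<in> D" "i \<le> length (l x)" for x i
      unfolding s_def using m(2)[OF that] bitsize_encode_list_drop[of i "l x"] by simp
  qed auto
  thus ?thesis unfolding s_def by (rule ptime_fst[OF ptime_snd])
qed

lemma ptime_length:
  assumes l: "ptime D u (\<lambda>x. encode_list (l x))"
  shows "ptime D u (\<lambda>x. Num (int (length (l x))))"
proof (rule ptime_fold[where acc = "\<lambda>x i. Num (int i)", OF l ptime_id])
  let ?J = "SIGMA x:D. {..<length (l x)}"
  let ?v = "\<lambda>y. Pair (u (fst y)) (Pair (Num (int (snd y))) (Num (l (fst y) ! snd y)))"
  have "ptime ?J ?v (\<lambda>y. Num (int (snd y)))"
    by (rule ptime_proj)+
  from ptime_add[OF this ptime_Num[where k = 1]]
  show "ptime ?J ?v (\<lambda>y. Num (int (Suc (snd y))))" by (simp add: add.commute)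
  show "ptime D u (\<lambda>_. Num (int 0))" by (rule ptime_Num)
  show "psize D u (\<lambda>x. 2 + bitsize (encode_list (l x)))"
    by (intro pbounded_add pbounded_const ptime_size l)
  fix x i assume "i \<le> length (l x)"
  moreover have "floorlog 2 i \<le> i" unfolding floorlog2_le_iff by (rule less_exp)
  ultimately show "bitsize (Num (int i)) \<le> 2 + bitsize (encode_list (l x))"
    using length_le_bitsize[of "l x"] by simp
qed

lemma ptime_rev_append:
  assumes l: "ptime D u (\<lambda>x. encode_list (l x))" and l': "ptime D u (\<lambda>x. encode_list (l' x))"
  shows "ptime D u (\<lambda>x. encode_list (rev (l x) @ l' x))"
proof -
  have "ptime D u (\<lambda>x. encode_list (rev (take (length (l x)) (l x)) @ l' x))"
  proof (rule ptime_fold[where acc = "\<lambda>x i. encode_list (rev (take i (l x)) @ l' x)", OF l ptime_id])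
    let ?J = "SIGMA x:D. {..<length (l x)}"
    let ?v = "\<lambda>y. Pair (u (fst y)) (Pair (encode_list (rev (take (snd y) (l (fst y))) @ l' (fst y)))
      (Num (l (fst y) ! snd y)))"
    have "ptime ?J ?v (\<lambda>y. encode_list (l (fst y) ! snd y # (rev (take (snd y) (l (fst y))) @ l' (fst y))))"
      by (rule ptime_Cons; (rule ptime_proj)+)
    thus "ptime ?J ?v (\<lambda>y. encode_list (rev (take (Suc (snd y)) (l (fst y))) @ l' (fst y)))"
      by (rule ptime_cong) (auto simp: take_Suc_conv_app_nth)
    show "psize D u (\<lambda>x. bitsize (encode_list (l x)) + bitsize (encode_list (l' x)))"
      by (intro pbounded_add ptime_size l l')
    show "bitsize (encode_list (rev (take i (l x)) @ l' x))
        \<le> bitsize (encode_list (l x)) + bitsize (encode_list (l' x))" for x i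
      using bitsize_encode_list_append[of "rev (take i (l x))" "l' x"]
        bitsize_encode_list_take[of i "l x"] unfolding bitsize_encode_list_rev by linarith
  qed (use l' in simp)
  thus ?thesis by simp
qed

lemma ptime_rev:
  "ptime D u (\<lambda>x. encode_list (l x)) \<Longrightarrow> ptime D u (\<lambda>x. encode_list (rev (l x)))"
  using ptime_rev_append[OF _ ptime_Nil] by fastforce

lemma ptime_append:
  "ptime D u (\<lambda>x. encode_list (l x)) \<Longrightarrow> ptime D u (\<lambda>x. encode_list (l' x)) \<Longrightarrow>
   ptime D u (\<lambda>x. encode_list (l x @ l' x))"
  using ptime_rev_append[OF ptime_rev] by fastforce

lemma ptime_map:
  assumes l: "ptime D u (\<lambda>x. encode_list (l x))" and env: "ptime D u env"
    and g: "ptime (SIGMA x:D. set (l x)) (\<lambda>y. Pair (env (fst y)) (Num (snd y)))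
      (\<lambda>y. Num (g (fst y) (snd y)))"
  shows "ptime D u (\<lambda>x. encode_list (map (g x) (l x)))"
proof -
  let ?acc = "\<lambda>x i. encode_list (rev (map (g x) (take i (l x))))"
  obtain T where T: "\<And>y. y \<in> (SIGMA x:D. set (l x)) \<Longrightarrow>
      bitsize (Num (g (fst y) (snd y))) \<le> poly T (bitsize (Pair (env (fst y)) (Num (snd y))))"
    using ptime_size[OF g] unfolding pbounded_def by blast
  have "ptime D u (\<lambda>x. encode_list (rev (map (g x) (take (length (l x)) (l x)))))"
  proof (rule ptime_fold[where acc = ?acc, OF l env])
    let ?J = "SIGMA x:D. {..<length (l x)}"
    let ?v = "\<lambda>y. Pair (env (fst y)) (Pair (?acc (fst y) (snd y)) (Num (l (fst y) ! snd y)))"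
    have v: "ptime ?J ?v (\<lambda>y. env (fst y))" "ptime ?J ?v (\<lambda>y. ?acc (fst y) (snd y))"
      "ptime ?J ?v (\<lambda>y. Num (l (fst y) ! snd y))"
      by (rule ptime_proj)+
    have "ptime ?J (\<lambda>y. Pair (env (fst y)) (Num (l (fst y) ! snd y))) (\<lambda>y. Num (g (fst y) (l (fst y) ! snd y)))"
      using ptime_reindex[OF g, of "\<lambda>y. (fst y, l (fst y) ! snd y)" ?J]
      unfolding fst_conv snd_conv by fastforce
    from ptime_Cons[OF ptime_trans[OF ptime_Pair[OF v(1,3)] this] v(2)]
    show "ptime ?J ?v (\<lambda>y. ?acc (fst y) (Suc (snd y)))"
      by (rule ptime_cong) (auto simp: take_Suc_conv_app_nth)
    let ?b = "\<lambda>x. 1 + bitsize (env x) + bitsize (encode_list (l x))"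
    have "psize D u ?b" by (intro pbounded_add pbounded_const ptime_size l env)
    hence "psize D u (\<lambda>x. poly T (?b x))" by (rule pbounded_poly)
    thus "psize D u (\<lambda>x. 2 + bitsize (encode_list (l x)) * (1 + poly T (?b x)))"
      by (intro pbounded_add pbounded_mult pbounded_const ptime_size l)
    fix x i assume x: "x \<in> D" "i \<le> length (l x)"
    have "bitsize (Num (g x k)) \<le> poly T (?b x)" if "k \<in> set (l x)" for k
      using T[of "(x, k)"] x that bitsize_encode_list_mem[OF that]
        poly_nat_mono[of "bitsize (Pair (env x) (Num k))" "?b x" T] by fastforce
    hence "bitsize (?acc x i) \<le> 2 + length (rev (map (g x) (take i (l x)))) * (1 + poly T (?b x))"
      by (intro bitsize_encode_list_le) (auto dest: in_set_takeD)
    also have "\<dots> \<le> 2 + bitsize (encode_list (l x)) * (1 + poly T (?b x))"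
      using x length_le_bitsize[of "l x"] by (intro add_left_mono mult_right_mono) auto
    finally show "bitsize (?acc x i) \<le> 2 + bitsize (encode_list (l x)) * (1 + poly T (?b x))" .
  qed (use ptime_Nil in simp)
  from ptime_rev[OF this] show ?thesis by simp
qed

text \<open>
  The elimination step of polynomial division. The lists are read from the leading coefficient
  on and aligned there; padding \<open>ys\<close> with zeros amounts to multiplying it by a
  power of the indeterminate. For \<open>M = 0\<close> the step is carried out over the
  integers.
\<close>

definition combine :: "int \<Rightarrow> int \<Rightarrow> int \<Rightarrow> int list \<Rightarrow> int list \<Rightarrow> int list" where
  "combine M c d xs ys = map (\<lambda>i. (c * xs ! i - d * nth_default 0 ys i) mod M) [0..<length xs]"

lemma length_combine [simp]: "length (combine M c d xs ys) = length xs"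
  by (simp add: combine_def)

lemma bitsize_nth_default: "bitsize (Num (nth_default 0 ys j)) \<le> bitsize (encode_list ys)"
proof (cases "j < length ys")
  case True
  thus ?thesis unfolding nth_default_def by (simp add: bitsize_encode_list_mem del: bitsize.simps)
next
  case False
  have "bitsize (Num 0) \<le> bitsize (encode_list ys)"
    unfolding bitsize_encode_list by (simp add: floorlog_def)
  with False show ?thesis unfolding nth_default_def by simp
qed

lemma ptime_combine:
  assumes M: "ptime D u (\<lambda>x. Num (M x))"
    and c: "ptime D u (\<lambda>x. Num (c x))" and d: "ptime D u (\<lambda>x. Num (d x))"
    and xs: "ptime D u (\<lambda>x. encode_list (xs x))" and ys: "ptime D u (\<lambda>x. encode_list (ys x))"
  shows "ptime D u (\<lambda>x. encode_list (combine (M x) (c x) (d x) (xs x) (ys x)))"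
proof -
  let ?c = "\<lambda>x. combine (M x) (c x) (d x) (xs x) (ys x)"
  let ?acc = "\<lambda>x i. Pair (encode_list (rev (take i (?c x)))) (encode_list (drop i (ys x)))"
  let ?env = "\<lambda>x. Pair (Num (M x)) (Pair (Num (c x)) (Num (d x)))"
  have "ptime D u (\<lambda>x. ?acc x (length (xs x)))"
  proof (rule ptime_fold[where acc = ?acc and env = ?env, OF xs])
    let ?J = "SIGMA x:D. {..<length (xs x)}"
    let ?v = "\<lambda>y. Pair (?env (fst y)) (Pair (?acc (fst y) (snd y)) (Num (xs (fst y) ! snd y)))"
    let ?d = "\<lambda>y. drop (snd y) (ys (fst y))"
    have v: "ptime ?J ?v (\<lambda>y. ?env (fst y))" "ptime ?J ?v (\<lambda>y. ?acc (fst y) (snd y))"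
      "ptime ?J ?v (\<lambda>y. Num (xs (fst y) ! snd y))"
      by (rule ptime_proj)+
    note e = ptime_fst[OF v(1)] ptime_fst[OF ptime_snd[OF v(1)]] ptime_snd[OF ptime_snd[OF v(1)]]
      ptime_fst[OF v(2)] ptime_snd[OF v(2)] v(3)
    have "ptime ?J ?v (\<lambda>y. Pair (encode_list
        ((c (fst y) * xs (fst y) ! snd y - d (fst y) * nth_default 0 (?d y) 0) mod M (fst y)
          # rev (take (snd y) (?c (fst y)))))
        (encode_list (tl (?d y))))"
      by (intro ptime_Pair ptime_Cons ptime_mod ptime_diff ptime_mult ptime_nth_default_0 ptime_tl e)
    thus "ptime ?J ?v (\<lambda>y. ?acc (fst y) (Suc (snd y)))"
      by (rule ptime_cong)
         (auto simp: take_Suc_conv_app_nth combine_def drop_Suc tl_drop nth_default_def)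
    let ?b = "\<lambda>x. bitsize (Num (c x)) + bitsize (encode_list (xs x)) +
      (bitsize (Num (d x)) + bitsize (encode_list (ys x))) + bitsize (Num (M x))"
    show "psize D u (\<lambda>x. 1 + (2 + bitsize (encode_list (xs x)) * (1 + ?b x)) + bitsize (encode_list (ys x)))"
      by (intro pbounded_add pbounded_mult pbounded_const ptime_size assms)
    fix x i assume x: "x \<in> D" "i \<le> length (xs x)"
    have entry: "bitsize (Num k) \<le> ?b x" if "k \<in> set (?c x)" for k
    proof -
      obtain j where j: "j < length (xs x)" "k = (c x * xs x ! j - d x * nth_default 0 (ys x) j) mod M x"
        using \<open>k \<in> set (?c x)\<close> by (auto simp: combine_def)
      have "bitsize (Num (nth_default 0 (ys x) j)) \<le> bitsize (encode_list (ys x))"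
        by (rule bitsize_nth_default)
      moreover have "bitsize (Num (xs x ! j)) \<le> bitsize (encode_list (xs x))"
        using j by (intro bitsize_encode_list_mem) simp
      ultimately show ?thesis
        unfolding j(2)
        using bitsize_Num_mod[of "c x * xs x ! j - d x * nth_default 0 (ys x) j" "M x"]
          bitsize_Num_add[of "c x * xs x ! j" "- (d x * nth_default 0 (ys x) j)"]
          bitsize_Num_mult[of "c x" "xs x ! j"] bitsize_Num_mult[of "d x" "nth_default 0 (ys x) j"]
        by simp
    qed
    have "bitsize (encode_list (rev (take i (?c x)))) \<le> 2 + length (rev (take i (?c x))) * (1 + ?b x)"
      using entry by (intro bitsize_encode_list_le) (auto dest: in_set_takeD)
    also have "\<dots> \<le> 2 + bitsize (encode_list (xs x)) * (1 + ?b x)"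
      using x length_le_bitsize[of "xs x"] by (intro add_left_mono mult_right_mono) auto
    finally show "bitsize (?acc x i)
        \<le> 1 + (2 + bitsize (encode_list (xs x)) * (1 + ?b x)) + bitsize (encode_list (ys x))"
      using bitsize_encode_list_drop[of i "ys x"] by simp
  next
    show "ptime D u ?env" by (intro ptime_Pair M c d)
    show "ptime D u (\<lambda>x. ?acc x 0)"
      unfolding take_0 drop_0 rev.simps by (intro ptime_Pair ptime_Nil ys)
  qed
  from ptime_rev[OF ptime_fst[OF this]] show ?thesis by simp
qed

section \<open>Greatest common divisors of integers\<close>

definition gcd_step :: "int \<times> int \<Rightarrow> int \<times> int" where
  "gcd_step = (\<lambda>(a, b). (b, a mod b))"

text \<open>
  The product of the two numbers is at least halved in each step, which bounds the number of
  steps by the bit size of the product.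
\<close>

lemma gcd_steps:
  fixes a b :: int
  assumes "0 \<le> b" "b \<le> a" "\<And>j. j < i \<Longrightarrow> snd ((gcd_step ^^ j) (a, b)) \<noteq> 0"
  shows "case (gcd_step ^^ i) (a, b) of (a', b') \<Rightarrow>
    0 \<le> b' \<and> b' \<le> a' \<and> a' \<le> a \<and> gcd a' b' = gcd a b \<and> a' * b' * 2 ^ i \<le> a * b"
  using assms(3)
proof (induction i)
  case (Suc i)
  obtain a' b' where *: "(gcd_step ^^ i) (a, b) = (a', b')" "0 \<le> b'" "b' \<le> a'" "a' \<le> a"
    "gcd a' b' = gcd a b" "a' * b' * 2 ^ i \<le> a * b"
    using Suc.IH Suc.prems by (cases "(gcd_step ^^ i) (a, b)") auto
  have "b' > 0" using Suc.prems[of i] * by simp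
  have m: "0 \<le> a' mod b'" "a' mod b' < b'" using \<open>b' > 0\<close> by auto
  have "1 * b' \<le> (a' div b') * b'"
    using \<open>b' > 0\<close> *(3) by (intro mult_right_mono) (auto simp: pos_imp_zdiv_pos_iff int_one_le_iff_zero_less)
  hence "2 * (a' mod b') \<le> a'" using m div_mult_mod_eq[of a' b'] by linarith
  hence "b' * (2 * (a' mod b')) \<le> b' * a'" using \<open>b' > 0\<close> by (intro mult_left_mono) auto
  hence "(b' * (2 * (a' mod b'))) * 2 ^ i \<le> (b' * a') * 2 ^ i" by (intro mult_right_mono) auto
  hence "b' * (a' mod b') * 2 ^ Suc i \<le> a * b" using *(6) by (simp add: mult_ac)
  moreover have "gcd b' (a' mod b') = gcd a b" using *(5) by (metis gcd_red_int)
  ultimately show ?case using * m by (simp add: gcd_step_def)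
qed (use assms in simp)

lemma ptime_gcd:
  assumes a: "ptime D u (\<lambda>x. Num (a x))" and b: "ptime D u (\<lambda>x. Num (b x))"
    and ab: "\<And>x. x \<in> D \<Longrightarrow> 0 \<le> b x" "\<And>x. x \<in> D \<Longrightarrow> b x \<le> a x"
  shows "ptime D u (\<lambda>x. Num (gcd (a x) (b x)))"
proof -
  define st where "st x i = (gcd_step ^^ i) (a x, b x)" for x i
  define n where "n x = bitsize (Num (a x * b x))" for x
  have ex: "\<exists>i\<le>n x. snd (st x i) = 0" if x: "x \<in> D" for x
  proof (rule ccontr)
    assume *: "\<not> ?thesis"
    obtain a' b' where ab': "st x (n x) = (a', b')" "0 \<le> b'" "b' \<le> a'" "a' * b' * 2 ^ n x \<le> a x * b x"
      using gcd_steps[of "b x" "a x" "n x"] x ab * unfolding st_def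
      by (cases "(gcd_step ^^ n x) (a x, b x)") auto
    have "b' \<noteq> 0" using * ab'(1) by force
    hence "1 * 1 \<le> a' * b'" using ab' by (intro mult_mono) auto
    hence "1 * 2 ^ n x \<le> a' * b' * 2 ^ n x" by (intro mult_right_mono) auto
    hence "2 ^ n x \<le> a x * b x" using ab' by linarith
    hence "nat (2 ^ n x) \<le> nat \<bar>a x * b x\<bar>" by linarith
    hence "2 ^ n x \<le> nat \<bar>a x * b x\<bar>" by (simp add: nat_power_eq)
    moreover have "nat \<bar>a x * b x\<bar> < 2 ^ n x"
      unfolding floorlog2_le_iff[symmetric] n_def by simp
    ultimately show False by linarith
  qed
  define k where "k x = (LEAST i. snd (st x i) = 0)" for x
  have k: "snd (st x (k x)) = 0" "k x \<le> n x" if "x \<in> D" for x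
  proof -
    obtain i where i: "i \<le> n x" "snd (st x i) = 0" using ex[OF \<open>x \<in> D\<close>] by blast
    show "snd (st x (k x)) = 0" unfolding k_def by (rule LeastI[of "\<lambda>i. snd (st x i) = 0", OF i(2)])
    show "k x \<le> n x" unfolding k_def using Least_le[of "\<lambda>i. snd (st x i) = 0", OF i(2)] i(1) by linarith
  qed
  have lk: "snd (st x j) \<noteq> 0" if "j < k x" for j x
    using not_less_Least that unfolding k_def by blast
  have inv: "0 \<le> snd (st x i) \<and> snd (st x i) \<le> fst (st x i) \<and> fst (st x i) \<le> a x \<and>
      gcd (fst (st x i)) (snd (st x i)) = gcd (a x) (b x)" if "x \<in> D" "i \<le> k x" for x i
    using gcd_steps[of "b x" "a x" i] that ab lk[of _ x] unfolding st_def
    by (simp add: case_prod_beta)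
  let ?s = "\<lambda>x i. Pair (Num (fst (st x i))) (Num (snd (st x i)))"
  have "ptime D u (\<lambda>x. ?s x (k x))"
  proof (rule ptime_loop[where b = "\<lambda>x i. snd (st x i)"])
    show "ptime D u (\<lambda>x. ?s x 0)" unfolding st_def by (simp add: ptime_Pair a b)
    let ?J = "SIGMA x:D. {..<k x}"
    have "ptime ?J (\<lambda>y. ?s (fst y) (snd y)) (\<lambda>y. Pair (Num (snd (st (fst y) (snd y))))
      (Num (fst (st (fst y) (snd y)) mod snd (st (fst y) (snd y)))))"
      by (intro ptime_Pair ptime_mod ptime_proj)
    thus "ptime ?J (\<lambda>y. ?s (fst y) (snd y)) (\<lambda>y. ?s (fst y) (Suc (snd y)))"
      by (rule ptime_cong) (simp add: st_def gcd_step_def case_prod_beta)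
    have "psize D u (\<lambda>x. bitsize (Num (a x)) + bitsize (Num (b x)))"
      by (intro pbounded_add ptime_size a b)
    thus "psize D u k"
      by (rule pbounded_mono) (use k(2) n_def bitsize_Num_mult le_trans in metis)
    show "psize D u (\<lambda>x. 1 + bitsize (Num (a x)) + bitsize (Num (a x)))"
      by (intro pbounded_add pbounded_const ptime_size a)
    show "bitsize (?s x i) \<le> 1 + bitsize (Num (a x)) + bitsize (Num (a x))"
      if "x \<in> D" "i \<le> k x" for x i
    proof -
      have "bitsize (Num (fst (st x i))) \<le> bitsize (Num (a x))"
        "bitsize (Num (snd (st x i))) \<le> bitsize (Num (a x))"
        using inv[OF that] by (intro bitsize_Num_mono; linarith)+
      thus ?thesis unfolding bitsize.simps(2) by linarith
    qed
    show "(snd (st x i) \<noteq> 0) = (i < k x)" if "x \<in> D" "i \<le> k x" for x i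
      using lk[of i x] k(1)[of x] that by (cases "i = k x") auto
  qed (rule ptime_proj)
  from ptime_fst[OF this] show ?thesis
  proof (rule ptime_cong)
    fix x assume x: "x \<in> D"
    hence "gcd (fst (st x (k x))) 0 = gcd (a x) (b x)" "0 \<le> fst (st x (k x))"
      using inv[OF x order.refl] k(1)[OF x] by auto
    thus "Num (gcd (a x) (b x)) = Num (fst (st x (k x)))" by simp
  qed
qed

section \<open>Integrality by the determinant trick\<close>

lemma monic_division:
  fixes f g :: "'a :: comm_ring_1 poly"
  assumes "lead_coeff g = 1"
  obtains q r where "f = g * q + r" "r = 0 \<or> Polynomial.degree r < Polynomial.degree g"
proof -
  have "g \<noteq> 0" using assms by auto
  obtain q r where qr: "pseudo_divmod f g = (q, r)" by fastforce
  from pseudo_divmod[OF \<open>g \<noteq> 0\<close> qr] assms that[of q r] show ?thesis by auto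
qed

lemma degree_monic_mult:
  fixes g :: "'a :: comm_ring_1 poly"
  assumes "lead_coeff g = 1" "q \<noteq> 0"
  shows "Polynomial.degree (g * q) = Polynomial.degree g + Polynomial.degree q"
    and "lead_coeff (g * q) = lead_coeff q"
proof -
  have *: "Polynomial.coeff (g * q) (Polynomial.degree g + Polynomial.degree q) = lead_coeff q"
    using assms by (simp add: coeff_mult_degree_sum)
  hence "Polynomial.degree g + Polynomial.degree q \<le> Polynomial.degree (g * q)"
    using assms by (intro le_degree) simp
  thus deg: "Polynomial.degree (g * q) = Polynomial.degree g + Polynomial.degree q"
    using degree_mult_le[of g q] by simp
  show "lead_coeff (g * q) = lead_coeff q" unfolding deg * ..
qed

lemma monic_dvd_small:
  fixes g :: "'a :: comm_ring_1 poly"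
  assumes "lead_coeff g = 1" "g dvd r" "r = 0 \<or> Polynomial.degree r < Polynomial.degree g"
  shows "r = 0"
proof (rule ccontr)
  assume "r \<noteq> 0"
  from \<open>g dvd r\<close> obtain q where q: "r = g * q" by auto
  with \<open>r \<noteq> 0\<close> have "q \<noteq> 0" by auto
  from degree_monic_mult(1)[OF assms(1) this] assms(3) q \<open>r \<noteq> 0\<close> show False by simp
qed

text \<open>
  Modulo \<open>F\<close>, multiplication by \<open>\<theta>\<close> acts on the vector
  \<open>v\<close> as the integer matrix \<open>M\<close>. So \<open>\<theta> I - M\<close>
  annihilates \<open>v\<close>, and multiplication by the adjugate matrix shows that its
  determinant does. This determinant is the characteristic polynomial of \<open>M\<close>
  evaluated at \<open>\<theta>\<close>.
\<close>

lemma stable_module_integral: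
  fixes F \<theta> :: "rat poly" and v :: "nat \<Rightarrow> rat poly" and M :: "nat \<Rightarrow> nat \<Rightarrow> int"
  assumes M: "\<And>k. k < m \<Longrightarrow> F dvd \<theta> * v k - (\<Sum>j<m. of_int (M k j) * v j)"
  obtains P :: "int poly" where "lead_coeff P = 1"
    "\<And>k. k < m \<Longrightarrow> F dvd poly (map_poly of_int P) \<theta> * v k"
proof -
  define A where "A = mat m m (\<lambda>(i, j). M i j)"
  have A: "A \<in> carrier_mat m m" unfolding A_def by simp
  define h :: "int poly \<Rightarrow> rat poly" where "h p = poly (map_poly of_int p) \<theta>" for p
  interpret h: comm_ring_hom h
    unfolding h_def by unfold_locales (simp_all add: hom_distribs)
  define B where "B = map_mat h (char_poly_matrix A)"
  have B: "B \<in> carrier_mat m m" unfolding B_def using A by simp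
  have Bij: "B $$ (i, j) = (if i = j then \<theta> else 0) - of_int (M i j)" if "i < m" "j < m" for i j
  proof -
    have "map_poly of_int [:c:] = [:of_int c :: rat poly:]" for c :: int
      by (simp add: hom_distribs map_poly_pCons)
    with that A show ?thesis unfolding B_def char_poly_matrix_def h_def A_def by auto
  qed
  define w where "w = vec m v"
  have w: "w \<in> carrier_vec m" unfolding w_def by simp
  have Bw: "F dvd (B *\<^sub>v w) $ k" if k: "k < m" for k
  proof -
    have "(B *\<^sub>v w) $ k = (\<Sum>j<m. B $$ (k, j) * v j)"
      using k B unfolding w_def by (simp add: scalar_prod_def lessThan_atLeast0)
    also have "\<dots> = (\<Sum>j<m. (if k = j then \<theta> * v j else 0) - of_int (M k j) * v j)"
      using k Bij by (intro sum.cong) (auto simp: left_diff_distrib)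
    also have "\<dots> = \<theta> * v k - (\<Sum>j<m. of_int (M k j) * v j)"
      using k by (simp add: sum_subtractf)
    finally show ?thesis using M[OF k] by simp
  qed
  have "F dvd det B * v k" if k: "k < m" for k
  proof -
    have "adj_mat B *\<^sub>v (B *\<^sub>v w) = (adj_mat B * B) *\<^sub>v w"
      using adj_mat(1)[OF B] B w by (metis assoc_mult_mat_vec)
    also have "\<dots> = (det B \<cdot>\<^sub>m 1\<^sub>m m) *\<^sub>v w" using adj_mat(3)[OF B] by simp
    also have "\<dots> = det B \<cdot>\<^sub>v w" by (auto simp: w_def scalar_prod_def if_distrib[of "\<lambda>x. x * _"] if_distrib[of "\<lambda>x. _ * x"] cong: if_cong)
    finally have "det B * v k = (adj_mat B *\<^sub>v (B *\<^sub>v w)) $ k" using k by (simp add: w_def)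
    also have "\<dots> = (\<Sum>j<m. adj_mat B $$ (k, j) * (B *\<^sub>v w) $ j)"
      using k B adj_mat(1)[OF B] by (simp add: scalar_prod_def lessThan_atLeast0)
    finally show ?thesis using Bw by (auto intro!: dvd_sum dvd_mult)
  qed
  moreover have "det B = h (char_poly A)" unfolding B_def char_poly_def by simp
  ultimately show ?thesis
    using that[of "char_poly A"] degree_monic_char_poly[OF A] unfolding h_def by simp
qed

section \<open>The ring of integers\<close>

abbreviation rat_poly :: "int poly \<Rightarrow> rat poly" where
  "rat_poly \<equiv> map_poly of_int"

lemma principal_ideal_eq: "principal_ideal f = {q. rat_poly f dvd q}"
  unfolding principal_ideal_def cgenideal_def
  by (auto simp: cring_class_ops_def dvd_def mult.commute)

lemma ideal_principal_ideal: "ideal (principal_ideal f) cring_class_ops"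
  unfolding principal_ideal_def by (rule cring.cgenideal_ideal[OF cring_class carrier_class])

lemma coset_eq_iff:
  "principal_ideal f +>\<^bsub>cring_class_ops\<^esub> x = principal_ideal f +>\<^bsub>cring_class_ops\<^esub> y
    \<longleftrightarrow> rat_poly f dvd x - y"
  using ring.quotient_eq_iff_same_a_r_cos[OF cring.axioms(1)[OF cring_class] ideal_principal_ideal carrier_class carrier_class, of x y f]
  unfolding principal_ideal_eq by (simp add: minus_class)

lemma finsum_class: "finite A \<Longrightarrow> (\<Oplus>\<^bsub>cring_class_ops\<^esub>i\<in>A. h i) = (\<Sum>i\<in>A. h i)"
  by (induction rule: finite_induct)
     (simp_all add: cring_class.finsum_insert carrier_class Pi_def class_simps)

lemma eval_int_poly_coset:
  "eval_int_poly (number_field f) P (principal_ideal f +>\<^bsub>cring_class_ops\<^esub> x) =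
   principal_ideal f +>\<^bsub>cring_class_ops\<^esub> poly (map_poly of_int P) x"
proof -
  interpret I: ideal "principal_ideal f" "cring_class_ops :: rat poly ring"
    by (rule ideal_principal_ideal)
  let ?h = "(+>\<^bsub>cring_class_ops\<^esub>) (principal_ideal f)"
  interpret h: ring_hom_cring cring_class_ops "number_field f" ?h
    unfolding number_field_def by (rule I.rcos_ring_hom_cring) (rule cring_class)
  have carr: "?h y \<in> carrier (number_field f)" for y by (rule h.hom_closed[OF carrier_class])
  have nat_mult: "[n] \<cdot>\<^bsub>number_field f\<^esub> ?h y = ?h (of_nat n * y)" for n :: nat and y
  proof (induction n)
    case 0
    show ?case using h.hom_zero by (simp add: h.S.add.nat_pow_0 class_simps)
  next
    case (Suc n)
    have "?h (of_nat n * y) \<oplus>\<^bsub>number_field f\<^esub> ?h y = ?h (of_nat n * y + y)"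
      using h.hom_add[OF carrier_class carrier_class, of "of_nat n * y" y] by (simp add: class_simps)
    with Suc show ?case by (simp add: h.S.add.nat_pow_Suc algebra_simps)
  qed
  have int_mult: "[c] \<cdot>\<^bsub>number_field f\<^esub> ?h y = ?h (of_int c * y)" for c :: int and y
  proof (cases "c \<ge> 0")
    case True
    then show ?thesis using nat_mult[of "nat c" y] by (simp add: add_pow_int_ge)
  next
    case False
    hence "[c] \<cdot>\<^bsub>number_field f\<^esub> ?h y = \<ominus>\<^bsub>number_field f\<^esub> ?h (of_nat (nat (- c)) * y)"
      using nat_mult[of "nat (- c)" y] by (simp add: add_pow_int_lt)
    also have "\<dots> = ?h (- (of_nat (nat (- c)) * y))"
      using h.hom_a_inv[OF carrier_class, of "of_nat (nat (- c)) * y"] by (simp add: class_simps)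
    also have "- (of_nat (nat (- c)) * y) = of_int c * y" using False by simp
    finally show ?thesis .
  qed
  have pow: "?h x [^]\<^bsub>number_field f\<^esub> i = ?h (x ^ i)" for i :: nat
    using ring_hom_ring.hom_nat_pow[OF I.rcos_ring_hom_ring carrier_class, of x i]
    unfolding number_field_def by (simp add: class_simps)
  have "eval_int_poly (number_field f) P (?h x) =
      (\<Oplus>\<^bsub>number_field f\<^esub>i\<in>{..Polynomial.degree P}. ?h (of_int (Polynomial.coeff P i) * x ^ i))"
    unfolding eval_int_poly_def pow int_mult ..
  also have "\<dots> = ?h (\<Oplus>\<^bsub>cring_class_ops\<^esub>i\<in>{..Polynomial.degree P}. of_int (Polynomial.coeff P i) * x ^ i)"
    by (subst h.hom_finsum) (simp_all add: carrier_class comp_def Pi_def)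
  also have "(\<Oplus>\<^bsub>cring_class_ops\<^esub>i\<in>{..Polynomial.degree P}. of_int (Polynomial.coeff P i) * x ^ i)
      = (\<Sum>i\<le>Polynomial.degree P. of_int (Polynomial.coeff P i) * x ^ i)"
    by (simp add: finsum_class)
  also have "\<dots> = poly (map_poly of_int P) x"
    by (simp add: poly_altdef)
  finally show ?thesis .
qed

lemma integral_coset:
  assumes "lead_coeff P = 1" "rat_poly f dvd poly (map_poly of_int P) x"
  shows "principal_ideal f +>\<^bsub>cring_class_ops\<^esub> x \<in> ring_of_integers f"
proof -
  interpret I: ideal "principal_ideal f" "cring_class_ops :: rat poly ring"
    by (rule ideal_principal_ideal)
  interpret h: ring_hom_cring cring_class_ops "number_field f" "(+>\<^bsub>cring_class_ops\<^esub>) (principal_ideal f)"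
    unfolding number_field_def by (rule I.rcos_ring_hom_cring) (rule cring_class)
  have zero: "\<zero>\<^bsub>number_field f\<^esub> = principal_ideal f +>\<^bsub>cring_class_ops\<^esub> 0"
    using h.hom_zero by (simp add: class_simps)
  have "principal_ideal f +>\<^bsub>cring_class_ops\<^esub> x \<in> carrier (number_field f)"
    by (rule h.hom_closed[OF carrier_class])
  moreover have "eval_int_poly (number_field f) P (principal_ideal f +>\<^bsub>cring_class_ops\<^esub> x)
      = \<zero>\<^bsub>number_field f\<^esub>"
    unfolding eval_int_poly_coset zero coset_eq_iff using assms(2) by simp
  ultimately show ?thesis unfolding ring_of_integers_def using assms(1) by blast
qed

text \<open>
  An index of 1 means that all cosets of \<open>\<int>[x]/(f)\<close> in the ring of integers
  coincide; those of an integral element and of 0 are compared.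
\<close>

lemma monogenic_integral:
  assumes "monogenic f" "lead_coeff P = 1" "rat_poly f dvd poly (map_poly of_int P) x"
  obtains q where "rat_poly f dvd x - rat_poly q"
proof -
  let ?h = "(+>\<^bsub>cring_class_ops\<^esub>) (principal_ideal f)"
  let ?O = "(number_field f)\<lparr>carrier := ring_of_integers f\<rparr>"
  interpret I: ideal "principal_ideal f" "cring_class_ops :: rat poly ring"
    by (rule ideal_principal_ideal)
  interpret h: ring_hom_cring cring_class_ops "number_field f" ?h
    unfolding number_field_def by (rule I.rcos_ring_hom_cring) (rule cring_class)
  have add: "?h y \<oplus>\<^bsub>number_field f\<^esub> ?h z = ?h (y + z)" for y z
    using h.hom_add[OF carrier_class carrier_class, of y z] by (simp add: class_simps)
  have cosets: "a_rcosets\<^bsub>?O\<^esub> H = (\<Union>z\<in>ring_of_integers f. {\<Union>k\<in>H. {k \<oplus>\<^bsub>number_field f\<^esub> z}})" for H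
    by (simp add: A_RCOSETS_defs r_coset_def)
  obtain c where c: "a_rcosets\<^bsub>?O\<^esub> (equation_order f) = {c}"
    using assms(1) unfolding monogenic_def by (rule card_1_singletonE)
  have coset: "(\<Union>k\<in>equation_order f. {k \<oplus>\<^bsub>number_field f\<^esub> z}) = c"
    if z: "z \<in> ring_of_integers f" for z
  proof -
    have "(\<Union>k\<in>equation_order f. {k \<oplus>\<^bsub>number_field f\<^esub> z}) \<in> a_rcosets\<^bsub>?O\<^esub> (equation_order f)"
      unfolding cosets using z by (rule UN_I) simp
    thus ?thesis unfolding c by (rule singletonD)
  qed
  have "?h x \<in> ring_of_integers f" by (rule integral_coset[OF assms(2,3)])
  moreover have "?h 0 \<in> ring_of_integers f"
    by (rule integral_coset[where P = "[:0, 1:]"]) (simp_all add: map_poly_pCons)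
  ultimately have "(\<Union>k\<in>equation_order f. {k \<oplus>\<^bsub>number_field f\<^esub> ?h x}) =
      (\<Union>k\<in>equation_order f. {k \<oplus>\<^bsub>number_field f\<^esub> ?h 0})"
    using coset by simp
  moreover have "?h (rat_poly 0) \<in> equation_order f" unfolding equation_order_def by blast
  hence "?h 0 \<oplus>\<^bsub>number_field f\<^esub> ?h x \<in> (\<Union>k\<in>equation_order f. {k \<oplus>\<^bsub>number_field f\<^esub> ?h x})" by auto
  ultimately have "?h x \<in> (\<Union>k\<in>equation_order f. {k \<oplus>\<^bsub>number_field f\<^esub> ?h 0})"
    unfolding add by simp
  then obtain q where "?h x = ?h (rat_poly q)" unfolding equation_order_def by (auto simp: add)
  thus ?thesis using that unfolding coset_eq_iff by blast
qed

section \<open>Dedekind's criterion\<close>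

text \<open>
  The ideal \<open>(p, g)\<close> of \<open>\<int>[x]\<close>. The maximal ideals of
  \<open>\<int>[x]\<close> are of this form, with \<open>p\<close> prime and \<open>g\<close>
  monic and irreducible modulo \<open>p\<close>.
\<close>

definition pg_ideal :: "int \<Rightarrow> int poly \<Rightarrow> int poly set" where
  "pg_ideal p g = {[:p:] * y + g * z | y z. True}"

lemma sum_lessThan_add: "(\<Sum>j<m + n. h j) = (\<Sum>j<m. h j) + (\<Sum>j<n. h (m + j))" for h :: "nat \<Rightarrow> 'a :: comm_monoid_add"
  by (induction n) (simp_all add: add.assoc)

text \<open>
  One half of Dedekind's criterion: a monogenic \<open>f\<close> is not in \<open>(p,
  g)\<^sup>2\<close>, which is what the assumptions on \<open>u\<close> and \<open>w\<close>
  amount to. In \<open>\<rat>[x]/(f)\<close> put \<open>\<theta> = u/p\<close>. Then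
  \<open>\<theta> p = u\<close> and \<open>\<theta> g = (f - p w)/p = - w\<close> lie in
  \<open>(p, g)\<close>, so that \<open>\<theta>\<close> maps the image of this ideal into
  itself and is integral by the determinant trick. But \<open>\<theta>\<close> is not in
  \<open>\<int>[x]/(f)\<close>, because \<open>u\<close> is monic of smaller degree than
  \<open>f\<close>.
\<close>

lemma monogenic_not_in_square:
  assumes mono: "monogenic f" and p: "p > 1" and g: "lead_coeff g = 1" "Polynomial.degree g > 0"
    and u: "lead_coeff u = 1" and f: "f = g * u + [:p:] * w"
    and deg: "Polynomial.degree f = Polynomial.degree g + Polynomial.degree u" "lead_coeff f = 1"
    and "u \<in> pg_ideal p g" "w \<in> pg_ideal p g"
  shows False
proof -
  define n where "n = Polynomial.degree f"
  have "n > 0" using deg g n_def by simp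
  obtain y1 z1 where u_eq: "u = [:p:] * y1 + g * z1" using assms unfolding pg_ideal_def by blast
  obtain y2 z2 where w_eq: "w = [:p:] * y2 + g * z2" using assms unfolding pg_ideal_def by blast
  define \<theta> where "\<theta> = [:1 / of_int p:] * rat_poly u"
  have p\<theta>: "[:of_int p:] * \<theta> = rat_poly u" unfolding \<theta>_def using p by simp
  have hom: "rat_poly (a + b) = rat_poly a + rat_poly b" "rat_poly (a * b) = rat_poly a * rat_poly b"
    "rat_poly [:c:] = [:of_int c:]" "rat_poly (sum s S) = (\<Sum>i\<in>S. rat_poly (s i))" for a b c s and S :: "nat set"
    by (simp_all add: hom_distribs map_poly_pCons)
  have g\<theta>: "rat_poly g * \<theta> + rat_poly w = [:1 / of_int p:] * rat_poly f"
  proof -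
    have "[:1 / of_int p:] * rat_poly f = [:1 / of_int p:] * (rat_poly g * rat_poly u) + ([:1 / of_int p:] * [:of_int p:]) * rat_poly w"
      unfolding f hom by (simp only: algebra_simps)
    also have "[:1 / of_int p:] * [:of_int p:] = (1 :: rat poly)" using p by (simp add: one_pCons)
    finally show ?thesis unfolding \<theta>_def by (simp only: algebra_simps mult_1_left mult_1_right)
  qed
  \<comment> \<open>Reduction modulo \<open>f\<close> keeps integer coefficients because \<open>f\<close> is monic.\<close>
  have "\<exists>r. f dvd q - r \<and> (r = 0 \<or> Polynomial.degree r < n)" for q
  proof -
    obtain s r where "q = f * s + r" "r = 0 \<or> Polynomial.degree r < n"
      using monic_division[OF deg(2)] n_def by metis
    thus ?thesis by (intro exI[of _ r]) auto
  qed
  then obtain red where red: "\<And>q. f dvd q - red q" "\<And>q. red q = 0 \<or> Polynomial.degree (red q) < n"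
    by metis
  have red_sum: "(\<Sum>j<n. of_int (Polynomial.coeff (red q) j) * (rat_poly s * Polynomial.monom 1 j))
      = rat_poly s * rat_poly (red q)" for q s
  proof -
    have "rat_poly (red q) = (\<Sum>j<n. Polynomial.monom (of_int (Polynomial.coeff (red q) j)) j)"
      by (rule poly_eqI) (use red(2)[of q] in \<open>auto simp: coeff_sum coeff_eq_0\<close>)
    thus ?thesis
      by (simp add: sum_distrib_left mult_ac of_int_poly smult_monom flip: mult_smult_right)
  qed
  \<comment> \<open>The module \<open>(p, g)/(f)\<close> is spanned by the polynomials \<open>p x\<^sup>k\<close> and \<open>g x\<^sup>k\<close> with \<open>k < n\<close>.\<close>
  define e where "e k = (if k < n then [:p:] else g)" for k :: nat
  define v where "v k = rat_poly (e k) * Polynomial.monom 1 (k mod n)" for k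
  define yz where "yz k = (if k < n then (y1, z1) else (- y2, - z2))" for k :: nat
  define M where "M k j = (if j < n then Polynomial.coeff (red (Polynomial.monom 1 (k mod n) * fst (yz k))) j
     else Polynomial.coeff (red (Polynomial.monom 1 (k mod n) * snd (yz k))) (j - n))" for k j
  have rel: "rat_poly f dvd \<theta> * rat_poly (e k) - rat_poly ([:p:] * fst (yz k) + g * snd (yz k))" for k
  proof (cases "k < n")
    case True
    have "\<theta> * rat_poly (e k) = rat_poly u" using True p\<theta> hom(3)[of p] by (simp add: e_def mult.commute)
    then show ?thesis using True by (simp add: yz_def u_eq)
  next
    case False
    have "\<theta> * rat_poly (e k) = [:1 / of_int p:] * rat_poly f - rat_poly w"
      unfolding g\<theta>[symmetric] using False by (simp add: e_def)
    moreover have "rat_poly ([:p:] * fst (yz k) + g * snd (yz k)) = - rat_poly w"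
      using False unfolding yz_def w_eq by (simp add: hom_distribs)
    ultimately show ?thesis by (simp add: dvd_smult)
  qed
  have *: "rat_poly f dvd \<theta> * v k - (\<Sum>j<2 * n. of_int (M k j) * v j)" for k
  proof -
    let ?X = "Polynomial.monom 1 (k mod n)" and ?X' = "Polynomial.monom 1 (k mod n)"
    have "(\<Sum>j<2 * n. of_int (M k j) * v j) = (\<Sum>j<n. of_int (M k j) * v j) + (\<Sum>j<n. of_int (M k (n + j)) * v (n + j))"
      by (simp add: mult_2 sum_lessThan_add)
    also have "\<dots> = rat_poly [:p:] * rat_poly (red (?X * fst (yz k))) + rat_poly g * rat_poly (red (?X * snd (yz k)))"
      unfolding red_sum[symmetric] by (intro arg_cong2[of _ _ _ _ "(+)"] sum.cong) (auto simp: M_def v_def e_def)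
    also have "\<dots> = rat_poly ([:p:] * red (?X * fst (yz k)) + g * red (?X * snd (yz k)))" unfolding hom ..
    finally have 1: "(\<Sum>j<2 * n. of_int (M k j) * v j) =
      rat_poly ([:p:] * red (?X * fst (yz k)) + g * red (?X * snd (yz k)))" .
    have "f dvd [:p:] * (?X * fst (yz k) - red (?X * fst (yz k))) + g * (?X * snd (yz k) - red (?X * snd (yz k)))"
      by (intro dvd_add dvd_mult red)
    hence "rat_poly f dvd rat_poly (?X * ([:p:] * fst (yz k) + g * snd (yz k)) - ([:p:] * red (?X * fst (yz k)) + g * red (?X * snd (yz k))))"
      by (intro of_int_poly_hom.hom_dvd) (simp only: algebra_simps)
    hence 2: "rat_poly f dvd ?X' * rat_poly ([:p:] * fst (yz k) + g * snd (yz k)) - (\<Sum>j<2 * n. of_int (M k j) * v j)"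
      unfolding 1 by (simp add: hom_distribs)
    have 3: "rat_poly f dvd ?X' * (\<theta> * rat_poly (e k) - rat_poly ([:p:] * fst (yz k) + g * snd (yz k)))"
      by (intro dvd_mult rel)
    show ?thesis using dvd_add[OF 3 2] unfolding v_def by (simp add: algebra_simps)
  qed
  obtain P :: "int poly" where P: "lead_coeff P = 1" "\<And>k. k < 2 * n \<Longrightarrow> rat_poly f dvd poly (map_poly of_int P) \<theta> * v k"
    using stable_module_integral[of "2 * n" "rat_poly f" \<theta> v M] * by blast
  \<comment> \<open>The generator \<open>p\<close> is invertible in \<open>\<rat>[x]\<close>, so that the module is faithful.\<close>
  have v0: "v 0 = [:of_int p:]"
    using \<open>n > 0\<close> hom(3)[of p] unfolding v_def e_def by simp
  have "rat_poly f dvd poly (map_poly of_int P) \<theta> * v 0" using P(2)[of 0] \<open>n > 0\<close> by simp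
  hence "rat_poly f dvd poly (map_poly of_int P) \<theta>" unfolding v0 using p by (simp add: dvd_smult_iff)
  from monogenic_integral[OF mono P(1) this] obtain q where q: "rat_poly f dvd \<theta> - rat_poly q" .
  have "rat_poly f dvd rat_poly (q - red q)" by (rule of_int_poly_hom.hom_dvd[OF red(1)])
  from dvd_add[OF q this] have q': "rat_poly f dvd \<theta> - rat_poly (red q)" by (simp add: hom_distribs)
  have "\<theta> - rat_poly (red q) = 0"
  proof (rule monic_dvd_small[OF _ q'])
    show "lead_coeff (rat_poly f) = 1" using deg(2) by simp
    have "Polynomial.degree \<theta> \<le> Polynomial.degree (rat_poly u)"
      unfolding \<theta>_def using degree_mult_le[of "[:1 / of_int p:]" "rat_poly u"] by simp
    also have "\<dots> < n" unfolding n_def using g deg by simp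
    finally have "Polynomial.degree \<theta> < n" .
    moreover have "Polynomial.degree (rat_poly (red q)) < n" using red(2)[of q] \<open>n > 0\<close> by auto
    ultimately have "Polynomial.degree (\<theta> - rat_poly (red q)) < n" by (rule degree_diff_less)
    thus "\<theta> - rat_poly (red q) = 0 \<or>
        Polynomial.degree (\<theta> - rat_poly (red q)) < Polynomial.degree (rat_poly f)"
      unfolding n_def by simp
  qed
  hence "rat_poly u = rat_poly ([:p:] * red q)" using p\<theta> unfolding hom by simp
  hence "u = [:p:] * red q" unfolding of_int_poly_hom.eq_iff .
  hence "lead_coeff u = p * Polynomial.coeff (red q) (Polynomial.degree u)"
    by (metis coeff_smult mult_pCons_left mult_zero_left pCons_0_0 add_0_right)
  hence "p dvd 1" using u by (metis dvd_triv_left)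
  thus False using p by simp
qed

section \<open>Divisibility modulo \<open>N\<close>\<close>

lemma const_dvd_iff: "[:c:] dvd p \<longleftrightarrow> (\<forall>i. c dvd Polynomial.coeff p i)" for c :: int
  by (rule const_poly_dvd_iff)

lemma residue_finsum:
  assumes "N > 1" "finite S" "\<And>i. i \<in> S \<Longrightarrow> h i \<in> carrier (residue_ring N)"
  shows "(\<Oplus>\<^bsub>residue_ring N\<^esub>i\<in>S. h i) = (\<Sum>i\<in>S. h i) mod N"
proof -
  interpret residues N "residue_ring N" by unfold_locales (use assms in auto)
  show ?thesis using assms(2,3)
  proof (induction S rule: finite_induct)
    case empty
    then show ?case using assms(1) by (simp add: res_zero_eq)
  next
    case (insert x S)
    then show ?case
      by (subst finsum_insert) (auto simp: res_add_eq mod_simps)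
  qed
qed

text \<open>
  Divisibility in the ring of coefficient sequences over the residues modulo \<open>N\<close>,
  expressed by integer polynomials.
\<close>

lemma factor_mod_imp:
  assumes "N > 1" "factor_mod N a f"
  obtains q where "[:N:] dvd f - a * q"
proof -
  interpret residues N "residue_ring N" by unfold_locales (use assms in auto)
  have carr: "k mod N \<in> carrier (residue_ring N)" for k using assms(1) by (simp add: res_carrier_eq)
  have up: "reduce_poly N p \<in> up (residue_ring N)" for p
  proof (rule mem_upI)
    show "reduce_poly N p n \<in> carrier (residue_ring N)" for n unfolding reduce_poly_def by (rule carr)
    show "\<exists>n. bound \<zero>\<^bsub>residue_ring N\<^esub> n (reduce_poly N p)"
      by (intro exI[of _ "Polynomial.degree p"] bound.intro) (simp add: reduce_poly_def coeff_eq_0 res_zero_eq)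
  qed
  obtain c where c: "c \<in> up (residue_ring N)" "reduce_poly N f = reduce_poly N a \<otimes>\<^bsub>UP (residue_ring N)\<^esub> c"
    using assms(2) unfolding factor_mod_def factor_def by (auto simp: UP_def)
  obtain n where n: "bound \<zero>\<^bsub>residue_ring N\<^esub> n c" using c(1) unfolding up_def by blast
  define q where "q = Poly (map c [0..<Suc n])"
  have q: "Polynomial.coeff q i = c i" for i
    using bound.bound[OF n, of i] by (auto simp: q_def nth_default_def res_zero_eq simp del: upt_Suc)
  have "N dvd Polynomial.coeff (f - a * q) i" for i
  proof -
    have "Polynomial.coeff f i mod N = reduce_poly N f i" by (simp add: reduce_poly_def)
    also have "\<dots> = (\<Oplus>\<^bsub>residue_ring N\<^esub>j\<in>{..i}. reduce_poly N a j \<otimes>\<^bsub>residue_ring N\<^esub> c (i - j))"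
      unfolding c(2) using up c(1) by (simp add: UP_def)
    also have "\<dots> = (\<Sum>j\<le>i. (Polynomial.coeff a j mod N * c (i - j)) mod N) mod N"
      by (subst residue_finsum) (use assms(1) carr in \<open>auto simp: res_mult_eq reduce_poly_def\<close>)
    also have "\<dots> = (\<Sum>j\<le>i. Polynomial.coeff a j * c (i - j)) mod N"
      by (simp add: mod_simps mod_sum_eq)
    also have "\<dots> = Polynomial.coeff (a * q) i mod N" by (simp add: coeff_mult q)
    finally show ?thesis by (simp add: mod_eq_dvd_iff)
  qed
  thus ?thesis using that[of q] unfolding const_dvd_iff by blast
qed

section \<open>Prime ideals of integer polynomials\<close>

definition is_ideal :: "int poly set \<Rightarrow> bool" where
  "is_ideal K \<longleftrightarrow> (\<forall>x\<in>K. \<forall>y\<in>K. x + y \<in> K) \<and> (\<forall>x\<in>K. \<forall>r. r * x \<in> K)"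

lemma is_ideal_add: "is_ideal K \<Longrightarrow> x \<in> K \<Longrightarrow> y \<in> K \<Longrightarrow> x + y \<in> K"
  and is_ideal_mult: "is_ideal K \<Longrightarrow> x \<in> K \<Longrightarrow> r * x \<in> K"
  unfolding is_ideal_def by blast+

lemma is_ideal_mult': "is_ideal K \<Longrightarrow> x \<in> K \<Longrightarrow> x * r \<in> K"
  using is_ideal_mult[of K x r] by (simp add: mult.commute)

lemma is_ideal_diff: "is_ideal K \<Longrightarrow> x \<in> K \<Longrightarrow> y \<in> K \<Longrightarrow> x - y \<in> K"
  using is_ideal_add[of K x "- 1 * y"] is_ideal_mult[of K y "- 1"] by simp

lemma is_ideal_dvd: "is_ideal K \<Longrightarrow> x \<in> K \<Longrightarrow> x dvd y \<Longrightarrow> y \<in> K"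
  using is_ideal_mult' by (metis dvdE)

definition span3 :: "int poly \<Rightarrow> int poly \<Rightarrow> int poly \<Rightarrow> int poly set" where
  "span3 a b c = {a * x + b * y + c * z | x y z. True}"

lemma is_ideal_span3: "is_ideal (span3 a b c)"
  unfolding is_ideal_def span3_def
proof (intro conjI ballI allI)
  fix u v assume "u \<in> {a * x + b * y + c * z | x y z. True}" "v \<in> {a * x + b * y + c * z | x y z. True}"
  then obtain x y z x' y' z' where "u = a * x + b * y + c * z" "v = a * x' + b * y' + c * z'" by blast
  hence "u + v = a * (x + x') + b * (y + y') + c * (z + z')" by (simp add: algebra_simps)
  thus "u + v \<in> {a * x + b * y + c * z | x y z. True}" by blast
next
  fix u r assume "u \<in> {a * x + b * y + c * z | x y z. True}"
  then obtain x y z where "u = a * x + b * y + c * z" by blast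
  hence "r * u = a * (r * x) + b * (r * y) + c * (r * z)" by (simp add: algebra_simps)
  thus "r * u \<in> {a * x + b * y + c * z | x y z. True}" by blast
qed

lemma span3_gens: "a \<in> span3 a b c" "b \<in> span3 a b c" "c \<in> span3 a b c"
proof -
  have "a = a * 1 + b * 0 + c * 0" "b = a * 0 + b * 1 + c * 0" "c = a * 0 + b * 0 + c * 1" by simp_all
  thus "a \<in> span3 a b c" "b \<in> span3 a b c" "c \<in> span3 a b c" unfolding span3_def by blast+
qed

lemma span3_least: "is_ideal K \<Longrightarrow> a \<in> K \<Longrightarrow> b \<in> K \<Longrightarrow> c \<in> K \<Longrightarrow> span3 a b c \<subseteq> K"
  unfolding span3_def by (auto intro!: is_ideal_add is_ideal_mult')

lemma pg_ideal_span3: "pg_ideal p g = span3 [:p:] g 0"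
  unfolding pg_ideal_def span3_def by auto

lemma is_ideal_pg: "is_ideal (pg_ideal p g)"
  unfolding pg_ideal_span3 by (rule is_ideal_span3)

lemma pg_gens: "[:p:] \<in> pg_ideal p g" "g \<in> pg_ideal p g"
  unfolding pg_ideal_span3 by (rule span3_gens)+

lemma pg_least: "is_ideal K \<Longrightarrow> [:p:] \<in> K \<Longrightarrow> g \<in> K \<Longrightarrow> pg_ideal p g \<subseteq> K"
  unfolding pg_ideal_span3 using span3_least[of K "[:p:]" g 0] is_ideal_mult[of K g 0] by simp

lemma coprime_in_ZxI:
  assumes "1 \<in> span3 g h [:N:]"
  shows "coprime_in_Zx g h N"
proof -
  let ?I = "Idl\<^bsub>cring_class_ops\<^esub> {g, h, [:N:]}"
  have R: "ring (cring_class_ops :: int poly ring)" by (rule cring.axioms(1)[OF cring_class])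
  have sub: "{g, h, [:N:]} \<subseteq> carrier cring_class_ops" by (simp add: cring_class_ops_def)
  interpret I: ideal ?I "cring_class_ops :: int poly ring" by (rule ring.genideal_ideal[OF R sub])
  have "is_ideal ?I"
    unfolding is_ideal_def using I.a_closed I.I_l_closed[OF _ carrier_class] by (simp add: class_simps)
  hence "span3 g h [:N:] \<subseteq> ?I"
    using ring.genideal_self[OF R sub] by (intro span3_least) auto
  hence "?I = carrier cring_class_ops"
    using assms by (intro I.one_imp_carrier) (auto simp: class_simps)
  thus ?thesis unfolding coprime_in_Zx_def by (simp add: cring_class_ops_def)
qed

text \<open>
  If an ideal is coprime to every prime factor of \<open>N\<close>, it is coprime to the
  product: relations \<open>1 = j + p z\<close> and \<open>1 = j' + N z'\<close> are inserted
  into each other.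
\<close>

lemma one_in_span3_if_primes:
  fixes N :: int
  assumes "N \<noteq> 0" "\<And>p. Factorial_Ring.prime p \<Longrightarrow> p dvd N \<Longrightarrow> 1 \<in> span3 g h [:p:]"
  shows "1 \<in> span3 g h [:N:]"
  using assms
proof (induction N rule: prime_divisors_induct)
  case (unit N)
  obtain k where "1 = N * k" by (rule dvdE[OF unit(1)])
  hence "[:N:] dvd 1" by (intro dvdI[of _ _ "[:k:]"]) (simp add: one_pCons mult.commute)
  thus ?case using is_ideal_dvd[OF is_ideal_span3 span3_gens(3)] by blast
next
  case (factor p N)
  have "1 \<in> span3 g h [:p:]" "1 \<in> span3 g h [:N:]"
    using factor by (auto intro: dvd_mult)
  then obtain x y z x' y' z' where
    *: "1 = g * x + h * y + [:p:] * z" "1 = g * x' + h * y' + [:N:] * z'" unfolding span3_def by blast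
  have "1 = g * x + h * y + [:p:] * z * (g * x' + h * y' + [:N:] * z')"
    unfolding *(2)[symmetric] using *(1) by simp
  also have "\<dots> = g * (x + [:p:] * z * x') + h * (y + [:p:] * z * y') + ([:p:] * [:N:]) * (z * z')"
    by (simp only: algebra_simps)
  also have "[:p:] * [:N:] = [:p * N:]" by simp
  finally show ?case unfolding span3_def by blast
qed simp

text \<open>
  Modulo \<open>p\<close> the ideal consists of the multiples of the monic polynomial
  \<open>g\<close>, and the only small multiple is 0.
\<close>

lemma pg_ideal_small:
  assumes "lead_coeff g = 1" "r \<in> pg_ideal p g" "r = 0 \<or> Polynomial.degree r < Polynomial.degree g"
  shows "[:p:] dvd r"
proof -
  obtain y z where r: "r = [:p:] * y + g * z" using assms(2) unfolding pg_ideal_def by blast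
  obtain s t where y: "y = g * s + t" "t = 0 \<or> Polynomial.degree t < Polynomial.degree g"
    using monic_division[OF assms(1)] by metis
  have "r - [:p:] * t = 0"
  proof (rule monic_dvd_small[OF assms(1)])
    have "r - [:p:] * t = g * ([:p:] * s + z)" unfolding r y(1) by (simp only: algebra_simps)
    thus "g dvd r - [:p:] * t" by simp
    have "Polynomial.degree (r - [:p:] * t) \<le> max (Polynomial.degree r) (Polynomial.degree t)"
      using degree_diff_le_max[of r "[:p:] * t"] degree_smult_le[of p t] by simp
    thus "r - [:p:] * t = 0 \<or> Polynomial.degree (r - [:p:] * t) < Polynomial.degree g"
      using assms(3) y(2) by (cases "r = 0"; cases "t = 0") (auto intro: le_less_trans)
  qed
  hence "r = [:p:] * t" by (rule eq_iff_diff_eq_0[THEN iffD2])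
  thus ?thesis by (rule dvdI)
qed

text \<open>
  The ring of polynomials over the field with \<open>p\<close> elements is a principal ideal
  domain; \<open>h\<close> is a monic polynomial of least degree in \<open>K\<close>. An element
  of smaller degree has a leading coefficient divisible by \<open>p\<close>, since otherwise it
  could be made monic with the help of \<open>p \<in> K\<close>.
\<close>

lemma monic_generator:
  assumes K: "is_ideal K" and p: "Factorial_Ring.prime p" "[:p:] \<in> K" and b: "lead_coeff b = 1" "b \<in> K"
  obtains h where "lead_coeff h = 1" "h \<in> K"
    "\<And>q. q \<in> K \<Longrightarrow> lead_coeff q = 1 \<Longrightarrow> Polynomial.degree h \<le> Polynomial.degree q"
    "\<And>r. r \<in> K \<Longrightarrow> r = 0 \<or> Polynomial.degree r < Polynomial.degree h \<Longrightarrow> [:p:] dvd r"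
    "K \<subseteq> pg_ideal p h"
proof -
  obtain h where h: "lead_coeff h = 1" "h \<in> K"
    and least: "\<And>q. lead_coeff q = 1 \<Longrightarrow> q \<in> K \<Longrightarrow> Polynomial.degree h \<le> Polynomial.degree q"
    using ex_has_least_nat[of "\<lambda>q. lead_coeff q = 1 \<and> q \<in> K" b Polynomial.degree] b by blast
  have small: "[:p:] dvd r" if "r \<in> K" "r = 0 \<or> Polynomial.degree r < Polynomial.degree h" for r
    using that
  proof (induction "Polynomial.degree r" arbitrary: r rule: less_induct)
    case (less r)
    show ?case
    proof (cases "r = 0")
      case False
      define c d where "c = lead_coeff r" and "d = Polynomial.degree r"
      have d: "d < Polynomial.degree h" using less.prems False d_def by simp
      have "p dvd c"
      proof (rule ccontr)
        assume "\<not> p dvd c"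
        hence "coprime c p" using p(1) by (metis coprime_commute prime_imp_coprime)
        then obtain i j where ij: "i * c + j * p = 1" using bezout_int[of c p] by auto
        define r' where "r' = [:i:] * r + Polynomial.monom j d * [:p:]"
        have "r' \<in> K" unfolding r'_def
          by (intro is_ideal_add[OF K] is_ideal_mult[OF K] less.prems p)
        moreover have cd: "Polynomial.coeff r' d = 1"
          unfolding r'_def using ij c_def d_def by (simp add: mult.commute)
        moreover have "Polynomial.degree r' \<le> d"
          unfolding r'_def d_def
          by (rule degree_le) (auto simp: coeff_eq_0)
        hence "Polynomial.degree r' = d" using cd by (metis le_antisym le_degree zero_neq_one)
        ultimately have "Polynomial.degree h \<le> d" using least[of r'] by simp
        thus False using d by simp
      qed
      then obtain k where k: "c = p * k" by auto
      define r' where "r' = r - Polynomial.monom k d * [:p:]"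
      have "r' \<in> K" unfolding r'_def by (intro is_ideal_diff[OF K] is_ideal_mult[OF K] less.prems p)
      moreover have "Polynomial.coeff r' d = 0" unfolding r'_def using k c_def d_def by (simp add: mult.commute)
      moreover have "Polynomial.degree r' \<le> d"
        unfolding r'_def d_def by (rule degree_le) (auto simp: coeff_eq_0)
      ultimately have "r' = 0 \<or> Polynomial.degree r' < d"
        by (metis le_neq_implies_less leading_coeff_0_iff)
      hence "[:p:] dvd r'" using less.hyps[of r'] \<open>r' \<in> K\<close> d d_def by (cases "r' = 0") auto
      moreover have "r = r' + Polynomial.monom k d * [:p:]" unfolding r'_def by simp
      ultimately show ?thesis by (metis dvd_add dvd_triv_right)
    qed simp
  qed
  have "q \<in> pg_ideal p h" if q: "q \<in> K" for q
  proof -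
    obtain s r where qr: "q = h * s + r" "r = 0 \<or> Polynomial.degree r < Polynomial.degree h"
      using monic_division[OF h(1)] by metis
    have "r = q - h * s" using qr by simp
    hence "r \<in> K" using q h by (auto intro: is_ideal_diff[OF K] is_ideal_mult'[OF K])
    hence "[:p:] dvd r" using small qr(2) by blast
    then obtain y where "r = [:p:] * y" by (rule dvdE)
    thus ?thesis unfolding pg_ideal_def using qr(1) by (auto simp: add.commute)
  qed
  thus ?thesis using that[of h] h least small by blast
qed

text \<open>
  Among the ideals \<open>(p, g)\<close> above \<open>J\<close>, with \<open>g\<close> monic and
  not constant, one with \<open>g\<close> of least degree is maximal: adjoining an element
  outside of it gives an ideal \<open>(p, h)\<close> with \<open>h\<close> of smaller degree,
  that is \<open>h = 1\<close>. Maximal ideals are prime.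
\<close>

lemma prime_ideal_above:
  assumes J: "is_ideal J" and p: "Factorial_Ring.prime p" "[:p:] \<in> J" and b: "lead_coeff b = 1" "b \<in> J"
    and proper: "1 \<notin> J"
  obtains g where "lead_coeff g = 1" "Polynomial.degree g > 0" "J \<subseteq> pg_ideal p g"
    "\<And>x y. x * y \<in> pg_ideal p g \<Longrightarrow> x \<in> pg_ideal p g \<or> y \<in> pg_ideal p g"
proof -
  have one: "q = 1" if q: "lead_coeff q = 1" "Polynomial.degree q = 0" for q :: "int poly"
  proof -
    obtain c where "q = [:c:]" using degree_eq_zeroE[OF q(2)] by blast
    thus ?thesis using q(1) by (simp add: one_pCons)
  qed
  let ?P = "\<lambda>g. lead_coeff g = 1 \<and> Polynomial.degree g > 0 \<and> J \<subseteq> pg_ideal p g"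
  obtain h where h: "lead_coeff h = 1" "h \<in> J" "J \<subseteq> pg_ideal p h"
    by (rule monic_generator[OF J p b])
  have "Polynomial.degree h \<noteq> 0" using one[OF h(1)] h(2) proper by metis
  hence "?P h" using h by blast
  then obtain g where g: "?P g" and least: "\<And>q. ?P q \<Longrightarrow> Polynomial.degree g \<le> Polynomial.degree q"
    using ex_has_least_nat[of ?P h Polynomial.degree] by blast
  have "y \<in> pg_ideal p g" if xy: "x * y \<in> pg_ideal p g" and x: "x \<notin> pg_ideal p g" for x y
  proof -
    let ?K = "span3 [:p:] g x"
    have pgK: "pg_ideal p g \<subseteq> ?K" by (intro pg_least is_ideal_span3 span3_gens)
    obtain h where h: "lead_coeff h = 1" "h \<in> ?K"
      "\<And>q. q \<in> ?K \<Longrightarrow> lead_coeff q = 1 \<Longrightarrow> Polynomial.degree h \<le> Polynomial.degree q"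
      "\<And>r. r \<in> ?K \<Longrightarrow> r = 0 \<or> Polynomial.degree r < Polynomial.degree h \<Longrightarrow> [:p:] dvd r"
      "?K \<subseteq> pg_ideal p h"
      by (rule monic_generator[OF is_ideal_span3[of "[:p:]" g x] p(1) span3_gens(1) conjunct1[OF g] span3_gens(2)])
        (rule that; assumption)
    have hg: "Polynomial.degree h \<le> Polynomial.degree g"
      using h(3)[OF span3_gens(2)] g by blast
    have "h = 1"
    proof (rule ccontr)
      assume "h \<noteq> 1"
      hence "?P h" using one[OF h(1)] h(1,5) g pgK by (meson neq0_conv subset_trans)
      hence deg: "Polynomial.degree h = Polynomial.degree g" using least hg by (simp add: le_antisym)
      have "Polynomial.degree (g - h) < Polynomial.degree h \<or> g - h = 0"
      proof (cases "g - h = 0")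
        case False
        have "Polynomial.coeff (g - h) (Polynomial.degree h) = 0" using h(1) g deg by simp
        moreover have "Polynomial.degree (g - h) \<le> Polynomial.degree h"
          using degree_diff_le_max[of g h] deg by simp
        ultimately show ?thesis using False by (metis le_neq_implies_less leading_coeff_0_iff)
      qed simp
      moreover have "g - h \<in> ?K" by (intro is_ideal_diff is_ideal_span3 span3_gens h)
      ultimately have "[:p:] dvd g - h" using h(4) by blast
      hence "g - h \<in> pg_ideal p g" by (rule is_ideal_dvd[OF is_ideal_pg pg_gens(1)])
      hence "h \<in> pg_ideal p g" using is_ideal_diff[OF is_ideal_pg pg_gens(2), of "g - h" p g] by simp
      hence "pg_ideal p h \<subseteq> pg_ideal p g" by (intro pg_least is_ideal_pg pg_gens)
      moreover have "x \<in> pg_ideal p h" using h(5) span3_gens(3) by blast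
      ultimately show False using x by blast
    qed
    then obtain i j k where "1 = [:p:] * i + g * j + x * k" using h(2) unfolding span3_def by blast
    hence "y = y * ([:p:] * i + g * j + x * k)" by simp
    also have "\<dots> = (y * i) * [:p:] + (y * j) * g + k * (x * y)" by (simp only: algebra_simps)
    also have "\<dots> \<in> pg_ideal p g"
      by (intro is_ideal_add[OF is_ideal_pg] is_ideal_mult[OF is_ideal_pg] pg_gens xy)
    finally show ?thesis .
  qed
  thus ?thesis using g by (intro that[of g]) blast+
qed

section \<open>Splitting off the common divisors with a second polynomial\<close>

lemma monic_power_degree:
  assumes "lead_coeff (g :: int poly) = 1"
  shows "lead_coeff (g ^ k) = 1 \<and> Polynomial.degree (g ^ k) = k * Polynomial.degree g"
proof (induction k)
  case (Suc k)
  have "g ^ k \<noteq> 0" using Suc by (metis leading_coeff_0_iff zero_neq_one)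
  moreover have "g \<noteq> 0" using assms by auto
  ultimately show ?case
    using degree_monic_mult[OF assms, of "g ^ k"] Suc by (metis mult_Suc power_Suc)
qed simp

lemma monic_not_in_high_power:
  assumes p: "p > 1" and g: "lead_coeff g = 1" "Polynomial.degree g > 0"
    and a: "lead_coeff a = 1" "Polynomial.degree a < k"
  shows "a \<notin> pg_ideal p (g ^ k)"
proof
  assume *: "a \<in> pg_ideal p (g ^ k)"
  have gk: "lead_coeff (g ^ k) = 1" "Polynomial.degree (g ^ k) = k * Polynomial.degree g"
    using monic_power_degree[OF g(1)] by blast+
  have "k * 1 \<le> k * Polynomial.degree g" using g(2) by (intro mult_left_mono) auto
  hence "Polynomial.degree a < Polynomial.degree (g ^ k)" using a(2) gk(2) by linarith
  hence "[:p:] dvd a" using pg_ideal_small[OF gk(1) *] by blast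
  hence "p dvd lead_coeff a" unfolding const_dvd_iff by blast
  thus False using a p by simp
qed

text \<open>
  If \<open>A\<close> and \<open>f1\<close> were both in \<open>(p, g)\<close>, so would be the
  two factors of \<open>a A\<close> and of \<open>N f1\<close>, and \<open>f\<close> would be in
  the square of the ideal.
\<close>

lemma monogenic_cofactor_not_in_ideal:
  assumes f: "monogenic f" "lead_coeff f = 1" "f = a * A + [:N:] * f1"
    and a: "lead_coeff a = 1" and A: "lead_coeff A = 1"
    and deg: "Polynomial.degree f = Polynomial.degree a + Polynomial.degree A"
    and p: "p > 1" "p dvd N" and g: "lead_coeff g = 1" "Polynomial.degree g > 0"
    and in_ideal: "a \<in> pg_ideal p g" "f1 \<in> pg_ideal p g"
  shows "A \<notin> pg_ideal p g"
proof
  assume A_in: "A \<in> pg_ideal p g"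
  obtain b r where b: "a = g * b + r" "r = 0 \<or> Polynomial.degree r < Polynomial.degree g"
    using monic_division[OF g(1)] by metis
  have "a - g * b \<in> pg_ideal p g"
    by (intro is_ideal_diff is_ideal_pg is_ideal_mult' pg_gens in_ideal)
  hence "[:p:] dvd r" using pg_ideal_small[OF g(1) _ b(2)] b(1) by simp
  then obtain t where t: "r = [:p:] * t" by (rule dvdE)
  obtain M where M: "N = p * M" using p(2) by (rule dvdE)
  have ga: "Polynomial.degree g \<le> Polynomial.degree a"
  proof (rule ccontr)
    assume "\<not> ?thesis"
    hence "[:p:] dvd a" using pg_ideal_small[OF g(1) in_ideal(1)] by simp
    hence "p dvd lead_coeff a" unfolding const_dvd_iff by blast
    thus False using a p by simp
  qed
  have ra: "r = 0 \<or> Polynomial.degree r < Polynomial.degree a" using b(2) ga by auto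
  have "lead_coeff (g * b) = 1 \<and> Polynomial.degree (g * b) = Polynomial.degree a"
  proof (cases "r = 0")
    case True
    then show ?thesis using b a by simp
  next
    case False
    have gb: "g * b = a - r" using b(1) by simp
    have "Polynomial.degree (a + - r) = Polynomial.degree a"
      using ra False by (intro degree_add_eq_left) simp
    moreover have "Polynomial.coeff (a + - r) (Polynomial.degree a) = 1"
      using ra False a by (simp add: coeff_eq_0)
    ultimately show ?thesis unfolding gb by simp
  qed
  moreover from this have "b \<noteq> 0" by auto
  ultimately have b_monic: "lead_coeff b = 1" "Polynomial.degree a = Polynomial.degree g + Polynomial.degree b"
    using degree_monic_mult[OF g(1), of b] by auto
  have "A \<noteq> 0" using A by auto
  note bA = degree_monic_mult[OF b_monic(1) this]
  show False
  proof (rule monogenic_not_in_square[OF f(1) p(1) g, of "b * A" "t * A + [:M:] * f1"])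
    have "f = (g * b + [:p:] * t) * A + ([:p:] * [:M:]) * f1"
      unfolding f(3) b(1) t M by (simp add: mult.commute)
    thus "f = g * (b * A) + [:p:] * (t * A + [:M:] * f1)" by (simp only: algebra_simps)
    show "t * A + [:M:] * f1 \<in> pg_ideal p g"
      by (intro is_ideal_add[OF is_ideal_pg] is_ideal_mult[OF is_ideal_pg] A_in in_ideal)
    show "b * A \<in> pg_ideal p g" by (intro is_ideal_mult[OF is_ideal_pg] A_in)
  qed (use bA A deg b_monic f(2) in simp_all)
qed

text \<open>
  Over a field this says that \<open>e'\<close> is \<open>e / gcd(e, f1)\<close> up to a unit,
  with \<open>r\<close> as the gcd: \<open>c e = e' r\<close>, the polynomial \<open>r\<close>
  is in the ideal \<open>(e, f1)\<close>, and \<open>e' f1\<close> is a multiple of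
  \<open>e\<close>.
\<close>

definition cofactor_step :: "int \<Rightarrow> int poly \<Rightarrow> int poly \<Rightarrow> int poly \<Rightarrow> bool" where
  "cofactor_step N f1 e e' \<longleftrightarrow> (\<exists>c r x y z. coprime c N \<and> [:N:] dvd [:c:] * e - e' * r \<and>
     [:N:] dvd r - (e * x + f1 * y) \<and> [:N:] dvd e' * f1 - e * z)"

lemma cofactor_chain_annihilates:
  "(cofactor_step N f1 ^^ n) a e \<Longrightarrow> \<exists>z. [:N:] dvd e * f1 ^ n - a * z"
proof (induction n arbitrary: e)
  case 0
  then show ?case by (intro exI[of _ 1]) simp
next
  case (Suc n)
  then obtain e0 where e0: "(cofactor_step N f1 ^^ n) a e0" "cofactor_step N f1 e0 e" by auto
  from Suc.IH[OF e0(1)] obtain z where z: "[:N:] dvd e0 * f1 ^ n - a * z" by blast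
  from e0(2) obtain z' where "[:N:] dvd e * f1 - e0 * z'" unfolding cofactor_step_def by blast
  hence "[:N:] dvd (e * f1 - e0 * z') * f1 ^ n + (e0 * f1 ^ n - a * z) * z'"
    using z by (intro dvd_add dvd_mult2)
  also have "\<dots> = e * f1 ^ Suc n - a * (z * z')" by (simp add: algebra_simps)
  finally show ?case by blast
qed

text \<open>
  Every step splits a factor \<open>r\<close> off from \<open>e\<close>. If the last polynomial
  of the chain and \<open>f1\<close> are in the ideal, all polynomials of the chain are, hence
  so are all the factors split off, whose product is in \<open>(p, g\<^sup>n)\<close>.
\<close>

lemma cofactor_chain_power:
  assumes p: "Factorial_Ring.prime p" "p dvd N" and f1: "f1 \<in> pg_ideal p g"
  shows "(cofactor_step N f1 ^^ n) a e \<Longrightarrow> e \<in> pg_ideal p g \<Longrightarrow>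
    \<exists>R \<in> pg_ideal p (g ^ n). [:p:] dvd a - e * R"
proof (induction n arbitrary: e)
  case 0
  have "1 \<in> pg_ideal p (g ^ 0)" using pg_gens(2)[of "g ^ 0" p] by simp
  with 0 show ?case by (intro bexI[of _ 1]) auto
next
  case (Suc n)
  have Np: "[:p:] dvd q" if "[:N:] dvd q" for q
    using that p(2) unfolding const_dvd_iff by (auto intro: dvd_trans)
  from Suc obtain e0 where e0: "(cofactor_step N f1 ^^ n) a e0" "cofactor_step N f1 e0 e" by auto
  then obtain c r x y where c: "coprime c N" and cr: "[:p:] dvd [:c:] * e0 - e * r"
    and r: "[:p:] dvd r - (e0 * x + f1 * y)" unfolding cofactor_step_def by (blast intro: Np)
  have "coprime c p" using c p(2) by (meson coprime_divisors dvd_refl)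
  then obtain i j where ij: "i * c + j * p = 1" using bezout_int[of c p] by auto
  have "[:i:] * [:c:] + [:j:] * [:p:] = (1 :: int poly)" using ij by (simp add: one_pCons mult.commute)
  hence "e0 - e * ([:i:] * r) = ([:i:] * [:c:] + [:j:] * [:p:]) * e0 - e * ([:i:] * r)" by simp
  also have "\<dots> = [:i:] * ([:c:] * e0 - e * r) + [:p:] * ([:j:] * e0)" by (simp only: algebra_simps)
  finally have e0_eq: "[:p:] dvd e0 - e * ([:i:] * r)"
    using dvd_add[OF dvd_mult[OF cr] dvd_triv_left] by metis
  have in_ideal: "q' \<in> pg_ideal p g" if "q \<in> pg_ideal p g" "[:p:] dvd q' - q" for q q'
    using is_ideal_add[OF is_ideal_pg that(1) is_ideal_dvd[OF is_ideal_pg pg_gens(1) that(2)]] by simp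
  have e0_in: "e0 \<in> pg_ideal p g"
    by (rule in_ideal[OF is_ideal_mult'[OF is_ideal_pg Suc.prems(2)] e0_eq])
  have r_in: "[:i:] * r \<in> pg_ideal p g"
    by (intro is_ideal_mult[OF is_ideal_pg] in_ideal[OF _ r] is_ideal_add[OF is_ideal_pg]
        is_ideal_mult'[OF is_ideal_pg] e0_in f1)
  from Suc.IH[OF e0(1) e0_in] obtain R where R: "R \<in> pg_ideal p (g ^ n)" "[:p:] dvd a - e0 * R" by blast
  obtain u v u' v' where uv: "[:i:] * r = [:p:] * u + g * v" "R = [:p:] * u' + g ^ n * v'"
    using r_in R(1) unfolding pg_ideal_def by blast
  have "[:i:] * r * R = [:p:] * (u * R) + g * v * ([:p:] * u' + g ^ n * v')"
    unfolding uv(1) uv(2)[symmetric] by (simp only: algebra_simps)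
  hence "[:i:] * r * R = [:p:] * (u * R + g * v * u') + (g * g ^ n) * (v * v')"
    by (simp only: algebra_simps)
  hence "[:i:] * r * R \<in> pg_ideal p (g ^ Suc n)" unfolding pg_ideal_def by auto
  moreover have "[:p:] dvd (a - e0 * R) + (e0 - e * ([:i:] * r)) * R"
    by (intro dvd_add dvd_mult2 R e0_eq)
  hence "[:p:] dvd a - e * ([:i:] * r * R)" by (simp only: algebra_simps) simp
  ultimately show ?case by blast
qed

text \<open>
  Suppose that a prime ideal \<open>(p, g)\<close> contains \<open>a + N s\<close>, \<open>f1 -
  s A\<close> and \<open>N\<close>. Then it contains \<open>a\<close>, and it contains
  \<open>s\<close> if and only if it contains \<open>e\<close>. If \<open>f1\<close> is in the
  ideal, so is \<open>s A\<close> but not \<open>A\<close>, hence \<open>e\<close>; then the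
  \<open>n\<close> factors split off from \<open>a\<close> together with \<open>e\<close> make
  \<open>a\<close> divisible by \<open>g\<^sup>n\<^sup>+\<^sup>1\<close> modulo
  \<open>p\<close>, which exceeds its degree. If \<open>f1\<close> is not in the ideal, then
  \<open>e\<close> is, because \<open>e f1\<^sup>n\<close> is a multiple of \<open>a\<close>
  modulo \<open>N\<close>; so \<open>s\<close> is, and \<open>f1 = (f1 - s A) + s A\<close> is
  in the ideal after all.
\<close>

theorem coprime_lift:
  assumes f: "monogenic f" "lead_coeff f = 1" "f = a * A + [:N:] * f1"
    and a: "lead_coeff a = 1" and A: "lead_coeff A = 1"
    and deg: "Polynomial.degree f = Polynomial.degree a + Polynomial.degree A"
    and N: "N > 0"
    and chain: "(cofactor_step N f1 ^^ n) a e" "Polynomial.degree a \<le> n"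
    and s: "[:N:] dvd s - e - a * t"
  shows "coprime_in_Zx (a + [:N:] * s) (f1 - s * A) N"
proof (rule coprime_in_ZxI, rule one_in_span3_if_primes)
  fix p :: int
  assume p: "Factorial_Ring.prime p" "p dvd N"
  let ?J = "span3 (a + [:N:] * s) (f1 - s * A) [:p:]"
  show "1 \<in> ?J"
  proof (rule ccontr)
    assume proper: "1 \<notin> ?J"
    obtain M where M: "N = p * M" using p(2) by (rule dvdE)
    have N_eq: "[:N:] = [:p:] * [:M:]" unfolding M by simp
    have "a + [:N:] * s - [:p:] * ([:M:] * s) \<in> ?J"
      by (intro is_ideal_diff is_ideal_span3 is_ideal_mult'[OF is_ideal_span3] span3_gens)
    hence aJ: "a \<in> ?J" unfolding N_eq by (simp only: mult.assoc add_diff_cancel_right')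
    obtain g where g: "lead_coeff g = 1" "Polynomial.degree g > 0" "?J \<subseteq> pg_ideal p g"
      and prime: "\<And>x y. x * y \<in> pg_ideal p g \<Longrightarrow> x \<in> pg_ideal p g \<or> y \<in> pg_ideal p g"
      by (rule prime_ideal_above[OF is_ideal_span3 p(1) span3_gens(3) a aJ proper]) (rule that; assumption)
    have a_in: "a \<in> pg_ideal p g" using aJ g(3) by blast
    have sA: "f1 - s * A \<in> pg_ideal p g" using g(3) span3_gens(2) by blast
    have N_in: "q \<in> pg_ideal p g" if "[:N:] dvd q" for q
      using that N_eq by (metis dvd_mult_left is_ideal_dvd is_ideal_pg pg_gens(1))
    have s_iff: "s \<in> pg_ideal p g \<longleftrightarrow> e \<in> pg_ideal p g"
    proof -
      have "s - e - a * t + a * t \<in> pg_ideal p g"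
        by (intro is_ideal_add[OF is_ideal_pg] N_in s is_ideal_mult'[OF is_ideal_pg] a_in)
      hence *: "s - e \<in> pg_ideal p g" by simp
      show ?thesis
        using is_ideal_add[OF is_ideal_pg *, of e] is_ideal_diff[OF is_ideal_pg _ *, of s] by auto
    qed
    show False
    proof (cases "f1 \<in> pg_ideal p g")
      case f1: True
      have "p > 1" using p(1) by (simp add: prime_gt_1_int)
      have "A \<notin> pg_ideal p g"
        by (rule monogenic_cofactor_not_in_ideal[OF f a A deg \<open>p > 1\<close> p(2) g(1,2) a_in f1])
      moreover have "s * A \<in> pg_ideal p g" using is_ideal_diff[OF is_ideal_pg f1 sA] by simp
      ultimately have "e \<in> pg_ideal p g" using prime s_iff by blast
      then obtain R where R: "R \<in> pg_ideal p (g ^ n)" "[:p:] dvd a - e * R" and e: "e \<in> pg_ideal p g"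
        using cofactor_chain_power[OF p f1 chain(1)] by blast
      obtain u v u' v' where uv: "e = [:p:] * u + g * v" "R = [:p:] * u' + g ^ n * v'"
        using e R(1) unfolding pg_ideal_def by blast
      have "e * R = [:p:] * (u * R) + g * v * ([:p:] * u' + g ^ n * v')"
        unfolding uv(1) uv(2)[symmetric] by (simp only: algebra_simps)
      hence "e * R = [:p:] * (u * R + g * v * u') + (g * g ^ n) * (v * v')"
        by (simp only: algebra_simps)
      moreover obtain w where "a - e * R = [:p:] * w" using R(2) by (rule dvdE)
      ultimately have "a = [:p:] * (w + (u * R + g * v * u')) + g ^ Suc n * (v * v')"
        by (simp add: algebra_simps)
      hence "a \<in> pg_ideal p (g ^ Suc n)" unfolding pg_ideal_def by blast
      moreover have "a \<notin> pg_ideal p (g ^ Suc n)"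
        using monic_not_in_high_power[OF \<open>p > 1\<close> g(1,2) a, of "Suc n"] chain(2) by simp
      ultimately show False by blast
    next
      case f1: False
      have f1n: "f1 ^ k \<notin> pg_ideal p g" for k
      proof (induction k)
        case 0
        show ?case
        proof
          assume "f1 ^ 0 \<in> pg_ideal p g"
          hence "f1 * 1 \<in> pg_ideal p g" by (intro is_ideal_mult[OF is_ideal_pg]) simp
          with f1 show False by simp
        qed
      next
        case (Suc k)
        then show ?case using prime[of f1 "f1 ^ k"] f1 by auto
      qed
      obtain z where "[:N:] dvd e * f1 ^ n - a * z" using cofactor_chain_annihilates[OF chain(1)] by blast
      hence "e * f1 ^ n - a * z + a * z \<in> pg_ideal p g"
        by (intro is_ideal_add[OF is_ideal_pg] N_in is_ideal_mult'[OF is_ideal_pg] a_in)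
      hence "e \<in> pg_ideal p g" using prime[of e "f1 ^ n"] f1n by auto
      hence "s * A \<in> pg_ideal p g" using s_iff by (intro is_ideal_mult'[OF is_ideal_pg]) simp
      from is_ideal_add[OF is_ideal_pg sA this] f1 show False by simp
    qed
  qed
qed (use N in simp)

section \<open>Polynomials as lists of coefficients\<close>

text \<open>
  The leading coefficient comes first, where a program can reach it. Leading zeros are allowed;
  the length of a list is a bound on the degree.
\<close>

definition desc_poly :: "int list \<Rightarrow> int poly" where "desc_poly xs = Poly (rev xs)"

lemma coeff_desc_poly: "Polynomial.coeff (desc_poly xs) i = (if i < length xs then xs ! (length xs - 1 - i) else 0)"
  by (simp add: desc_poly_def nth_default_def rev_nth)

lemma desc_poly_Cons: "desc_poly (k # xs) = Polynomial.monom k (length xs) + desc_poly xs"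
  by (rule poly_eqI) (auto simp: coeff_desc_poly nth_Cons' less_Suc_eq)

lemma coeff_mult_monom_1:
  "Polynomial.coeff (p * Polynomial.monom 1 n) i = (if i < n then 0 else Polynomial.coeff p (i - n))"
  for p :: "int poly"
  by (simp add: mult.commute[of p] coeff_monom_mult)

lemma desc_poly_append: "desc_poly (xs @ ys) = desc_poly xs * Polynomial.monom 1 (length ys) + desc_poly ys"
  by (rule poly_eqI) (auto simp: coeff_desc_poly coeff_mult_monom_1 nth_append)

lemma desc_poly_replicate_0: "desc_poly (replicate k 0) = 0"
  by (rule poly_eqI) (auto simp: coeff_desc_poly)

lemma desc_poly_tl: "xs \<noteq> [] \<Longrightarrow> hd xs = 0 \<Longrightarrow> desc_poly (tl xs) = desc_poly xs"
  by (cases xs) (auto simp: desc_poly_Cons)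

lemma desc_poly_rev_coeffs: "desc_poly (rev (coeffs f)) = f"
  by (simp add: desc_poly_def)

lemma degree_desc_poly: "desc_poly xs = 0 \<or> Polynomial.degree (desc_poly xs) < length xs"
proof (cases "desc_poly xs = 0")
  case False
  hence "Polynomial.coeff (desc_poly xs) (Polynomial.degree (desc_poly xs)) \<noteq> 0" by simp
  thus ?thesis unfolding coeff_desc_poly by (meson)
qed simp

lemma lead_coeff_desc_poly:
  assumes xs: "xs \<noteq> []" "hd xs \<noteq> 0"
  shows "lead_coeff (desc_poly xs) = hd xs" "Polynomial.degree (desc_poly xs) = length xs - 1"
proof -
  have c: "Polynomial.coeff (desc_poly xs) (length xs - 1) = hd xs" using xs by (simp add: coeff_desc_poly hd_conv_nth)
  have "Polynomial.degree (desc_poly xs) \<le> length xs - 1" by (rule degree_le) (auto simp: coeff_desc_poly)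
  moreover have "length xs - 1 \<le> Polynomial.degree (desc_poly xs)" using c xs(2) by (intro le_degree) simp
  ultimately show deg: "Polynomial.degree (desc_poly xs) = length xs - 1" by simp
  show "lead_coeff (desc_poly xs) = hd xs" unfolding deg by (rule c)
qed

lemma desc_poly_combine:
  assumes "length ys \<le> length xs"
  shows "[:M:] dvd desc_poly (combine M c d xs ys)
    - ([:c:] * desc_poly xs - [:d:] * (Polynomial.monom 1 (length xs - length ys) * desc_poly ys))"
  unfolding const_dvd_iff
proof
  fix i
  let ?p = "[:c:] * desc_poly xs - [:d:] * (Polynomial.monom 1 (length xs - length ys) * desc_poly ys)"
  show "M dvd Polynomial.coeff (desc_poly (combine M c d xs ys) - ?p) i"
  proof (cases "i < length xs")
    case True
    define j where "j = length xs - 1 - i"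
    have j: "j < length xs" using True j_def by simp
    have y: "Polynomial.coeff (Polynomial.monom 1 (length xs - length ys) * desc_poly ys) i = nth_default 0 ys j"
    proof (cases "j < length ys")
      case jy: True
      hence "length ys - 1 - (i - (length xs - length ys)) = j" "\<not> i < length xs - length ys"
        "i - (length xs - length ys) < length ys"
        using True assms unfolding j_def by linarith+
      with jy show ?thesis by (simp add: coeff_monom_mult coeff_desc_poly nth_default_def)
    next
      case False
      hence "i < length xs - length ys" using True assms unfolding j_def by linarith
      with False show ?thesis by (simp add: coeff_monom_mult nth_default_def)
    qed
    have "Polynomial.coeff (desc_poly (combine M c d xs ys)) i = (c * xs ! j - d * nth_default 0 ys j) mod M"
      using True j unfolding coeff_desc_poly by (simp add: combine_def j_def)
    moreover have "Polynomial.coeff ?p i = c * xs ! j - d * nth_default 0 ys j"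
      using True y unfolding j_def by (simp add: coeff_desc_poly)
    ultimately show ?thesis by (simp add: mod_eq_dvd_iff[symmetric])
  next
    case False
    thus ?thesis using assms by (auto simp: coeff_monom_mult coeff_desc_poly)
  qed
qed

lemma set_combine: "M > 0 \<Longrightarrow> set (combine M c d xs ys) \<subseteq> {0..<M}"
  by (auto simp: combine_def)

lemma hd_combine:
  "xs \<noteq> [] \<Longrightarrow> ys \<noteq> [] \<Longrightarrow> hd (combine M c d xs ys) = (c * hd xs - d * hd ys) mod M"
  by (cases xs; cases ys) (simp_all add: combine_def upt_rec hd_map)

definition cong_poly :: "int \<Rightarrow> int poly \<Rightarrow> int poly \<Rightarrow> bool" where
  "cong_poly M p q \<longleftrightarrow> [:M:] dvd p - q"

lemma cong_poly_trans: "cong_poly M p q \<Longrightarrow> cong_poly M q r \<Longrightarrow> cong_poly M p r"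
  unfolding cong_poly_def using dvd_add[of "[:M:]" "p - q" "q - r"] by simp

lemma cong_poly_refl: "cong_poly M p p" by (simp add: cong_poly_def)

lemma cong_poly_sym: "cong_poly M p q \<Longrightarrow> cong_poly M q p"
  unfolding cong_poly_def using dvd_minus_iff[of "[:M:]" "p - q"] by (simp add: minus_diff_eq)

lemma cong_poly_diff: "cong_poly M p q \<Longrightarrow> cong_poly M p' q' \<Longrightarrow> cong_poly M (p - p') (q - q')"
  unfolding cong_poly_def using dvd_diff[of "[:M:]" "p - q" "p' - q'"] by (simp add: algebra_simps)

lemma cong_poly_add: "cong_poly M p q \<Longrightarrow> cong_poly M p' q' \<Longrightarrow> cong_poly M (p + p') (q + q')"
  unfolding cong_poly_def using dvd_add[of "[:M:]" "p - q" "p' - q'"] by (simp add: algebra_simps)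

lemma cong_poly_mult: "cong_poly M p q \<Longrightarrow> cong_poly M p' q' \<Longrightarrow> cong_poly M (p * p') (q * q')"
proof -
  assume "cong_poly M p q" "cong_poly M p' q'"
  hence "[:M:] dvd (p - q) * p' + q * (p' - q')" unfolding cong_poly_def by (intro dvd_add dvd_mult dvd_mult2)
  thus ?thesis unfolding cong_poly_def by (simp add: algebra_simps)
qed

lemmas cong_poly_arith = cong_poly_diff cong_poly_mult cong_poly_refl

lemma desc_poly_eliminate:
  assumes "xs \<noteq> []" "ys \<noteq> []" "length ys \<le> length xs"
  shows "cong_poly M (desc_poly (tl (combine M (hd ys) (hd xs) xs ys)))
    ([:hd ys:] * desc_poly xs - [:hd xs:] * (Polynomial.monom 1 (length xs - length ys) * desc_poly ys))"
proof -
  have "desc_poly (tl (combine M (hd ys) (hd xs) xs ys)) = desc_poly (combine M (hd ys) (hd xs) xs ys)"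
    using assms by (intro desc_poly_tl) (auto simp: hd_combine mult.commute length_greater_0_conv[symmetric] simp del: length_greater_0_conv)
  thus ?thesis unfolding cong_poly_def using desc_poly_combine[OF assms(3)] by simp
qed

section \<open>Division with remainder\<close>

definition divide_step :: "int \<Rightarrow> int list \<Rightarrow> int list \<Rightarrow> int list" where
  "divide_step M ys xs = tl (combine M (hd ys) (hd xs) xs ys)"

text \<open>
  One step for each coefficient of \<open>xs\<close> that is at or above the leading position of
  \<open>ys\<close>.
\<close>

definition remainder :: "int \<Rightarrow> int list \<Rightarrow> int list \<Rightarrow> int list" where
  "remainder M ys xs = (divide_step M ys ^^ (length xs + 1 - length ys)) xs"

lemma length_divide_steps [simp]: "length ((divide_step M ys ^^ i) xs) = length xs - i"
  by (induction i) (auto simp: divide_step_def)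

lemma set_divide_steps:
  "M > 0 \<Longrightarrow> set xs \<subseteq> {0..<M} \<Longrightarrow> set ((divide_step M ys ^^ i) xs) \<subseteq> {0..<M}"
proof (induction i)
  case (Suc i)
  have "set (tl zs) \<subseteq> set zs" for zs :: "int list" by (cases zs) auto
  then show ?case using set_combine[OF Suc.prems(1)] unfolding divide_step_def by fastforce
qed simp

lemma divide_steps_cong:
  assumes "ys \<noteq> []" "hd ys = 1" "i \<le> length xs + 1 - length ys"
  shows "\<exists>q. cong_poly M (desc_poly ((divide_step M ys ^^ i) xs)) (desc_poly xs - desc_poly ys * q)"
  using assms(3)
proof (induction i)
  case 0
  show ?case by (intro exI[of _ 0]) (simp add: cong_poly_refl)
next
  case (Suc i)
  then obtain q where q: "cong_poly M (desc_poly ((divide_step M ys ^^ i) xs)) (desc_poly xs - desc_poly ys * q)" by auto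
  define zs where "zs = (divide_step M ys ^^ i) xs"
  have len: "length ys \<le> length zs" using Suc.prems unfolding zs_def by simp
  hence "zs \<noteq> []" using assms(1) by auto
  let ?t = "[:hd zs:] * Polynomial.monom 1 (length zs - length ys)"
  have e1: "[:hd ys:] * desc_poly zs - [:hd zs:] * (Polynomial.monom 1 (length zs - length ys) * desc_poly ys)
      = desc_poly zs - desc_poly ys * ?t" using assms(2) by (simp add: algebra_simps)
  have "cong_poly M (desc_poly (divide_step M ys zs)) (desc_poly zs - desc_poly ys * ?t)"
    unfolding divide_step_def e1[symmetric] by (rule desc_poly_eliminate[OF \<open>zs \<noteq> []\<close> assms(1) len])
  moreover have "cong_poly M (desc_poly zs - desc_poly ys * ?t) ((desc_poly xs - desc_poly ys * q) - desc_poly ys * ?t)"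
    using q unfolding zs_def by (intro cong_poly_diff cong_poly_refl)
  ultimately have "cong_poly M (desc_poly (divide_step M ys zs)) ((desc_poly xs - desc_poly ys * q) - desc_poly ys * ?t)"
    by (rule cong_poly_trans)
  also have "(desc_poly xs - desc_poly ys * q) - desc_poly ys * ?t = desc_poly xs - desc_poly ys * (q + ?t)" by (simp only: algebra_simps)
  finally have "cong_poly M (desc_poly (divide_step M ys zs)) (desc_poly xs - desc_poly ys * (q + ?t))" .
  thus ?case unfolding zs_def by auto
qed

text \<open>
  The difference of the two remainders is a small element of the ideal \<open>(M, g)\<close>.
\<close>

lemma cong_remainder_unique:
  assumes "lead_coeff g = 1" "cong_poly M (r - r') (g * q)"
    "r = 0 \<or> Polynomial.degree r < Polynomial.degree g" "r' = 0 \<or> Polynomial.degree r' < Polynomial.degree g"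
  shows "cong_poly M r r'"
proof -
  obtain y where "r - r' - g * q = [:M:] * y" using assms(2) unfolding cong_poly_def by (rule dvdE)
  hence "r - r' = [:M:] * y + g * q" by (simp add: algebra_simps)
  hence *: "r - r' \<in> pg_ideal M g" unfolding pg_ideal_def by blast
  have "Polynomial.degree (r - r') < Polynomial.degree g \<or> r - r' = 0"
    using assms(3,4) degree_diff_less[of r "Polynomial.degree g" r'] by (cases "r = 0"; cases "r' = 0") auto
  thus ?thesis unfolding cong_poly_def using pg_ideal_small[OF assms(1) *] by blast
qed

lemma remainder_cong:
  assumes "ys \<noteq> []" "hd ys = 1" "length ys \<le> length xs + 1"
    and "cong_poly M (desc_poly xs) (desc_poly ys * q + r)" "r = 0 \<or> Polynomial.degree r < Polynomial.degree (desc_poly ys)"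
  shows "cong_poly M (desc_poly (remainder M ys xs)) r"
proof -
  have "hd ys \<noteq> 0" using assms(2) by simp
  note ys = lead_coeff_desc_poly[OF assms(1) this, unfolded assms(2)]
  obtain q' where "cong_poly M (desc_poly (remainder M ys xs)) (desc_poly xs - desc_poly ys * q')"
    unfolding remainder_def using divide_steps_cong[OF assms(1,2) order.refl] by blast
  hence "cong_poly M (desc_poly (remainder M ys xs)) ((desc_poly ys * q + r) - desc_poly ys * q')"
    by (rule cong_poly_trans) (intro cong_poly_diff assms cong_poly_refl)
  hence "cong_poly M (desc_poly (remainder M ys xs) - r) (((desc_poly ys * q + r) - desc_poly ys * q') - r)"
    by (intro cong_poly_diff cong_poly_refl)
  also have "((desc_poly ys * q + r) - desc_poly ys * q') - r = desc_poly ys * (q - q')" by (simp add: algebra_simps)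
  finally show ?thesis
  proof (rule cong_remainder_unique[OF ys(1) _ _ assms(5)])
    have "length (remainder M ys xs) = length ys - 1" using assms(3) unfolding remainder_def by simp
    thus "desc_poly (remainder M ys xs) = 0 \<or> Polynomial.degree (desc_poly (remainder M ys xs)) < Polynomial.degree (desc_poly ys)"
      using degree_desc_poly[of "remainder M ys xs"] ys(2) by simp
  qed
qed

section \<open>Euclid's algorithm\<close>

type_synonym euclid_state = "int list \<times> int list \<times> int"

text \<open>
  Euclid's algorithm over the integers modulo \<open>N\<close>, without divisions:
  \<open>xs\<close> and \<open>ys\<close> are multiplied crosswise by their leading
  coefficients. This is harmless as long as the leading coefficient of \<open>ys\<close> is a
  unit. Otherwise the gcd of this coefficient and \<open>N\<close> is a proper factor of
  \<open>N\<close>; the first one is kept in \<open>d\<close>, and the computation goes on with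
  polynomials that no longer matter.
\<close>

fun euclid_step :: "int \<Rightarrow> euclid_state \<Rightarrow> euclid_state" where
  "euclid_step N (xs, ys, d) =
    (if length xs < length ys then (ys, xs, d)
     else if hd ys = 0 then (xs, tl ys, d)
     else (tl (combine N (hd ys) (hd xs) xs ys), ys, if d = 1 then gcd N (hd ys) else d))"

definition euclid_time :: "int \<Rightarrow> nat \<Rightarrow> euclid_state \<Rightarrow> nat" where
  "euclid_time N K s = (LEAST i. length (fst (snd ((euclid_step N ^^ i) s))) \<le> K)"

text \<open>
  For \<open>K = length es\<close> these are the polynomials \<open>e X\<^sup>K\<close> and
  \<open>b X\<^sup>K + 1\<close>. A linear combination of both has the form \<open>(u e + v b)
  X\<^sup>K + v\<close>: the remainder in Euclid's algorithm for \<open>e\<close> and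
  \<open>b\<close> is in the upper half of the list and the cofactor \<open>v\<close> of
  \<open>b\<close> in the lower half, so that no separate bookkeeping of cofactors takes place.
\<close>

definition cofactor_state :: "int \<Rightarrow> int list \<Rightarrow> int list \<Rightarrow> int \<Rightarrow> euclid_state" where
  "cofactor_state N bs es d =
    (es @ replicate (length es) 0, bs @ replicate (length es - 1) 0 @ [1], d)"

text \<open>
  The algorithm stops when the upper half of the second polynomial is used up. Its remainder is
  0 then, and the cofactor is left.
\<close>

definition cofactor :: "int \<Rightarrow> int list \<Rightarrow> int list \<times> int \<Rightarrow> int list \<times> int" where
  "cofactor N bs = (\<lambda>(es, d). let s = cofactor_state N bs es d in
     snd ((euclid_step N ^^ euclid_time N (length es) s) s))"

text \<open>
  That one of the lists is longer than \<open>K\<close> at all times leaves less than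
  \<open>K\<close> for the degree of the final cofactor.
\<close>

definition bounded_state :: "int \<Rightarrow> nat \<Rightarrow> nat \<Rightarrow> euclid_state \<Rightarrow> bool" where
  "bounded_state N K L = (\<lambda>(xs, ys, d). set xs \<subseteq> {0..<N} \<and> set ys \<subseteq> {0..<N} \<and>
     K \<le> length xs \<and> length xs \<le> L \<and> K \<le> length ys \<and> length ys \<le> L \<and>
     (K < length xs \<or> K < length ys) \<and> 1 \<le> d \<and> d < N \<and> d dvd N)"

text \<open>
  The second summand accounts for exchanges of the two polynomials, which do not shorten a list.
\<close>

fun euclid_measure :: "euclid_state \<Rightarrow> nat" where
  "euclid_measure (xs, ys, d) = 2 * (length xs + length ys) + (if length xs < length ys then 1 else 0)"

lemma set_tl: "set (tl xs) \<subseteq> set xs" by (cases xs) auto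

lemma bounded_state_step:
  assumes "bounded_state N K L s" "K < length (fst (snd s))"
  shows "bounded_state N K L (euclid_step N s)" "euclid_measure (euclid_step N s) < euclid_measure s"
proof -
  obtain xs ys d where s: "s = (xs, ys, d)" by (cases s)
  have *: "set xs \<subseteq> {0..<N}" "set ys \<subseteq> {0..<N}" "K \<le> length xs" "length xs \<le> L" "K < length ys" "length ys \<le> L"
    "1 \<le> d" "d < N" "d dvd N" using assms unfolding s bounded_state_def by auto
  have "ys \<noteq> []" using * by auto
  hence hd: "hd ys \<in> {0..<N}" using * hd_in_set by blast
  have gcd: "1 \<le> gcd N (hd ys)" "gcd N (hd ys) < N" if "hd ys \<noteq> 0"
  proof -
    show "1 \<le> gcd N (hd ys)" using that by (simp add: int_one_le_iff_zero_less)
    have "gcd N (hd ys) \<le> hd ys" using hd that by (intro gcd_le2_int) simp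
    thus "gcd N (hd ys) < N" using hd by simp
  qed
  have tl: "set (tl (combine N (hd ys) (hd xs) xs ys)) \<subseteq> {0..<N}"
    using set_tl set_combine[of N] * by fastforce
  show "bounded_state N K L (euclid_step N s)"
    using * gcd tl set_tl[of ys] unfolding s bounded_state_def by auto
  show "euclid_measure (euclid_step N s) < euclid_measure s"
    using * \<open>ys \<noteq> []\<close> unfolding s by auto
qed

lemma euclid_terminates:
  assumes "bounded_state N K L s"
  shows "length (fst (snd ((euclid_step N ^^ euclid_time N K s) s))) \<le> K"
    and "i < euclid_time N K s \<Longrightarrow> K < length (fst (snd ((euclid_step N ^^ i) s)))"
    and "i \<le> euclid_time N K s \<Longrightarrow> bounded_state N K L ((euclid_step N ^^ i) s)"
    and "euclid_time N K s \<le> euclid_measure s"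
proof -
  let ?P = "\<lambda>i. length (fst (snd ((euclid_step N ^^ i) s))) \<le> K"
  have inv: "bounded_state N K L ((euclid_step N ^^ i) s) \<and>
      euclid_measure ((euclid_step N ^^ i) s) + i \<le> euclid_measure s" if "\<And>j. j < i \<Longrightarrow> \<not> ?P j" for i
    using that
  proof (induction i)
    case (Suc i)
    have IH: "bounded_state N K L ((euclid_step N ^^ i) s)"
      "euclid_measure ((euclid_step N ^^ i) s) + i \<le> euclid_measure s" using Suc.IH Suc.prems by simp_all
    have "K < length (fst (snd ((euclid_step N ^^ i) s)))" using Suc.prems[of i] by simp
    from bounded_state_step[OF IH(1) this] IH(2) show ?case by simp
  qed (use assms in simp)
  have ex: "\<exists>i\<le>euclid_measure s. ?P i"
  proof (rule ccontr)
    assume "\<not> ?thesis"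
    hence "euclid_measure ((euclid_step N ^^ Suc (euclid_measure s)) s) + Suc (euclid_measure s) \<le> euclid_measure s"
      using inv[of "Suc (euclid_measure s)"] by (meson less_Suc_eq_le)
    thus False by simp
  qed
  then obtain i0 where i0: "i0 \<le> euclid_measure s" "?P i0" by blast
  show "?P (euclid_time N K s)" unfolding euclid_time_def by (rule LeastI[of ?P, OF i0(2)])
  have "euclid_time N K s \<le> i0" unfolding euclid_time_def by (rule Least_le[of ?P, OF i0(2)])
  thus "euclid_time N K s \<le> euclid_measure s" using i0(1) by simp
  have nP: "\<not> ?P j" if "j < euclid_time N K s" for j
    using that unfolding euclid_time_def by (rule not_less_Least)
  thus "i < euclid_time N K s \<Longrightarrow> K < length (fst (snd ((euclid_step N ^^ i) s)))" by (meson not_le)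
  show "i \<le> euclid_time N K s \<Longrightarrow> bounded_state N K L ((euclid_step N ^^ i) s)"
    using inv[of i] nP by simp
qed

text \<open>
  The determinant \<open>c\<close> is, up to the sign, the product of the leading coefficients
  used for elimination. The bounds on the degrees ensure that cofactors do not run into the
  upper half: what a remainder loses in degree is what a cofactor may gain.
\<close>

definition cofactor_invariant :: "int \<Rightarrow> nat \<Rightarrow> int poly \<Rightarrow> int poly \<Rightarrow> euclid_state \<Rightarrow> bool" where
  "cofactor_invariant N K e b = (\<lambda>(xs, ys, d). d = 1 \<longrightarrow> (\<exists>u0 v0 u1 v1 c. coprime c N \<and>
     cong_poly N (desc_poly xs) ((u0 * e + v0 * b) * Polynomial.monom 1 K + v0) \<and>
     cong_poly N (desc_poly ys) ((u1 * e + v1 * b) * Polynomial.monom 1 K + v1) \<and>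
     u0 * v1 - u1 * v0 = [:c:] \<and>
     Polynomial.degree v0 + length ys \<le> 2 * K \<and> Polynomial.degree v1 + length xs \<le> 2 * K))"

lemma cofactor_invariant_step:
  assumes inv: "cofactor_invariant N K e b s" and "K < length (fst (snd s))"
  shows "cofactor_invariant N K e b (euclid_step N s)"
proof -
  obtain xs ys d where s: "s = (xs, ys, d)" by (cases s)
  have "ys \<noteq> []" using assms(2) s by auto
  show ?thesis
  proof (cases "d = 1 \<and> snd (snd (euclid_step N s)) = 1")
    case False
    then show ?thesis unfolding cofactor_invariant_def s by auto
  next
    case True
    then obtain u0 v0 u1 v1 c where c: "coprime c N"
      and xs: "cong_poly N (desc_poly xs) ((u0 * e + v0 * b) * Polynomial.monom 1 K + v0)"
      and ys: "cong_poly N (desc_poly ys) ((u1 * e + v1 * b) * Polynomial.monom 1 K + v1)"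
      and det: "u0 * v1 - u1 * v0 = [:c:]"
      and deg: "Polynomial.degree v0 + length ys \<le> 2 * K" "Polynomial.degree v1 + length xs \<le> 2 * K"
      using inv unfolding cofactor_invariant_def s by auto
    consider "length xs < length ys" | "length ys \<le> length xs" "hd ys = 0" | "length ys \<le> length xs" "hd ys \<noteq> 0"
      by linarith
    then show ?thesis
    proof cases
      case 1
      have "u1 * v0 - u0 * v1 = - (u0 * v1 - u1 * v0)" by simp
      also have "\<dots> = [:- c:]" unfolding det by simp
      finally have "u1 * v0 - u0 * v1 = [:- c:]" .
      moreover have "coprime (- c) N" using c by simp
      ultimately have "\<exists>u0 v0 u1 v1 c. coprime c N \<and>
         cong_poly N (desc_poly ys) ((u0 * e + v0 * b) * Polynomial.monom 1 K + v0) \<and>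
         cong_poly N (desc_poly xs) ((u1 * e + v1 * b) * Polynomial.monom 1 K + v1) \<and>
         u0 * v1 - u1 * v0 = [:c:] \<and>
         Polynomial.degree v0 + length xs \<le> 2 * K \<and> Polynomial.degree v1 + length ys \<le> 2 * K"
        using xs ys deg by blast
      with 1 show ?thesis unfolding s cofactor_invariant_def by simp
    next
      case 2
      have "desc_poly (tl ys) = desc_poly ys" using 2 \<open>ys \<noteq> []\<close> by (intro desc_poly_tl)
      hence "\<exists>u0 v0 u1 v1 c. coprime c N \<and>
         cong_poly N (desc_poly xs) ((u0 * e + v0 * b) * Polynomial.monom 1 K + v0) \<and>
         cong_poly N (desc_poly (tl ys)) ((u1 * e + v1 * b) * Polynomial.monom 1 K + v1) \<and>
         u0 * v1 - u1 * v0 = [:c:] \<and>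
         Polynomial.degree v0 + length (tl ys) \<le> 2 * K \<and> Polynomial.degree v1 + length xs \<le> 2 * K"
        using xs ys deg c det by (intro exI[of _ u0] exI[of _ v0] exI[of _ u1] exI[of _ v1] exI[of _ c]) simp
      with 2 show ?thesis unfolding s cofactor_invariant_def by simp
    next
      case 3
      define X where "X = Polynomial.monom (1 :: int) (length xs - length ys)"
      define k l where "k = hd ys" and "l = hd xs"
      have "gcd N k = 1" using True 3 unfolding s k_def by auto
      hence k: "coprime k N" by (simp add: coprime_iff_gcd_eq_1 gcd.commute)
      let ?zs = "tl (combine N (hd ys) (hd xs) xs ys)"
      let ?u = "[:k:] * u0 - [:l:] * (X * u1)" and ?v = "[:k:] * v0 - [:l:] * (X * v1)"
      have "xs \<noteq> []" using 3 \<open>ys \<noteq> []\<close> by auto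
      have "cong_poly N (desc_poly ?zs) ([:k:] * desc_poly xs - [:l:] * (X * desc_poly ys))"
        unfolding k_def l_def X_def by (rule desc_poly_eliminate[OF \<open>xs \<noteq> []\<close> \<open>ys \<noteq> []\<close> 3(1)])
      also have "cong_poly N ([:k:] * desc_poly xs - [:l:] * (X * desc_poly ys))
         ([:k:] * ((u0 * e + v0 * b) * Polynomial.monom 1 K + v0)
          - [:l:] * (X * ((u1 * e + v1 * b) * Polynomial.monom 1 K + v1)))"
        by (intro cong_poly_arith xs ys)
      finally (cong_poly_trans) have
        "cong_poly N (desc_poly ?zs) ((?u * e + ?v * b) * Polynomial.monom 1 K + ?v)"
        by (simp only: algebra_simps)
      moreover have "?u * v1 - u1 * ?v = [:k:] * (u0 * v1 - u1 * v0)" by (simp only: algebra_simps)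
      hence "?u * v1 - u1 * ?v = [:k * c:]" unfolding det by simp
      moreover have "coprime (k * c) N" using k c by simp
      moreover have "Polynomial.degree ?v + length ys \<le> 2 * K"
      proof -
        have "Polynomial.degree ([:k:] * v0) \<le> 2 * K - length ys"
          using deg(1) degree_smult_le[of k v0] by simp
        moreover have "Polynomial.degree ([:l:] * (X * v1)) \<le> 2 * K - length ys"
          using deg(2) 3(1) degree_smult_le[of l "X * v1"] degree_mult_le[of X v1]
            degree_monom_le[of "1 :: int" "length xs - length ys"] unfolding X_def by simp
        ultimately have "Polynomial.degree ?v \<le> 2 * K - length ys" by (rule degree_diff_le)
        thus ?thesis using deg(1) by simp
      qed
      moreover have "Polynomial.degree v1 + length ?zs \<le> 2 * K" using deg(2) by simp
      ultimately have "\<exists>u0 v0 u1 v1 c. coprime c N \<and>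
         cong_poly N (desc_poly ?zs) ((u0 * e + v0 * b) * Polynomial.monom 1 K + v0) \<and>
         cong_poly N (desc_poly ys) ((u1 * e + v1 * b) * Polynomial.monom 1 K + v1) \<and>
         u0 * v1 - u1 * v0 = [:c:] \<and>
         Polynomial.degree v0 + length ys \<le> 2 * K \<and> Polynomial.degree v1 + length ?zs \<le> 2 * K"
        using ys by blast
      with 3 True show ?thesis unfolding s cofactor_invariant_def by simp
    qed
  qed
qed

text \<open>
  At the end \<open>u1 e + v1 b\<close> vanishes modulo \<open>N\<close>. So \<open>e' =
  v1\<close> makes \<open>e' b\<close> a multiple of \<open>e\<close>, and the determinant gives
  \<open>c e = v1 (u0 e + v0 b)\<close> modulo \<open>N\<close>, with the last remainder but one
  in the role of the gcd.
\<close>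

lemma cofactor_correct:
  assumes N: "N > 1" and d: "1 \<le> d" "d < N" "d dvd N"
    and es: "set es \<subseteq> {0..<N}" "es \<noteq> []" and bs: "set bs \<subseteq> {0..<N}" "length bs = length es - 1"
    and res: "cofactor N bs (es, d) = (es', d')"
  shows "bounded_state N (length es) (2 * length es) (cofactor_state N bs es d)"
    and "set es' \<subseteq> {0..<N}" "length es' = length es" "1 \<le> d'" "d' < N" "d' dvd N"
    and "d' = 1 \<Longrightarrow> d = 1 \<and> cofactor_step N (desc_poly bs) (desc_poly es) (desc_poly es')"
proof -
  define K where "K = length es"
  have K: "K > 0" using es K_def by simp
  define s where "s = cofactor_state N bs es d"
  define st where "st i = (euclid_step N ^^ i) s" for i
  define n where "n = euclid_time N K s"
  have init: "bounded_state N K (2 * K) s"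
    using assms K unfolding bounded_state_def s_def cofactor_state_def K_def by auto
  thus "bounded_state N (length es) (2 * length es) (cofactor_state N bs es d)" unfolding s_def K_def .
  note tm = euclid_terminates[OF init, folded n_def st_def]
  have res': "snd (st n) = (es', d')"
    using res unfolding cofactor_def st_def n_def s_def K_def by (simp add: Let_def)
  obtain xs where xs: "st n = (xs, es', d')" using res' by (cases "st n") auto
  have b: "bounded_state N K (2 * K) (xs, es', d')" using tm(3)[of n] xs by simp
  moreover have "length es' \<le> K" using tm(1) xs by simp
  ultimately have len: "length es' = K" "K < length xs" unfolding bounded_state_def by auto
  show "set es' \<subseteq> {0..<N}" "1 \<le> d'" "d' < N" "d' dvd N" using b unfolding bounded_state_def by auto
  show "length es' = length es" using len K_def by simp
  have mono: "snd (snd (st i)) = 1 \<Longrightarrow> d = 1" for i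
  proof (induction i)
    case 0
    then show ?case by (simp add: st_def s_def cofactor_state_def)
  next
    case (Suc i)
    show ?case
    proof (rule Suc.IH)
      obtain x y z where "st i = (x, y, z)" by (cases "st i")
      with Suc.prems show "snd (snd (st i)) = 1" by (auto simp: st_def split: if_splits)
    qed
  qed
  have "cofactor_invariant N K (desc_poly es) (desc_poly bs) s"
  proof -
    have es_eq: "desc_poly (es @ replicate K 0) = (1 * desc_poly es + 0 * desc_poly bs) * Polynomial.monom 1 K + 0"
      by (simp add: desc_poly_append desc_poly_replicate_0)
    have "desc_poly [1] = 1" by (simp add: desc_poly_Cons monom_0 one_pCons) (simp add: desc_poly_def)
    hence "desc_poly (replicate (K - 1) 0 @ [1]) = 1" by (simp add: desc_poly_append desc_poly_replicate_0)
    hence bs_eq: "desc_poly (bs @ replicate (K - 1) 0 @ [1]) = (0 * desc_poly es + 1 * desc_poly bs) * Polynomial.monom 1 K + 1"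
      using K by (simp add: desc_poly_append)
    have "\<exists>u0 v0 u1 v1 c. coprime c N \<and>
       cong_poly N (desc_poly (es @ replicate K 0)) ((u0 * desc_poly es + v0 * desc_poly bs) * Polynomial.monom 1 K + v0) \<and>
       cong_poly N (desc_poly (bs @ replicate (K - 1) 0 @ [1])) ((u1 * desc_poly es + v1 * desc_poly bs) * Polynomial.monom 1 K + v1) \<and>
       u0 * v1 - u1 * v0 = [:c:] \<and>
       Polynomial.degree v0 + length (bs @ replicate (K - 1) 0 @ [1 :: int]) \<le> 2 * K \<and>
       Polynomial.degree v1 + length (es @ replicate K (0 :: int)) \<le> 2 * K"
      by (rule exI[of _ 1], rule exI[of _ 0], rule exI[of _ 0], rule exI[of _ 1], rule exI[of _ 1], intro conjI,
          simp, subst es_eq, rule cong_poly_refl, subst bs_eq, rule cong_poly_refl)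
        (use bs K K_def in \<open>auto simp: one_pCons\<close>)
    thus ?thesis unfolding s_def cofactor_state_def cofactor_invariant_def K_def by simp
  qed
  hence "cofactor_invariant N K (desc_poly es) (desc_poly bs) (st i)" if "i \<le> n" for i
    using that
  proof (induction i)
    case (Suc i)
    then show ?case using cofactor_invariant_step[of N K _ _ "st i"] tm(2)[of i] by (simp add: st_def)
  qed (simp add: st_def)
  from this[of n] have inv: "cofactor_invariant N K (desc_poly es) (desc_poly bs) (xs, es', d')" unfolding xs by simp
  assume d': "d' = 1"
  with mono[of n] have "d = 1" unfolding xs by simp
  from inv d' obtain u0 v0 u1 v1 c where c: "coprime c N"
    and es': "cong_poly N (desc_poly es') ((u1 * desc_poly es + v1 * desc_poly bs) * Polynomial.monom 1 K + v1)"
    and det: "u0 * v1 - u1 * v0 = [:c:]" and deg: "Polynomial.degree v1 + length xs \<le> 2 * K"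
    unfolding cofactor_invariant_def by auto
  have "Polynomial.degree v1 < K" using deg len by simp
  define r where "r = u1 * desc_poly es + v1 * desc_poly bs"
  have dvd: "[:N:] dvd desc_poly es' - (r * Polynomial.monom 1 K + v1)" using es' unfolding cong_poly_def r_def .
  have "N dvd Polynomial.coeff r i" for i
  proof -
    have "N dvd Polynomial.coeff (desc_poly es' - (r * Polynomial.monom 1 K + v1)) (i + K)"
      using dvd unfolding const_dvd_iff by blast
    moreover have "Polynomial.coeff (desc_poly es') (i + K) = 0" using len by (simp add: coeff_desc_poly)
    moreover have "Polynomial.coeff v1 (i + K) = 0" using \<open>Polynomial.degree v1 < K\<close> by (simp add: coeff_eq_0)
    ultimately show ?thesis by (simp add: coeff_mult_monom_1)
  qed
  hence r: "[:N:] dvd r" unfolding const_dvd_iff by blast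
  have "[:N:] dvd (desc_poly es' - (r * Polynomial.monom 1 K + v1)) + r * Polynomial.monom 1 K"
    using dvd r by (intro dvd_add dvd_mult2)
  hence e': "[:N:] dvd desc_poly es' - v1" by (simp add: algebra_simps)
  have e'': "[:N:] dvd v1 - desc_poly es'"
    using e' dvd_minus_iff[of "[:N:]" "desc_poly es' - v1"] by (simp add: minus_diff_eq)
  have "[:c:] * desc_poly es - desc_poly es' * (u0 * desc_poly es + v0 * desc_poly bs)
      = (v1 - desc_poly es') * (u0 * desc_poly es + v0 * desc_poly bs) - r * v0"
    unfolding det[symmetric] r_def by (simp only: algebra_simps)
  hence 1: "[:N:] dvd [:c:] * desc_poly es - desc_poly es' * (u0 * desc_poly es + v0 * desc_poly bs)"
    using dvd_diff[OF dvd_mult2[OF e''] dvd_mult2[OF r]] by metis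
  have "desc_poly es' * desc_poly bs - desc_poly es * (- u1) = (desc_poly es' - v1) * desc_poly bs + r"
    unfolding r_def by (simp only: algebra_simps)
  hence 2: "[:N:] dvd desc_poly es' * desc_poly bs - desc_poly es * (- u1)" using r e' by (auto intro!: dvd_add dvd_mult2)
  have 3: "[:N:] dvd (u0 * desc_poly es + v0 * desc_poly bs) - (desc_poly es * u0 + desc_poly bs * v0)" by (simp add: mult.commute)
  show "d = 1 \<and> cofactor_step N (desc_poly bs) (desc_poly es) (desc_poly es')"
    unfolding cofactor_step_def using \<open>d = 1\<close> c 1 2 3 by blast
qed

section \<open>The algorithm\<close>

text \<open>
  The algorithm works with residues, the chain in \<open>coprime_lift\<close> starts with the
  given polynomials.
\<close>

lemma cofactor_step_cong:
  assumes "cofactor_step N b e e'" "cong_poly N b b'" "cong_poly N e e0"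
  shows "cofactor_step N b' e0 e'"
proof -
  from assms(1) obtain c r x y z where c: "coprime c N" and 1: "cong_poly N ([:c:] * e) (e' * r)"
    and 2: "cong_poly N r (e * x + b * y)" and 3: "cong_poly N (e' * b) (e * z)"
    unfolding cofactor_step_def cong_poly_def by blast
  note sym = assms(2,3)[THEN cong_poly_sym]
  have "cong_poly N ([:c:] * e0) (e' * r)"
    using cong_poly_trans[OF cong_poly_mult[OF cong_poly_refl sym(2)] 1] .
  moreover have "cong_poly N r (e0 * x + b' * y)"
    by (rule cong_poly_trans[OF 2]) (intro cong_poly_add cong_poly_mult assms cong_poly_refl)
  moreover have "cong_poly N (e' * b') (e0 * z)"
    by (rule cong_poly_trans[OF cong_poly_mult[OF cong_poly_refl sym(1)]], rule cong_poly_trans[OF 3])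
      (intro cong_poly_mult assms cong_poly_refl)
  ultimately show ?thesis using c unfolding cofactor_step_def cong_poly_def by blast
qed

text \<open>
  For \<open>f = a A + N b\<close> this is \<open>b\<close> modulo \<open>N\<close>. The
  remainder \<open>N b\<close> of the division by \<open>a\<close> is computed modulo
  \<open>N\<^sup>2\<close>, which keeps the coefficients small and is just precise enough.
\<close>

definition division_quotient :: "int \<Rightarrow> int list \<Rightarrow> int list \<Rightarrow> int list" where
  "division_quotient N ys xs =
     map (\<lambda>c. (c div N) mod N) (remainder (N * N) ys (map (\<lambda>c. c mod (N * N)) xs))"

definition cofactor_iteration :: "int \<Rightarrow> int list \<Rightarrow> int list \<Rightarrow> nat \<Rightarrow> int list \<times> int" where
  "cofactor_iteration N bs ys i = (cofactor N bs ^^ i) (map (\<lambda>c. c mod N) ys, 1)"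

text \<open>
  The inner combination is \<open>s = e - c a\<close> modulo \<open>N\<close>, with
  \<open>c\<close> the coefficient of \<open>e\<close> in the degree of \<open>a\<close>, and
  the outer one is \<open>a + N s\<close> over the integers. Subtracting \<open>c a\<close>
  brings the degree of \<open>s\<close> below that of \<open>a\<close>, so that \<open>a + N
  s\<close> stays monic.
\<close>

definition adjusted :: "int \<Rightarrow> int list \<Rightarrow> int list \<Rightarrow> int list" where
  "adjusted N ys es = combine 0 1 (- N) ys (combine N 1 (hd es) es ys)"

text \<open>
  The number of iterations is the number of coefficients of \<open>a\<close>, which is larger
  than its degree.
\<close>

definition find_lift :: "int poly \<Rightarrow> int \<Rightarrow> int poly \<Rightarrow> int + int poly" where
  "find_lift f N a = (let xs = rev (coeffs f); ys = rev (coeffs a);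
     (es, d) = cofactor_iteration N (division_quotient N ys xs) ys (length ys)
     in if d = 1 then Inr (desc_poly (adjusted N ys es)) else Inl d)"

lemma coeff_desc_poly_map: "g 0 = 0 \<Longrightarrow> Polynomial.coeff (desc_poly (map g xs)) i = g (Polynomial.coeff (desc_poly xs) i)"
  by (simp add: coeff_desc_poly)

lemma cong_map_mod: "cong_poly M (desc_poly (map (\<lambda>c. c mod M) xs)) (desc_poly xs)"
  unfolding cong_poly_def const_dvd_iff by (simp add: coeff_desc_poly_map mod_eq_dvd_iff[symmetric])

lemma rev_coeffs_monic:
  fixes a :: "int poly"
  assumes "lead_coeff a = 1"
  shows "rev (coeffs a) \<noteq> []" "hd (rev (coeffs a)) = 1" "length (rev (coeffs a)) = Polynomial.degree a + 1"
proof -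
  have "a \<noteq> 0" using assms by auto
  thus "rev (coeffs a) \<noteq> []" "length (rev (coeffs a)) = Polynomial.degree a + 1"
    by (simp_all add: length_coeffs_degree)
  show "hd (rev (coeffs a)) = 1" using \<open>a \<noteq> 0\<close> assms by (simp add: hd_rev last_coeffs_eq_coeff_degree)
qed

lemma cofactor_iteration_bounds:
  assumes N: "N > 1" and ys: "ys \<noteq> []" and bs: "set bs \<subseteq> {0..<N}" "length bs = length ys - 1"
    and it: "cofactor_iteration N bs ys i = (es, d)"
  shows "set es \<subseteq> {0..<N} \<and> length es = length ys \<and> 1 \<le> d \<and> d < N \<and> d dvd N"
  using it
proof (induction i arbitrary: es d)
  case 0
  then show ?case using N by (auto simp: cofactor_iteration_def)
next
  case (Suc i)
  obtain es0 d0 where it0: "cofactor_iteration N bs ys i = (es0, d0)" by fastforce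
  note IH = Suc.IH[OF this]
  have res: "cofactor N bs (es0, d0) = (es, d)"
    using Suc.prems it0 unfolding cofactor_iteration_def by simp
  have "es0 \<noteq> []" using IH ys by auto
  show ?case
    using cofactor_correct(2-6)[OF N _ _ _ _ \<open>es0 \<noteq> []\<close> bs(1) _ res] IH bs(2) by simp
qed

lemma cofactor_iteration_correct:
  assumes N: "N > 1" and ys: "ys \<noteq> []" and bs: "set bs \<subseteq> {0..<N}" "length bs = length ys - 1"
    and b: "cong_poly N (desc_poly bs) b"
    and it: "cofactor_iteration N bs ys i = (es, 1)"
  shows "\<exists>e. (cofactor_step N b ^^ i) (desc_poly ys) e \<and> cong_poly N e (desc_poly es)"
  using it
proof (induction i arbitrary: es)
  case 0
  then show ?case by (auto simp: cofactor_iteration_def intro: cong_poly_sym cong_map_mod)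
next
  case (Suc i)
  obtain es0 d0 where it0: "cofactor_iteration N bs ys i = (es0, d0)" by fastforce
  note bounds = cofactor_iteration_bounds[OF N ys bs it0]
  have res: "cofactor N bs (es0, d0) = (es, 1)"
    using Suc.prems it0 unfolding cofactor_iteration_def by simp
  have "es0 \<noteq> []" using bounds ys by auto
  have step: "d0 = 1 \<and> cofactor_step N (desc_poly bs) (desc_poly es0) (desc_poly es)"
    using cofactor_correct(7)[OF N _ _ _ _ \<open>es0 \<noteq> []\<close> bs(1) _ res] bounds bs(2) by simp
  then obtain e where e: "(cofactor_step N b ^^ i) (desc_poly ys) e" "cong_poly N e (desc_poly es0)"
    using Suc.IH it0 by blast
  have "cofactor_step N b e (desc_poly es)"
    using cofactor_step_cong[OF _ b cong_poly_sym[OF e(2)]] step by blast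
  with e(1) have "(cofactor_step N b ^^ Suc i) (desc_poly ys) (desc_poly es)" by auto
  thus ?case using cong_poly_refl by blast
qed

lemma length_division_quotient:
  "length ys \<le> length xs + 1 \<Longrightarrow> length (division_quotient N ys xs) = length ys - 1"
  unfolding division_quotient_def remainder_def by simp

lemma set_division_quotient: "N > 0 \<Longrightarrow> set (division_quotient N ys xs) \<subseteq> {0..<N}"
  unfolding division_quotient_def by auto

lemma division_quotient_correct:
  assumes "N > 0" "ys \<noteq> []" "hd ys = 1" "length ys \<le> length xs + 1"
    and "desc_poly xs = desc_poly ys * A + [:N:] * b"
    and small: "[:N:] * b = 0 \<or> Polynomial.degree ([:N:] * b) < Polynomial.degree (desc_poly ys)"
  shows "cong_poly N (desc_poly (division_quotient N ys xs)) b"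
proof -
  let ?M = "N * N"
  let ?xs = "map (\<lambda>c. c mod ?M) xs"
  have "cong_poly ?M (desc_poly ?xs) (desc_poly ys * A + [:N:] * b)" unfolding assms(5)[symmetric] by (rule cong_map_mod)
  from remainder_cong[OF assms(2,3) _ this small] assms(4)
  have R: "cong_poly ?M (desc_poly (remainder ?M ys ?xs)) ([:N:] * b)" by simp
  have "N dvd Polynomial.coeff (desc_poly (division_quotient N ys xs)) i - Polynomial.coeff b i" for i
  proof -
    let ?c = "Polynomial.coeff (desc_poly (remainder ?M ys ?xs)) i"
    have "?M dvd ?c - N * Polynomial.coeff b i"
      using R unfolding cong_poly_def const_dvd_iff by simp
    then obtain k where "?c - N * Polynomial.coeff b i = ?M * k" by (rule dvdE)
    hence "?c = N * (Polynomial.coeff b i + N * k)" by (simp add: algebra_simps)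
    hence "?c div N = Polynomial.coeff b i + N * k" using assms(1) by simp
    hence "(?c div N) mod N = Polynomial.coeff b i mod N" by simp
    thus ?thesis unfolding division_quotient_def by (simp add: coeff_desc_poly_map mod_eq_dvd_iff[symmetric])
  qed
  thus ?thesis unfolding cong_poly_def const_dvd_iff by simp
qed

lemma hd_adjusted:
  assumes "ys \<noteq> []" "hd ys = 1" "length es = length ys"
  shows "adjusted N ys es \<noteq> []" "hd (adjusted N ys es) = 1"
proof -
  let ?ss = "combine N 1 (hd es) es ys"
  have es: "es \<noteq> []" using assms by auto
  hence "hd ?ss = 0" using assms by (simp add: hd_combine)
  moreover have "?ss \<noteq> []" using es by (metis length_combine length_0_conv)
  ultimately show "hd (adjusted N ys es) = 1" unfolding adjusted_def using assms by (simp add: hd_combine)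
  show "adjusted N ys es \<noteq> []" unfolding adjusted_def using assms(1) by (metis length_combine length_0_conv)
qed

lemma desc_poly_adjusted:
  assumes "ys \<noteq> []" "hd ys = 1" "length es = length ys"
  shows "\<exists>s. desc_poly (adjusted N ys es) = desc_poly ys + [:N:] * s \<and> cong_poly N s (desc_poly es - [:hd es:] * desc_poly ys)"
    and "lead_coeff (desc_poly (adjusted N ys es)) = 1"
proof -
  let ?ss = "combine N 1 (hd es) es ys"
  have es: "es \<noteq> []" using assms by auto
  have "desc_poly (adjusted N ys es) = desc_poly ys + [:N:] * desc_poly ?ss"
    using desc_poly_combine[of ?ss ys 0 1 "- N"] assms(3) unfolding adjusted_def by (simp add: monom_0)
  moreover have "cong_poly N (desc_poly ?ss) (desc_poly es - [:hd es:] * desc_poly ys)"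
    using desc_poly_combine[of ys es N 1 "hd es"] assms(3) unfolding cong_poly_def by (simp add: monom_0)
  ultimately show "\<exists>s. desc_poly (adjusted N ys es) = desc_poly ys + [:N:] * s \<and> cong_poly N s (desc_poly es - [:hd es:] * desc_poly ys)"
    by blast
  show "lead_coeff (desc_poly (adjusted N ys es)) = 1"
    using lead_coeff_desc_poly(1)[of "adjusted N ys es"] hd_adjusted[OF assms] by simp
qed

text \<open>
  Division over the integers and division modulo \<open>N\<close> have the same remainder modulo
  \<open>N\<close>, which is 0 by assumption.
\<close>

lemma factor_mod_division:
  assumes "lead_coeff f = 1" and N: "N > 1" and a: "lead_coeff a = 1" and fm: "factor_mod N a f"
  obtains A b where "f = a * A + [:N:] * b"
    "[:N:] * b = 0 \<or> Polynomial.degree ([:N:] * b) < Polynomial.degree a"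
    "lead_coeff A = 1" "Polynomial.degree f = Polynomial.degree a + Polynomial.degree A"
proof -
  obtain A r where Ar: "f = a * A + r" "r = 0 \<or> Polynomial.degree r < Polynomial.degree a"
    using monic_division[OF a] by metis
  obtain q where "[:N:] dvd f - a * q" using factor_mod_imp[OF N fm] .
  moreover have "f - a * q = (r - 0) - a * (q - A)" unfolding Ar(1) by (simp add: algebra_simps)
  ultimately have "cong_poly N (r - 0) (a * (q - A))" unfolding cong_poly_def by simp
  from cong_remainder_unique[OF a this Ar(2)] have "[:N:] dvd r" unfolding cong_poly_def by simp
  then obtain b where b: "r = [:N:] * b" by (rule dvdE)
  have "A \<noteq> 0"
  proof
    assume "A = 0"
    hence "f = [:N:] * b" using Ar(1) b by simp
    hence "[:N:] dvd f" by (rule dvdI)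
    hence "N dvd lead_coeff f" unfolding const_dvd_iff by blast
    thus False using assms(1) N by simp
  qed
  have deg: "Polynomial.degree f = Polynomial.degree a + Polynomial.degree A \<and> lead_coeff f = lead_coeff A"
  proof (cases "r = 0")
    case True
    then show ?thesis using degree_monic_mult[OF a \<open>A \<noteq> 0\<close>] Ar(1) by simp
  next
    case False
    have aA: "Polynomial.degree r < Polynomial.degree (a * A)"
      using False Ar(2) degree_monic_mult(1)[OF a \<open>A \<noteq> 0\<close>] by simp
    show ?thesis
      using degree_add_eq_left[OF aA] lead_coeff_add_le[of r "a * A"] aA degree_monic_mult[OF a \<open>A \<noteq> 0\<close>]
      unfolding Ar(1) by (simp add: coeff_eq_0)
  qed
  show ?thesis by (rule that[of A b]) (use Ar deg assms(1) b in auto)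
qed

lemma factor_mod_degree:
  assumes "lead_coeff f = 1" "N > 1" "lead_coeff a = 1" "factor_mod N a f"
  shows "Polynomial.degree a \<le> Polynomial.degree f"
  by (rule factor_mod_division[OF assms]) simp

theorem find_lift_correct:
  assumes f: "lead_coeff f = 1" "monogenic f" and N: "N > 1"
    and a: "lead_coeff a = 1" and fm: "factor_mod N a f"
  shows "case find_lift f N a of
      Inl d \<Rightarrow> 1 < d \<and> d < N \<and> d dvd N
    | Inr a' \<Rightarrow> lead_coeff a' = 1 \<and>
        (\<forall>i. [Polynomial.coeff a i = Polynomial.coeff a' i] (mod N)) \<and>
        (\<exists>f1 A. f = f1 * [:N:] + a' * A \<and> coprime_in_Zx a' f1 N)"
proof -
  define xs ys where "xs = rev (coeffs f)" and "ys = rev (coeffs a)"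
  note xs = rev_coeffs_monic[OF f(1), folded xs_def] and ys = rev_coeffs_monic[OF a, folded ys_def]
  have polys: "desc_poly xs = f" "desc_poly ys = a" unfolding xs_def ys_def by (simp_all add: desc_poly_rev_coeffs)
  obtain A b where Ab: "f = a * A + [:N:] * b"
      "[:N:] * b = 0 \<or> Polynomial.degree ([:N:] * b) < Polynomial.degree a"
      "lead_coeff A = 1" "Polynomial.degree f = Polynomial.degree a + Polynomial.degree A"
    by (rule factor_mod_division[OF f(1) N a fm])
  have len: "length ys \<le> length xs + 1" using xs(3) ys(3) Ab(4) by simp
  define bs where "bs = division_quotient N ys xs"
  have bs: "set bs \<subseteq> {0..<N}" "length bs = length ys - 1"
    unfolding bs_def using N len by (simp_all add: set_division_quotient length_division_quotient)
  have bs_cong: "cong_poly N (desc_poly bs) b"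
    unfolding bs_def by (rule division_quotient_correct[OF _ ys(1,2) len]) (use N Ab(1,2) polys in auto)
  obtain es d where it: "cofactor_iteration N bs ys (length ys) = (es, d)" by fastforce
  note bounds = cofactor_iteration_bounds[OF N ys(1) bs it]
  have result: "find_lift f N a = (if d = 1 then Inr (desc_poly (adjusted N ys es)) else Inl d)"
    using it unfolding find_lift_def xs_def ys_def bs_def by (simp add: Let_def)
  show ?thesis
  proof (cases "d = 1")
    case False
    then show ?thesis unfolding result using bounds by auto
  next
    case True
    let ?a = "desc_poly (adjusted N ys es)"
    obtain s where s: "?a = a + [:N:] * s" "cong_poly N s (desc_poly es - [:hd es:] * a)"
      using desc_poly_adjusted(1)[OF ys(1,2), of es N] bounds unfolding polys by blast
    obtain e where e: "(cofactor_step N b ^^ length ys) a e" "cong_poly N e (desc_poly es)"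
      using cofactor_iteration_correct[OF N ys(1) bs bs_cong] it True unfolding polys by blast
    have "cong_poly N s (e - [:hd es:] * a)"
      by (rule cong_poly_trans[OF s(2)]) (intro cong_poly_diff cong_poly_sym[OF e(2)] cong_poly_refl)
    hence se: "[:N:] dvd s - e - a * [:- hd es:]" unfolding cong_poly_def by (simp add: algebra_simps)
    have "coprime_in_Zx (a + [:N:] * s) (b - s * A) N"
      by (rule coprime_lift[OF f(2,1) Ab(1) a Ab(3,4) _ e(1) _ se]) (use N ys(3) in auto)
    moreover have "f = (b - s * A) * [:N:] + ?a * A" unfolding s(1) by (subst Ab(1)) (simp add: algebra_simps)
    moreover have "[Polynomial.coeff a i = Polynomial.coeff ?a i] (mod N)" for i
      unfolding s(1) by (simp add: cong_def)
    moreover have "lead_coeff ?a = 1" by (rule desc_poly_adjusted(2)[OF ys(1,2)]) (use bounds in simp)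
    ultimately show ?thesis unfolding result using True s(1) by auto
  qed
qed

section \<open>Running time of the algorithm\<close>

lemma bitsize_entries_le:
  assumes "set xs \<subseteq> {0..<N}" "length xs \<le> n"
  shows "bitsize (encode_list xs) \<le> 2 + n * (1 + bitsize (Num N))"
proof -
  have "bitsize (encode_list xs) \<le> 2 + length xs * (1 + bitsize (Num N))"
    using assms(1) by (intro bitsize_encode_list_le bitsize_Num_mono) fastforce
  also have "\<dots> \<le> 2 + n * (1 + bitsize (Num N))" using assms(2) by (intro add_left_mono mult_right_mono) auto
  finally show ?thesis .
qed

lemma psize_length: "ptime D u (\<lambda>x. encode_list (l x)) \<Longrightarrow> psize D u (\<lambda>x. length (l x))"
  by (rule pbounded_mono[OF ptime_size length_le_bitsize])

lemma ptime_remainder: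
  assumes M: "ptime D u (\<lambda>x. Num (M x))"
    and ys: "ptime D u (\<lambda>x. encode_list (ys x))" and xs: "ptime D u (\<lambda>x. encode_list (xs x))"
    and D: "\<And>x. x \<in> D \<Longrightarrow> M x > 0 \<and> ys x \<noteq> [] \<and> set (xs x) \<subseteq> {0..<M x}"
  shows "ptime D u (\<lambda>x. encode_list (remainder (M x) (ys x) (xs x)))"
proof -
  define R where "R x i = (divide_step (M x) (ys x) ^^ i) (xs x)" for x i
  define k where "k x = length (xs x) + 1 - length (ys x)" for x
  let ?s = "\<lambda>x i. Pair (Num (M x)) (Pair (encode_list (ys x)) (encode_list (R x i)))"
  have len: "length (R x i) = length (xs x) - i" for x i unfolding R_def by simp
  have "ptime D u (\<lambda>x. ?s x (k x))"
  proof (rule ptime_loop[where b = "\<lambda>x i. if int (length (ys x)) < int (length (R x i)) + 1 then 1 else 0"])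
    show "ptime D u (\<lambda>x. ?s x 0)" unfolding R_def by (simp add: ptime_Pair M ys xs)
    show "ptime (SIGMA x:D. {..k x}) (\<lambda>y. ?s (fst y) (snd y))
        (\<lambda>y. Num (if int (length (ys (fst y))) < int (length (R (fst y) (snd y))) + 1 then 1 else 0))"
      by (intro ptime_less ptime_add ptime_length ptime_Num; (rule ptime_proj)+)
    let ?J = "SIGMA x:D. {..<k x}"
    let ?v = "\<lambda>y. ?s (fst y) (snd y)"
    have v: "ptime ?J ?v (\<lambda>y. Num (M (fst y)))" "ptime ?J ?v (\<lambda>y. encode_list (ys (fst y)))"
      "ptime ?J ?v (\<lambda>y. encode_list (R (fst y) (snd y)))"
      by (rule ptime_proj)+
    have "ptime ?J ?v (\<lambda>y. Pair (Num (M (fst y))) (Pair (encode_list (ys (fst y)))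
       (encode_list (tl (combine (M (fst y)) (hd (ys (fst y))) (hd (R (fst y) (snd y)))
         (R (fst y) (snd y)) (ys (fst y)))))))"
    proof (intro ptime_Pair ptime_tl ptime_combine ptime_hd v)
      fix y assume y: "y \<in> ?J"
      show "ys (fst y) \<noteq> []" using y D by auto
      hence "length (R (fst y) (snd y)) > 0" using y unfolding len k_def by (cases "ys (fst y)") auto
      thus "R (fst y) (snd y) \<noteq> []" by simp
    qed
    thus "ptime ?J ?v (\<lambda>y. ?s (fst y) (Suc (snd y)))"
      by (rule ptime_cong) (simp add: R_def divide_step_def)
    show "(if int (length (ys x)) < int (length (R x i)) + 1 then 1 else 0 :: int) \<noteq> 0 \<longleftrightarrow> i < k x"
      if "x \<in> D" "i \<le> k x" for x i
      using D[OF that(1)] that(2) unfolding len k_def by (cases "ys x") auto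
    have "psize D u (\<lambda>x. length (xs x) + 1)" by (intro pbounded_add pbounded_const psize_length xs)
    thus "psize D u k" by (rule pbounded_mono) (simp add: k_def)
    show "psize D u (\<lambda>x. 1 + bitsize (Num (M x)) + (1 + bitsize (encode_list (ys x)) +
        (2 + length (xs x) * (1 + bitsize (Num (M x))))))"
      by (intro pbounded_add pbounded_mult pbounded_const ptime_size psize_length M xs ys)
    fix x i assume x: "x \<in> D"
    have "bitsize (encode_list (R x i)) \<le> 2 + length (xs x) * (1 + bitsize (Num (M x)))"
      unfolding R_def using D[OF x] by (intro bitsize_entries_le set_divide_steps) auto
    thus "bitsize (?s x i) \<le> 1 + bitsize (Num (M x)) + (1 + bitsize (encode_list (ys x)) +
        (2 + length (xs x) * (1 + bitsize (Num (M x)))))" unfolding bitsize.simps(2) by linarith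
  qed
  from ptime_snd[OF ptime_snd[OF this]] show ?thesis unfolding R_def k_def remainder_def .
qed

lemma ptime_division_quotient:
  assumes N: "ptime D u (\<lambda>x. Num (N x))"
    and ys: "ptime D u (\<lambda>x. encode_list (ys x))" and xs: "ptime D u (\<lambda>x. encode_list (xs x))"
    and D: "\<And>x. x \<in> D \<Longrightarrow> N x > 0 \<and> ys x \<noteq> []"
  shows "ptime D u (\<lambda>x. encode_list (division_quotient (N x) (ys x) (xs x)))"
  unfolding division_quotient_def
proof (rule ptime_map[OF _ N, where g = "\<lambda>x c. (c div N x) mod N x"], rule ptime_remainder)
  show "ptime D u (\<lambda>x. Num (N x * N x))" by (intro ptime_mult N)
  show "ptime D u (\<lambda>x. encode_list (map (\<lambda>c. c mod (N x * N x)) (xs x)))"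
    by (rule ptime_map[OF xs N, where g = "\<lambda>x c. c mod (N x * N x)"])
      (intro ptime_mod ptime_mult ptime_proj)
  show "N x * N x > 0 \<and> ys x \<noteq> [] \<and> set (map (\<lambda>c. c mod (N x * N x)) (xs x)) \<subseteq> {0..<N x * N x}"
    if "x \<in> D" for x using D[OF that] by auto
qed (use ys in \<open>auto intro!: ptime_mod ptime_div intro: ptime_proj_fst ptime_proj_snd\<close>)

text \<open>
  The assumptions on \<open>ys\<close> and \<open>N\<close> keep the program for the gcd in its
  domain.
\<close>

lemma ptime_euclid_step:
  assumes N: "ptime D u (\<lambda>x. Num (N x))"
    and xs: "ptime D u (\<lambda>x. encode_list (xs x))" and ys: "ptime D u (\<lambda>x. encode_list (ys x))"
    and d: "ptime D u (\<lambda>x. Num (d x))"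
    and D: "\<And>x. x \<in> D \<Longrightarrow> N x > 0 \<and> ys x \<noteq> [] \<and> set (ys x) \<subseteq> {0..<N x}"
  shows "ptime D u (\<lambda>x. case euclid_step (N x) (xs x, ys x, d x) of
    (xs', ys', d') \<Rightarrow> Pair (encode_list xs') (Pair (encode_list ys') (Num d')))"
proof -
  note subs = ptime_subset[OF N] ptime_subset[OF xs] ptime_subset[OF ys] ptime_subset[OF d]
  have hd: "0 \<le> hd (ys x) \<and> hd (ys x) \<le> N x" if "x \<in> D" for x
    using D[OF that] hd_in_set[of "ys x"] by fastforce
  have "ptime D u (\<lambda>x. if int (length (xs x)) < int (length (ys x))
     then Pair (encode_list (ys x)) (Pair (encode_list (xs x)) (Num (d x)))
     else if hd (ys x) = 0 then Pair (encode_list (xs x)) (Pair (encode_list (tl (ys x))) (Num (d x)))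
     else Pair (encode_list (tl (combine (N x) (hd (ys x)) (hd (xs x)) (xs x) (ys x))))
       (Pair (encode_list (ys x)) (if d x = 1 then Num (gcd (N x) (hd (ys x))) else Num (d x))))"
  proof (intro ptime_if_less ptime_if_eq ptime_Pair ptime_length ptime_tl ptime_combine ptime_hd ptime_gcd subs)
    fix x assume x: "x \<in> {x \<in> {x \<in> D. \<not> int (length (xs x)) < int (length (ys x))}. hd (ys x) \<noteq> 0}"
    show "xs x \<noteq> []" using x D[of x] by auto
  qed (use D hd in auto)
  thus ?thesis by (rule ptime_cong) auto
qed

lemma ptime_cofactor:
  assumes N: "ptime D u (\<lambda>x. Num (N x))" and bs: "ptime D u (\<lambda>x. encode_list (bs x))"
    and es: "ptime D u (\<lambda>x. encode_list (es x))" and d: "ptime D u (\<lambda>x. Num (d x))"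
    and D: "\<And>x. x \<in> D \<Longrightarrow> N x > 1 \<and> es x \<noteq> [] \<and> set (es x) \<subseteq> {0..<N x} \<and>
      set (bs x) \<subseteq> {0..<N x} \<and> length (bs x) = length (es x) - 1 \<and> 1 \<le> d x \<and> d x < N x \<and> d x dvd N x"
  shows "ptime D u (\<lambda>x. case cofactor (N x) (bs x) (es x, d x) of (es', d') \<Rightarrow>
    Pair (encode_list es') (Num d'))"
proof -
  define s0 where "s0 x = cofactor_state (N x) (bs x) (es x) (d x)" for x
  define st where "st x i = (euclid_step (N x) ^^ i) (s0 x)" for x i
  define K where "K x = length (es x)" for x
  define k where "k x = euclid_time (N x) (K x) (s0 x)" for x
  have init: "bounded_state (N x) (K x) (2 * K x) (s0 x)" if "x \<in> D" for x
    unfolding K_def s0_def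
    by (rule cofactor_correct(1)[of "N x" "d x" "es x" "bs x", OF _ _ _ _ _ _ _ _ surjective_pairing])
      (use D[OF that] in auto)
  note tm = euclid_terminates[OF init, folded k_def st_def]
  define R0 R1 dd where "R0 x i = fst (st x i)" and "R1 x i = fst (snd (st x i))"
    and "dd x i = snd (snd (st x i))" for x i
  have st: "st x i = (R0 x i, R1 x i, dd x i)" for x i unfolding R0_def R1_def dd_def by simp
  have b: "set (R0 x i) \<subseteq> {0..<N x} \<and> set (R1 x i) \<subseteq> {0..<N x} \<and> length (R0 x i) \<le> 2 * K x \<and>
    length (R1 x i) \<le> 2 * K x \<and> 1 \<le> dd x i \<and> dd x i < N x" if "x \<in> D" "i \<le> k x" for x i
    using tm(3)[OF that(1), of i] that(2) unfolding st bounded_state_def by auto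
  let ?e = "\<lambda>x i. Pair (encode_list (R0 x i)) (Pair (encode_list (R1 x i)) (Num (dd x i)))"
  let ?s = "\<lambda>x i. Pair (Num (N x)) (Pair (Num (int (K x))) (?e x i))"
  have "ptime D u (\<lambda>x. ?s x (k x))"
  proof (rule ptime_loop[where b = "\<lambda>x i. if int (K x) < int (length (R1 x i)) then 1 else 0"])
    have K: "ptime D u (\<lambda>x. Num (int (K x)))" unfolding K_def by (rule ptime_length[OF es])
    have zeros: "ptime D u (\<lambda>x. encode_list (map (\<lambda>_. 0) (l x)))" if "ptime D u (\<lambda>x. encode_list (l x))" for l
      by (rule ptime_map[OF that N, where g = "\<lambda>_ _. 0"]) (rule ptime_Num)
    have "ptime D u (\<lambda>x. Pair (Num (N x)) (Pair (Num (int (K x)))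
       (Pair (encode_list (es x @ map (\<lambda>_. 0) (es x)))
       (Pair (encode_list (bs x @ map (\<lambda>_. 0) (tl (es x)) @ [1])) (Num (d x))))))"
      by (intro ptime_Pair ptime_append zeros ptime_tl ptime_Cons ptime_Nil ptime_Num N K es bs d)
    thus "ptime D u (\<lambda>x. ?s x 0)"
      by (rule ptime_cong) (simp add: R0_def R1_def dd_def st_def s0_def cofactor_state_def map_replicate_const)
    show "ptime (SIGMA x:D. {..k x}) (\<lambda>y. ?s (fst y) (snd y))
        (\<lambda>y. Num (if int (K (fst y)) < int (length (R1 (fst y) (snd y))) then 1 else 0))"
      by (intro ptime_less ptime_length; (rule ptime_proj)+)
    let ?J = "SIGMA x:D. {..<k x}"
    let ?v = "\<lambda>y. ?s (fst y) (snd y)"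
    have v: "ptime ?J ?v (\<lambda>y. Num (N (fst y)))" "ptime ?J ?v (\<lambda>y. Num (int (K (fst y))))"
      "ptime ?J ?v (\<lambda>y. encode_list (R0 (fst y) (snd y)))" "ptime ?J ?v (\<lambda>y. encode_list (R1 (fst y) (snd y)))"
      "ptime ?J ?v (\<lambda>y. Num (dd (fst y) (snd y)))"
      by (rule ptime_proj)+
    have "ptime ?J ?v (\<lambda>y. case euclid_step (N (fst y)) (R0 (fst y) (snd y), R1 (fst y) (snd y), dd (fst y) (snd y)) of
      (xs', ys', d') \<Rightarrow> Pair (encode_list xs') (Pair (encode_list ys') (Num d')))"
    proof (rule ptime_euclid_step[OF v(1,3,4,5)])
      fix y assume y: "y \<in> ?J"
      hence "K (fst y) < length (R1 (fst y) (snd y))" using tm(2)[of "fst y" "snd y"] unfolding R1_def by auto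
      hence "R1 (fst y) (snd y) \<noteq> []" by auto
      thus "N (fst y) > 0 \<and> R1 (fst y) (snd y) \<noteq> [] \<and> set (R1 (fst y) (snd y)) \<subseteq> {0..<N (fst y)}"
        using y b[of "fst y" "snd y"] D[of "fst y"] by fastforce
    qed
    moreover have "(case euclid_step (N x) (R0 x i, R1 x i, dd x i) of
      (xs', ys', d') \<Rightarrow> Pair (encode_list xs') (Pair (encode_list ys') (Num d'))) = ?e x (Suc i)" for x i
    proof -
      have "euclid_step (N x) (R0 x i, R1 x i, dd x i) = (R0 x (Suc i), R1 x (Suc i), dd x (Suc i))"
        unfolding st[symmetric] by (simp add: st_def)
      thus ?thesis by (simp del: euclid_step.simps)
    qed
    ultimately have "ptime ?J ?v (\<lambda>y. ?e (fst y) (Suc (snd y)))" by (simp del: euclid_step.simps)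
    from ptime_Pair[OF v(1) ptime_Pair[OF v(2) this]]
    show "ptime ?J ?v (\<lambda>y. ?s (fst y) (Suc (snd y)))" .
    show "(if int (K x) < int (length (R1 x i)) then 1 else 0 :: int) \<noteq> 0 \<longleftrightarrow> i < k x"
      if "x \<in> D" "i \<le> k x" for x i
      using tm(1)[OF that(1)] tm(2)[OF that(1), of i] that(2) unfolding R1_def by (cases "i = k x") auto
    have "psize D u (\<lambda>x. 8 * K x + 1)"
      unfolding K_def by (intro pbounded_add pbounded_mult pbounded_const psize_length es)
    thus "psize D u k"
    proof (rule pbounded_mono)
      fix x assume x: "x \<in> D"
      have "euclid_measure (s0 x) \<le> 8 * K x + 1"
        using b[OF x, of 0] st[of x 0] by (simp add: st_def)
      thus "k x \<le> 8 * K x + 1" using tm(4)[OF x] by simp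
    qed
    let ?b = "\<lambda>x. 2 + 2 * K x * (1 + bitsize (Num (N x)))"
    show "psize D u (\<lambda>x. 1 + bitsize (Num (N x)) + (1 + bitsize (Num (int (K x))) +
        (1 + ?b x + (1 + ?b x + bitsize (Num (N x))))))"
      using ptime_size[OF K] psize_length[OF es] ptime_size[OF N] unfolding K_def
      by (intro pbounded_add pbounded_mult pbounded_const)
    fix x i assume x: "x \<in> D" "i \<le> k x"
    have "bitsize (encode_list (R0 x i)) \<le> ?b x" "bitsize (encode_list (R1 x i)) \<le> ?b x"
      using b[OF x] by (intro bitsize_entries_le; blast)+
    moreover have "bitsize (Num (dd x i)) \<le> bitsize (Num (N x))"
      using b[OF x] by (intro bitsize_Num_mono) simp
    ultimately show "bitsize (?s x i) \<le> 1 + bitsize (Num (N x)) + (1 + bitsize (Num (int (K x))) +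
        (1 + ?b x + (1 + ?b x + bitsize (Num (N x)))))"
      unfolding bitsize.simps(2) by linarith
  qed
  from ptime_snd[OF ptime_snd[OF ptime_snd[OF this]]] show ?thesis
  proof (rule ptime_cong)
    fix x
    have "cofactor (N x) (bs x) (es x, d x) = (R1 x (k x), dd x (k x))"
      unfolding cofactor_def R1_def dd_def st_def k_def s0_def K_def by (simp add: Let_def)
    thus "(case cofactor (N x) (bs x) (es x, d x) of (es', d') \<Rightarrow> Pair (encode_list es') (Num d'))
      = Pair (encode_list (R1 x (k x))) (Num (dd x (k x)))" by simp
  qed
qed

lemma ptime_cofactor_iteration:
  assumes N: "ptime D u (\<lambda>x. Num (N x))" and bs: "ptime D u (\<lambda>x. encode_list (bs x))"
    and ys: "ptime D u (\<lambda>x. encode_list (ys x))"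
    and D: "\<And>x. x \<in> D \<Longrightarrow> N x > 1 \<and> ys x \<noteq> [] \<and> set (bs x) \<subseteq> {0..<N x} \<and> length (bs x) = length (ys x) - 1"
  shows "ptime D u (\<lambda>x. case cofactor_iteration (N x) (bs x) (ys x) (length (ys x)) of (es, d) \<Rightarrow>
    Pair (encode_list es) (Num d))"
proof -
  define es d where "es x i = fst (cofactor_iteration (N x) (bs x) (ys x) i)"
    and "d x i = snd (cofactor_iteration (N x) (bs x) (ys x) i)" for x i
  have it: "cofactor_iteration (N x) (bs x) (ys x) i = (es x i, d x i)" for x i
    unfolding es_def d_def by simp
  have b: "set (es x i) \<subseteq> {0..<N x} \<and> length (es x i) = length (ys x) \<and> 1 \<le> d x i \<and> d x i < N x \<and> d x i dvd N x"
    if "x \<in> D" for x i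
    by (rule cofactor_iteration_bounds[OF _ _ _ _ it]) (use D[OF that] in auto)
  let ?acc = "\<lambda>x i. Pair (encode_list (es x i)) (Num (d x i))"
  let ?env = "\<lambda>x. Pair (Num (N x)) (encode_list (bs x))"
  have "ptime D u (\<lambda>x. ?acc x (length (ys x)))"
  proof (rule ptime_fold[where acc = ?acc and env = ?env, OF ys])
    show "ptime D u ?env" by (intro ptime_Pair N bs)
    have "ptime D u (\<lambda>x. Pair (encode_list (map (\<lambda>c. c mod N x) (ys x))) (Num 1))"
      by (intro ptime_Pair ptime_Num ptime_map[OF ys N, where g = "\<lambda>x c. c mod N x"])
        (intro ptime_mod ptime_proj)
    thus "ptime D u (\<lambda>x. ?acc x 0)" by (simp add: es_def d_def cofactor_iteration_def)
    let ?J = "SIGMA x:D. {..<length (ys x)}"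
    let ?v = "\<lambda>y. Pair (?env (fst y)) (Pair (?acc (fst y) (snd y)) (Num (ys (fst y) ! snd y)))"
    have v: "ptime ?J ?v (\<lambda>y. ?env (fst y))" "ptime ?J ?v (\<lambda>y. ?acc (fst y) (snd y))"
      by (rule ptime_proj)+
    have "ptime ?J ?v (\<lambda>y. case cofactor (N (fst y)) (bs (fst y)) (es (fst y) (snd y), d (fst y) (snd y)) of
       (es', d') \<Rightarrow> Pair (encode_list es') (Num d'))"
    proof (rule ptime_cofactor[OF ptime_fst[OF v(1)] ptime_snd[OF v(1)] ptime_fst[OF v(2)] ptime_snd[OF v(2)]])
      fix y assume "y \<in> ?J"
      hence y: "fst y \<in> D" by auto
      have "es (fst y) (snd y) \<noteq> []" using b[OF y, of "snd y"] D[OF y] by auto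
      thus "N (fst y) > 1 \<and> es (fst y) (snd y) \<noteq> [] \<and> set (es (fst y) (snd y)) \<subseteq> {0..<N (fst y)} \<and>
        set (bs (fst y)) \<subseteq> {0..<N (fst y)} \<and> length (bs (fst y)) = length (es (fst y) (snd y)) - 1 \<and>
        1 \<le> d (fst y) (snd y) \<and> d (fst y) (snd y) < N (fst y) \<and> d (fst y) (snd y) dvd N (fst y)"
        using b[OF y, of "snd y"] D[OF y] by simp
    qed
    moreover have "cofactor (N x) (bs x) (es x i, d x i) = (es x (Suc i), d x (Suc i))" for x i
      unfolding it[symmetric] by (simp add: cofactor_iteration_def)
    ultimately show "ptime ?J ?v (\<lambda>y. ?acc (fst y) (Suc (snd y)))" by simp
    let ?b = "\<lambda>x. 1 + (2 + length (ys x) * (1 + bitsize (Num (N x)))) + bitsize (Num (N x))"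
    show "psize D u ?b"
      by (intro pbounded_add pbounded_mult pbounded_const ptime_size psize_length N ys)
    fix x i assume x: "x \<in> D"
    have "bitsize (encode_list (es x i)) \<le> 2 + length (ys x) * (1 + bitsize (Num (N x)))"
      using b[OF x, of i] by (intro bitsize_entries_le) auto
    moreover have "bitsize (Num (d x i)) \<le> bitsize (Num (N x))"
      using b[OF x, of i] by (intro bitsize_Num_mono) simp
    ultimately show "bitsize (?acc x i) \<le> ?b x" unfolding bitsize.simps(2) by linarith
  qed
  thus ?thesis by (rule ptime_cong) (simp add: it)
qed

lemma coeffs_desc_poly: "xs \<noteq> [] \<Longrightarrow> hd xs \<noteq> 0 \<Longrightarrow> coeffs (desc_poly xs) = rev xs"
  by (cases xs) (simp_all add: desc_poly_def strip_while_def)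

lemma ptime_uminus: "ptime D u (\<lambda>x. Num (k x)) \<Longrightarrow> ptime D u (\<lambda>x. Num (- k x))"
  using ptime_diff[OF ptime_Num[of D u 0]] by fastforce

lemma ptime_find_lift:
  assumes D: "\<And>f N a. (f, N, a) \<in> D \<Longrightarrow> N > 1 \<and> lead_coeff f = 1 \<and> lead_coeff a = 1 \<and>
      Polynomial.degree a \<le> Polynomial.degree f"
  shows "ptime D (\<lambda>(f, N, a). encode_input f N a) (\<lambda>(f, N, a). encode_output (find_lift f N a))"
proof -
  let ?u = "\<lambda>(f, N, a). encode_input f N a"
  define N where "N = (\<lambda>x :: int poly \<times> int \<times> int poly. fst (snd x))"
  define xs ys where "xs = (\<lambda>x :: int poly \<times> int \<times> int poly. rev (coeffs (fst x)))"
    and "ys = (\<lambda>x :: int poly \<times> int \<times> int poly. rev (coeffs (snd (snd x))))"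
  define bs where "bs x = division_quotient (N x) (ys x) (xs x)" for x
  define es d where "es x = fst (cofactor_iteration (N x) (bs x) (ys x) (length (ys x)))"
    and "d x = snd (cofactor_iteration (N x) (bs x) (ys x) (length (ys x)))" for x
  have u: "?u = (\<lambda>x. Pair (encode_list (coeffs (fst x))) (Pair (Num (N x)) (encode_list (coeffs (snd (snd x))))))"
    by (auto simp: encode_input_def encode_poly_def N_def)
  have pN: "ptime D ?u (\<lambda>x. Num (N x))" and pf: "ptime D ?u (\<lambda>x. encode_list (coeffs (fst x)))"
    and pa: "ptime D ?u (\<lambda>x. encode_list (coeffs (snd (snd x))))"
    unfolding u by (rule ptime_proj)+
  have pxs: "ptime D ?u (\<lambda>x. encode_list (xs x))" and pys: "ptime D ?u (\<lambda>x. encode_list (ys x))"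
    unfolding xs_def ys_def by (intro ptime_rev pf pa)+
  have ys: "ys x \<noteq> []" "hd (ys x) = 1" "length (ys x) \<le> length (xs x) + 1" and N: "N x > 1" if "x \<in> D" for x
    using D[of "fst x" "fst (snd x)" "snd (snd x)"] that rev_coeffs_monic[of "snd (snd x)"] rev_coeffs_monic[of "fst x"]
    unfolding ys_def xs_def N_def by auto
  have pbs: "ptime D ?u (\<lambda>x. encode_list (bs x))"
    unfolding bs_def by (rule ptime_division_quotient[OF pN pys pxs]) (use ys N in fastforce)
  have bs: "set (bs x) \<subseteq> {0..<N x}" "length (bs x) = length (ys x) - 1" if "x \<in> D" for x
    unfolding bs_def using ys(3)[OF that] N[OF that]
    by (simp_all add: set_division_quotient length_division_quotient)
  have "ptime D ?u (\<lambda>x. case cofactor_iteration (N x) (bs x) (ys x) (length (ys x)) of (es, d) \<Rightarrow>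
      Pair (encode_list es) (Num d))"
    by (rule ptime_cofactor_iteration[OF pN pbs pys]) (use ys N bs in blast)
  hence it: "ptime D ?u (\<lambda>x. Pair (encode_list (es x)) (Num (d x)))"
    unfolding es_def d_def case_prod_beta .
  have len: "length (es x) = length (ys x)" if x: "x \<in> D" for x
    using cofactor_iteration_bounds[OF N[OF x] ys(1)[OF x] bs[OF x] surjective_pairing] unfolding es_def by blast
  have pes: "ptime D ?u (\<lambda>x. encode_list (es x))" by (rule ptime_fst[OF it])
  have nonempty: "es x \<noteq> []" if "x \<in> D" for x using len[OF that] ys(1)[OF that] by auto
  have adj: "ptime D ?u (\<lambda>x. encode_list (rev (adjusted (N x) (ys x) (es x))))"
    unfolding adjusted_def
    by (intro ptime_rev ptime_combine ptime_Num ptime_uminus pN pys pes ptime_hd nonempty)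
  have pt: "ptime D ?u (\<lambda>x. if d x = 1 then Pair (Num 1) (encode_list (rev (adjusted (N x) (ys x) (es x))))
      else Pair (Num 0) (Num (d x)))"
    by (intro ptime_if_eq ptime_Pair ptime_Num ptime_subset[OF adj] ptime_subset[OF ptime_snd[OF it]]
        ptime_snd[OF it]) auto
  show ?thesis
  proof (rule ptime_cong[OF pt])
    fix x assume x: "x \<in> D"
    have "coeffs (desc_poly (adjusted (N x) (ys x) (es x))) = rev (adjusted (N x) (ys x) (es x))"
      using hd_adjusted[OF ys(1,2)[OF x] len[OF x], of "N x"] by (intro coeffs_desc_poly) simp_all
    moreover have "find_lift (fst x) (N x) (snd (snd x)) = (if d x = 1 then Inr (desc_poly (adjusted (N x) (ys x) (es x))) else Inl (d x))"
      unfolding find_lift_def d_def es_def bs_def xs_def ys_def by (simp add: Let_def case_prod_beta)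
    ultimately show "(case x of (f, N, a) \<Rightarrow> encode_output (find_lift f N a)) =
       (if d x = 1 then Pair (Num 1) (encode_list (rev (adjusted (N x) (ys x) (es x)))) else Pair (Num 0) (Num (d x)))"
      by (simp add: case_prod_beta N_def encode_poly_def)
  qed
qed

theorem theorem3:
  shows "\<exists>(P :: prog) (T :: nat poly).
    \<forall>(f :: int poly) (N :: int) (a :: int poly).
      lead_coeff f = 1 \<and> Factorial_Ring.irreducible f \<and> monogenic f \<and>
      N > 0 \<and> \<not> perfect_power N \<and>
      lead_coeff a = 1 \<and> factor_mod N a f \<longrightarrow>
      (\<exists>(t :: nat) (r :: int + int poly).
         run P (encode_input f N a) t (encode_output r) \<and>
         t \<le> poly T (bitsize (encode_input f N a)) \<and>
         (case r of
            Inl d \<Rightarrow> 1 < d \<and> d < N \<and> d dvd N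
          | Inr a' \<Rightarrow>
              lead_coeff a' = 1 \<and>
              (\<forall>i. [Polynomial.coeff a i = Polynomial.coeff a' i] (mod N)) \<and>
              (\<exists>f1 A :: int poly. f = f1 * [:N:] + a' * A \<and> coprime_in_Zx a' f1 N)))"
proof -
  define D where "D = {(f, N, a). lead_coeff f = 1 \<and> monogenic f \<and> N > 1 \<and> lead_coeff a = 1 \<and> factor_mod N a f}"
  have "ptime D (\<lambda>(f, N, a). encode_input f N a) (\<lambda>(f, N, a). encode_output (find_lift f N a))"
  proof (rule ptime_find_lift)
    fix f a :: "int poly" and N :: int
    assume "(f, N, a) \<in> D"
    thus "N > 1 \<and> lead_coeff f = 1 \<and> lead_coeff a = 1 \<and> Polynomial.degree a \<le> Polynomial.degree f"
      unfolding D_def using factor_mod_degree by auto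
  qed
  then obtain P T where PT: "\<And>x. x \<in> D \<Longrightarrow> \<exists>t. run P ((\<lambda>(f, N, a). encode_input f N a) x) t
      ((\<lambda>(f, N, a). encode_output (find_lift f N a)) x) \<and> t \<le> poly T (bitsize ((\<lambda>(f, N, a). encode_input f N a) x))"
    unfolding ptime_def by blast
  show ?thesis
  proof (intro exI[of _ P] exI[of _ T] allI impI)
    fix f a :: "int poly" and N :: int
    assume *: "lead_coeff f = 1 \<and> Factorial_Ring.irreducible f \<and> monogenic f \<and>
      N > 0 \<and> \<not> perfect_power N \<and> lead_coeff a = 1 \<and> factor_mod N a f"
    \<comment> \<open>1 is a perfect power, so that residues modulo \<open>N\<close> form a non-trivial ring.\<close>
    have "perfect_power 1" unfolding perfect_power_def by (intro exI[of _ 2]) simp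
    hence "N \<noteq> 1" using * by blast
    hence N: "N > 1" using * by simp
    hence "(f, N, a) \<in> D" unfolding D_def using * by simp
    from PT[OF this] obtain t where "run P (encode_input f N a) t (encode_output (find_lift f N a))"
      "t \<le> poly T (bitsize (encode_input f N a))" by auto
    with find_lift_correct[of f N a] * N
    show "\<exists>t r. run P (encode_input f N a) t (encode_output r) \<and>
         t \<le> poly T (bitsize (encode_input f N a)) \<and>
         (case r of
            Inl d \<Rightarrow> 1 < d \<and> d < N \<and> d dvd N
          | Inr a' \<Rightarrow>
              lead_coeff a' = 1 \<and>
              (\<forall>i. [Polynomial.coeff a i = Polynomial.coeff a' i] (mod N)) \<and>
              (\<exists>f1 A :: int poly. f = f1 * [:N:] + a' * A \<and> coprime_in_Zx a' f1 N))"
      by blast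
  qed
qed

end
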